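(* Let $m\ge1$, $n\ge 2$, $\delta>0$, $E=(d_{kl})\in\mathbb{R}^{m\times m}$, and let $F=(f_1,\dots,f_m)^T:\mathbb{R}^m\to\mathbb{R}^m$ be sufficiently smooth. Consider the patch model $$\frac{du_k^{(j)}}{dt}=\delta\sum_{l=1}^m\sum_{i=1}^n d_{kl}\big(u_l^{(i)}-u_l^{(j)}\big)+f_k\big(u_1^{(j)},\dots,u_m^{(j)}\big),\quad k=1,\dots,m,\ j=1,\dots,n.$$ Suppose that $\phi$ is a periodic solution with minimum period $P>0$ of the kinetic system $\dot U=F(U)$, $U\in\mathbb{R}^m$, such that the Floquet multipliers $\gamma_1,\dots,\gamma_m$ of the linearized system $\dot U=F_U(\phi(t))U$ satisfy $\gamma_1=1$ and $|\gamma_i|<1$ for $i=2,\dots,m$. Let $P(\epsilon)$ denote the period function of the periodic solutions bifurcating from $\phi$ in the perturbed system $(I_m+\epsilon E)\dot U=F(U)$ for small $|\epsilon|$. If $P'(0)<0$, then for sufficiently small $\delta>0$ the synchronous periodic solution $\mathcal U_0(t)=(\phi(t)^T,\dots,\phi(t)^T)^T$ (in which $(u_1^{(j)},\dots,u_m^{(j)})^T=\phi(t)$ for every $j$) is unstable with respect to the patch model.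
   Context: Under the Floquet multiplier hypothesis, $\phi$ is hyperbolic, so for small $|\epsilon|$ the perturbed system has a unique family of periodic solutions $\phi_\epsilon$ bifurcating from $\phi$ with minimum period $P(\epsilon)$, and $P$ is continuously differentiable near $0$; $P'(0)$ is its derivative at $0$. *)

theory Defs
  imports "HOL-Analysis.Analysis" "HOL-Computational_Algebra.Polynomial"
begin

definition C2_map :: "('a::euclidean_space \<Rightarrow> 'a) \<Rightarrow> ('a \<Rightarrow> 'a \<Rightarrow>\<^sub>L 'a) \<Rightarrow> bool" where
  "C2_map F F' \<longleftrightarrow> (\<forall>x. (F has_derivative blinfun_apply (F' x)) (at x)) \<and>
     (\<exists>F''. continuous_on UNIV F'' \<and> (\<forall>x. (F' has_derivative blinfun_apply (F'' x)) (at x)))"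

definition periodic_solution ::
  "real^'m^'m \<Rightarrow> (real^'m \<Rightarrow> real^'m) \<Rightarrow> (real \<Rightarrow> real^'m) \<Rightarrow> real \<Rightarrow> bool" where
  "periodic_solution M G x p \<longleftrightarrow> p > 0 \<and>
     (\<forall>t. \<exists>v. (x has_vector_derivative v) (at t) \<and> M *v v = G (x t)) \<and>
     (\<forall>t. x (t + p) = x t) \<and>
     (\<forall>q. 0 < q \<and> q < p \<longrightarrow> (\<exists>t. x (t + q) \<noteq> x t))"

definition fundamental_matrix :: "(real \<Rightarrow> real^'m^'m) \<Rightarrow> (real \<Rightarrow> real^'m^'m) \<Rightarrow> bool" where
  "fundamental_matrix A \<Phi> \<longleftrightarrow> \<Phi> 0 = mat 1 \<and> (\<forall>t. (\<Phi> has_vector_derivative (A t ** \<Phi> t)) (at t))"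

definition char_poly_cmat :: "real^'m^'m \<Rightarrow> complex poly" where
  "char_poly_cmat M = det (\<chi> i j. (if i = j then [:0, 1:] else 0) - [:complex_of_real (M $ i $ j):])"

definition floquet_hyp :: "(real \<Rightarrow> real^'m^'m) \<Rightarrow> real \<Rightarrow> bool" where
  "floquet_hyp A p \<longleftrightarrow> (\<exists>\<Phi>. fundamental_matrix A \<Phi> \<and>
     order 1 (char_poly_cmat (\<Phi> p)) = 1 \<and>
     (\<forall>z. poly (char_poly_cmat (\<Phi> p)) z = 0 \<longrightarrow> z = 1 \<or> cmod z < 1))"

definition is_period_function ::
  "(real^'m \<Rightarrow> real^'m) \<Rightarrow> real^'m^'m \<Rightarrow> (real \<Rightarrow> real^'m) \<Rightarrow> real \<Rightarrow> (real \<Rightarrow> real) \<Rightarrow> bool" where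
  "is_period_function F E \<phi> P Pf \<longleftrightarrow> (\<exists>\<phi>e \<epsilon>0. \<epsilon>0 > 0 \<and> \<phi>e 0 = \<phi> \<and> Pf 0 = P \<and>
     (\<forall>e. \<bar>e\<bar> < \<epsilon>0 \<longrightarrow> periodic_solution (mat 1 + e *\<^sub>R E) F (\<phi>e e) (Pf e)) \<and>
     (\<forall>\<eta>>0. \<exists>\<rho>>0. \<forall>e. \<bar>e\<bar> < \<rho> \<longrightarrow> (\<forall>t\<in>{0..P}. dist (\<phi>e e t) (\<phi> t) < \<eta>)))"

text \<open>Right-hand side of the patch model; u $ j $ k = u_k^(j), d_kl = E $ k $ l.\<close>
definition patch_field ::
  "real \<Rightarrow> real^'m^'m \<Rightarrow> (real^'m \<Rightarrow> real^'m) \<Rightarrow> real^'m^'n \<Rightarrow> real^'m^'n" where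
  "patch_field \<delta> E F u = (\<chi> j k. \<delta> * (\<Sum>l\<in>UNIV. \<Sum>i\<in>UNIV. E $ k $ l * (u $ i $ l - u $ j $ l))
                                + F (u $ j) $ k)"

definition orbitally_stable :: "('a::real_normed_vector \<Rightarrow> 'a) \<Rightarrow> 'a set \<Rightarrow> bool" where
  "orbitally_stable G \<Gamma> \<longleftrightarrow> (\<forall>\<eta>>0. \<exists>\<rho>>0. \<forall>T y. T \<ge> 0 \<and>
      (\<forall>t\<in>{0..T}. (y has_vector_derivative G (y t)) (at t within {0..T})) \<and>
      infdist (y 0) \<Gamma> < \<rho> \<longrightarrow> (\<forall>t\<in>{0..T}. infdist (y t) \<Gamma> < \<eta>))"

end

theory Submission
  imports Defs "HOL-Complex_Analysis.Complex_Analysis" "HOL-Library.Periodic_Fun"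
begin

text \<open>
  A perturbation of the synchronous solution splits into its mean over the patches, which evolves by
  the linearized kinetic system \<open>x' = A(t) x\<close> with monodromy \<open>M 0\<close>, and the deviations from the
  mean, which evolve by \<open>x' = (A(t) - d E) x\<close> with \<open>d = n \<delta>\<close> and monodromy \<open>M d\<close>. Let \<open>q\<close> be the
  periodic solution of the adjoint equation with \<open>q \<bullet> \<phi>' = 1\<close> and let \<open>k\<close> be the integral of
  \<open>q \<bullet> E \<phi>'\<close> over one period. To first order the Floquet multiplier 1 of \<open>M 0\<close> moves to
  \<open>1 - d k\<close>. On the other hand, testing the perturbed kinetic system with \<open>q\<close> gives \<open>k = P'(0)\<close>, as
  hyperbolicity forces suitably shifted perturbed orbits to be \<open>O(\<epsilon>)\<close>-close to \<open>\<phi>\<close>. Hence \<open>M d\<close>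
  has a real eigenvalue larger than 1.

  For the nonlinear instability one compares solutions with the synchronous one at the multiples of
  the period. Since the growth rate of the deviations is larger than 1, it dominates the phase drift
  along the orbit, so no phase needs to be adjusted. The quadratic error terms are controlled by
  starting in directions, and stopping at times, for which the growth of the linear iteration is
  almost optimal.
\<close>

section \<open>Gronwall inequality and global solutions\<close>

text \<open>The hypothesis on the period function gives uniform convergence of the perturbed orbits,
  with neither a rate nor a phase. Pairing with \<open>q\<close> leaves a quadratic remainder, so
  the rate \<open>O(\<epsilon>)\<close> must be earned before \<open>P'(0)\<close> can be read off.
  The multiplier and the period then share the constant \<open>k\<close> because both first-order
  forcings are multiples of \<open>- E \<phi>'\<close>, paired with the same \<open>q\<close>. In
  the nonlinear step the mean of the perturbation keeps the multiplier 1, and the deviations may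
  have complex multipliers and Jordan blocks, so no dominant eigendirection is available. What is
  used instead is a lower rate \<open>a\<close> and an upper rate \<open>b\<close> with
  \<open>b < a\<^sup>2\<close>: an error that is quadratic in a quantity growing like
  \<open>a\<^sup>k\<close> stays negligible even if it is afterwards amplified at rate
  \<open>b\<close>. Escape from the whole orbit, not just from one point of it, is detected by the
  difference of two patches, which vanishes on every synchronous state. As \<open>F\<close> is only
  locally Lipschitz, it is modified outside a ball around the orbit so that solutions exist for all
  times.\<close>

text \<open>The additive constant \<open>c\<close> lets one statement serve for Lipschitz comparison
  (\<open>c = 0\<close>) and for forced equations. The factor \<open>c * t\<close> replaces the
  sharper quotient by \<open>K\<close>, so that \<open>K = 0\<close> is allowed.\<close>

lemma gronwall:
  fixes y :: "real \<Rightarrow> 'a::banach"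
  assumes deriv: "\<And>t. t \<in> {0..T} \<Longrightarrow> (y has_vector_derivative y' t) (at t within {0..T})"
    and bound: "\<And>t. t \<in> {0..T} \<Longrightarrow> norm (y' t) \<le> K * norm (y t) + c"
    and K: "K \<ge> 0" and c: "c \<ge> 0" and t: "t \<in> {0..T}"
  shows "norm (y t) \<le> (norm (y 0) + c * t) * exp (K * t)"
proof -
  have conty: "continuous_on {0..T} y"
    using deriv by (meson continuous_on_eq_continuous_within has_vector_derivative_continuous)
  then have contb: "continuous_on {0..T} (\<lambda>t. K * norm (y t) + c)"
    by (intro continuous_intros)
  define g where "g t = norm (y 0) + integral {0..t} (\<lambda>t. K * norm (y t) + c)" for t
  have yg: "norm (y s) \<le> g s" if s: "s \<in> {0..T}" for s
  proof -
    have "(y' has_integral (y s - y 0)) {0..s}"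
      using s by (intro fundamental_theorem_of_calculus)
        (auto intro: has_vector_derivative_within_subset[OF deriv])
    moreover have "norm (integral {0..s} y') \<le> integral {0..s} (\<lambda>t. K * norm (y t) + c)"
      using s bound calculation
      by (intro integral_norm_bound_integral)
        (auto simp: has_integral_iff intro!: integrable_continuous_interval
            continuous_on_subset[OF contb])
    ultimately have "norm (y s - y 0) \<le> integral {0..s} (\<lambda>t. K * norm (y t) + c)"
      by (simp add: has_integral_iff)
    moreover have "norm (y s) \<le> norm (y 0) + norm (y s - y 0)"
      by (metis add.commute diff_add_cancel norm_triangle_ineq)
    ultimately show ?thesis
      unfolding g_def by linarith
  qed
  have dg: "(g has_real_derivative (K * norm (y s) + c)) (at s within {0..T})" if "s \<in> {0..T}" for s
    unfolding g_def has_real_derivative_iff_has_vector_derivative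
    using integral_has_vector_derivative[OF contb that]
    by (auto intro!: derivative_eq_intros)
  \<comment> \<open>\<open>h\<close> is nonincreasing: the derivative of \<open>g\<close> is at most
    \<open>K * g + c\<close>, and \<open>c * exp (- K * s)\<close> is at most
    \<open>c\<close>.\<close>
  define h where "h s = g s * exp (- K * s) - c * s" for s
  have "h t \<le> h 0"
  proof (rule DERIV_nonpos_imp_decreasing_open[of 0 t h])
    show "0 \<le> t" using t by simp
    have dh: "(h has_real_derivative ((K * norm (y s) + c) * exp (- K * s) - K * g s * exp (- K * s) - c)) (at s within {0..T})"
      if "s \<in> {0..T}" for s
      unfolding h_def using that
      by (auto intro!: derivative_eq_intros dg simp: algebra_simps)
    show "continuous_on {0..t} h"
      by (rule continuous_on_subset[OF DERIV_continuous_on[OF dh]]) (use t in auto)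
    fix s assume s: "0 < s" "s < t"
    have "at s within {0..T} = at s"
      using s t by (intro at_within_interior) auto
    moreover have "((K * norm (y s) + c) * exp (- K * s) - K * g s * exp (- K * s) - c) \<le> 0"
    proof -
      have "K * norm (y s) \<le> K * g s"
        using yg[of s] s t K by (intro mult_left_mono) auto
      then have "K * norm (y s) * exp (- K * s) \<le> K * g s * exp (- K * s)"
        by (intro mult_right_mono) auto
      moreover have "c * exp (- K * s) \<le> c * 1"
        using K c s by (intro mult_left_mono) auto
      ultimately show ?thesis
        by (simp add: algebra_simps)
    qed
    ultimately show "\<exists>z. DERIV h s :> z \<and> z \<le> 0"
      using dh[of s] s t by auto
  qed
  moreover have "h 0 = norm (y 0)"
    by (simp add: h_def g_def)
  ultimately have "g t * exp (- K * t) \<le> norm (y 0) + c * t"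
    unfolding h_def by linarith
  then have "g t * exp (- K * t) * exp (K * t) \<le> (norm (y 0) + c * t) * exp (K * t)"
    by (intro mult_right_mono) auto
  then have "g t \<le> (norm (y 0) + c * t) * exp (K * t)"
    by (simp add: mult.assoc flip: exp_add)
  then show ?thesis
    using yg[OF t] by linarith
qed


text \<open>Writing a candidate as \<open>x0 + exp (lam * s) *\<^sub>R \<xi> s\<close> with
  \<open>\<xi>\<close> bounded turns the exponentially weighted sup norm into the norm of bounded
  continuous functions. A single contraction then covers the whole half-line, with no continuation
  argument. The bound along the constant \<open>x0\<close> keeps the images bounded.\<close>

lemma picard_global:
  fixes G :: "real \<Rightarrow> 'a::euclidean_space \<Rightarrow> 'a"
  assumes cont: "continuous_on UNIV (\<lambda>p. G (fst p) (snd p))"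
    and lip: "\<And>t x y. t \<ge> 0 \<Longrightarrow> norm (G t x - G t y) \<le> K * norm (x - y)"
    and bnd: "\<And>t. t \<ge> 0 \<Longrightarrow> norm (G t x0) \<le> B"
    and K: "K > 0"
  obtains x where "x 0 = x0"
    "\<And>t. t \<ge> 0 \<Longrightarrow> (x has_vector_derivative G t (x t)) (at t within {0..})"
proof -
  \<comment> \<open>The contraction factor is \<open>K / lam\<close>, hence 1/2.\<close>
  define lam where "lam = 2 * K"
  have lam: "lam > 0" using K by (simp add: lam_def)
  have B0: "B \<ge> 0" using bnd[of 0] norm_ge_zero order_trans by blast
  define X where "X \<xi> s = x0 + exp (lam * s) *\<^sub>R apply_bcontfun \<xi> s" for \<xi> :: "real \<Rightarrow>\<^sub>C 'a" and s
  define I where "I \<xi> t = integral {0..t} (\<lambda>s. G s (X \<xi> s))" for \<xi> t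
  \<comment> \<open>Bounded continuous functions are defined on the whole line;
    \<open>max 0 t\<close> extends the image constantly to negative times.\<close>
  define J where "J \<xi> t = exp (- lam * max 0 t) *\<^sub>R I \<xi> (max 0 t)" for \<xi> t
  have contX: "continuous_on S (X \<xi>)" for S \<xi>
    unfolding X_def by (intro continuous_intros continuous_on_apply_bcontfun continuous_on_id) 
  have contG: "continuous_on S (\<lambda>s. G s (X \<xi> s))" for S \<xi>
    using continuous_on_compose2[OF cont, of S "\<lambda>s. (s, X \<xi> s)"]
      continuous_on_Pair[OF continuous_on_id contX] by auto
  have intG: "(\<lambda>s. G s (X \<xi> s)) integrable_on {0..t}" for \<xi> t
    using contG by (rule integrable_continuous_interval)
  have contI: "continuous_on {0..} (I \<xi>)" for \<xi>
  proof -
    have "continuous_on {0..t} (I \<xi>)" for t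
      unfolding I_def using intG by (rule indefinite_integral_continuous_1)
    then have "continuous (at t within {0..}) (I \<xi>)" if "t \<ge> 0" for t
    proof -
      have "continuous (at t within {0..t+1}) (I \<xi>)"
        using \<open>continuous_on {0..t+1} (I \<xi>)\<close> that by (auto simp: continuous_on_eq_continuous_within)
      moreover have "at t within {0..t+1} = at t within {0..}"
        using that by (intro at_within_nhd[of _ "{..<t+1}"]) auto
      ultimately show ?thesis by simp
    qed
    then show ?thesis by (auto simp: continuous_on_eq_continuous_within)
  qed
  have contJ: "continuous_on UNIV (J \<xi>)" for \<xi>
  proof -
    have "continuous_on UNIV (\<lambda>t. I \<xi> (max 0 t))"
      by (rule continuous_on_compose2[OF contI]) (auto intro!: continuous_intros)
    then show ?thesis unfolding J_def by (intro continuous_intros)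
  qed
  have expint: "((\<lambda>s. exp (lam * s)) has_integral ((exp (lam * t) - 1) / lam)) {0..t}" if "t \<ge> 0" for t
  proof -
    have "((\<lambda>s. exp (lam * s)) has_integral (exp (lam * t) / lam - exp (lam * 0) / lam)) {0..t}"
      using that lam by (intro fundamental_theorem_of_calculus)
        (auto intro!: derivative_eq_intros simp flip: has_real_derivative_iff_has_vector_derivative)
    then show ?thesis by (simp add: diff_divide_distrib)
  qed
  have Gbound: "norm (G s (X \<xi> s)) \<le> B + K * exp (lam * s) * norm \<xi>" if "s \<ge> 0" for \<xi> s
  proof -
    have "norm (G s (X \<xi> s) - G s x0) \<le> K * norm (X \<xi> s - x0)"
      using lip that by blast
    also have "\<dots> = K * (exp (lam * s) * norm (apply_bcontfun \<xi> s))" by (simp add: X_def)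
    also have "\<dots> \<le> K * (exp (lam * s) * norm \<xi>)"
      using K by (intro mult_left_mono norm_bounded) auto
    finally have "norm (G s (X \<xi> s) - G s x0) \<le> K * exp (lam * s) * norm \<xi>" by simp
    moreover have "norm (G s (X \<xi> s)) \<le> norm (G s x0) + norm (G s (X \<xi> s) - G s x0)"
      by (metis add.commute diff_add_cancel norm_triangle_ineq)
    ultimately show ?thesis using bnd[OF that] by linarith
  qed
  have bddJ: "norm (J \<xi> t) \<le> B / lam + K / lam * norm \<xi>" for \<xi> t
  proof -
    define u where "u = max 0 t"
    have u: "u \<ge> 0" unfolding u_def by (rule max.cobounded1)
    have "((\<lambda>s. B + K * norm \<xi> * exp (lam * s)) has_integral (B * u + K * norm \<xi> * ((exp (lam * u) - 1) / lam))) {0..u}"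
      using u by (intro has_integral_add has_integral_mult_right expint has_integral_const_real[THEN has_integral_eq_rhs]) auto
    then have int: "(\<lambda>s. B + K * norm \<xi> * exp (lam * s)) integrable_on {0..u}"
      "integral {0..u} (\<lambda>s. B + K * norm \<xi> * exp (lam * s)) = B * u + K * norm \<xi> * ((exp (lam * u) - 1) / lam)"
      by (auto simp: has_integral_iff)
    have "norm (I \<xi> u) \<le> integral {0..u} (\<lambda>s. B + K * norm \<xi> * exp (lam * s))"
      unfolding I_def using Gbound[of _ \<xi>]
      by (intro integral_norm_bound_integral intG int(1)) (auto simp: mult_ac)
    also have "\<dots> = B * u + K * norm \<xi> * ((exp (lam * u) - 1) / lam)"
      by (rule int(2))
    also have "\<dots> \<le> B * (exp (lam * u) / lam) + K * norm \<xi> * (exp (lam * u) / lam)"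
    proof (intro add_mono mult_left_mono)
      have "1 + lam * u \<le> exp (lam * u)" by (rule exp_ge_add_one_self)
      then have "lam * u \<le> exp (lam * u)" by linarith
      then show "u \<le> exp (lam * u) / lam" using lam by (simp add: pos_le_divide_eq mult.commute)
      show "(exp (lam * u) - 1) / lam \<le> exp (lam * u) / lam" using lam by (simp add: divide_simps)
    qed (use B0 K in auto)
    finally have "norm (I \<xi> u) \<le> (B / lam + K / lam * norm \<xi>) * exp (lam * u)"
      by (simp add: algebra_simps)
    then have "exp (- lam * u) * norm (I \<xi> u) \<le> exp (- lam * u) * ((B / lam + K / lam * norm \<xi>) * exp (lam * u))"
      by (intro mult_left_mono) auto
    also have "\<dots> = (B / lam + K / lam * norm \<xi>)"
      by (simp add: exp_minus field_simps)
    finally show ?thesis by (simp add: J_def u_def)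
  qed
  have Jb: "J \<xi> \<in> bcontfun" for \<xi>
    using contJ bddJ by (auto simp: bcontfun_def intro!: boundedI)
  have contr: "dist (Bcontfun (J \<xi>)) (Bcontfun (J \<zeta>)) \<le> 1/2 * dist \<xi> \<zeta>" for \<xi> \<zeta>
  proof (rule dist_bound)
    fix t :: real
    define u where "u = max 0 t"
    have u: "u \<ge> 0" unfolding u_def by (rule max.cobounded1)
    have le: "norm (G s (X \<xi> s) - G s (X \<zeta> s)) \<le> K * dist \<xi> \<zeta> * exp (lam * s)" if "s \<in> {0..u}" for s
    proof -
      have "norm (G s (X \<xi> s) - G s (X \<zeta> s)) \<le> K * norm (X \<xi> s - X \<zeta> s)"
        using lip that by auto
      also have "X \<xi> s - X \<zeta> s = exp (lam * s) *\<^sub>R (apply_bcontfun \<xi> s - apply_bcontfun \<zeta> s)"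
        by (simp add: X_def algebra_simps)
      also have "K * norm \<dots> = K * (dist (apply_bcontfun \<xi> s) (apply_bcontfun \<zeta> s) * exp (lam * s))"
        by (simp add: dist_norm)
      also have "\<dots> \<le> K * (dist \<xi> \<zeta> * exp (lam * s))"
        using K by (intro mult_left_mono mult_right_mono dist_bounded) auto
      finally show ?thesis by simp
    qed
    have "I \<xi> u - I \<zeta> u = integral {0..u} (\<lambda>s. G s (X \<xi> s) - G s (X \<zeta> s))"
      unfolding I_def by (intro Henstock_Kurzweil_Integration.integral_diff[symmetric] intG)
    also have "norm \<dots> \<le> K * dist \<xi> \<zeta> * ((exp (lam * u) - 1) / lam)"
    proof -
      have int: "((\<lambda>s. K * dist \<xi> \<zeta> * exp (lam * s)) has_integral K * dist \<xi> \<zeta> * ((exp (lam * u) - 1) / lam)) {0..u}"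
        by (intro has_integral_mult_right expint u)
      show ?thesis
        unfolding has_integral_iff[THEN iffD1, OF int, THEN conjunct2, symmetric]
        using int le
        by (intro integral_norm_bound_integral Henstock_Kurzweil_Integration.integrable_diff intG)
          (auto simp: has_integral_iff)
    qed
    also have "\<dots> \<le> K * dist \<xi> \<zeta> * (exp (lam * u) / lam)"
      using K lam by (intro mult_left_mono divide_right_mono) auto
    also have "\<dots> = 1/2 * dist \<xi> \<zeta> * exp (lam * u)"
      using K by (simp add: lam_def)
    finally have "exp (- lam * u) * norm (I \<xi> u - I \<zeta> u) \<le> exp (- lam * u) * (1/2 * dist \<xi> \<zeta> * exp (lam * u))"
      by (intro mult_left_mono) auto
    also have "\<dots> = 1/2 * dist \<xi> \<zeta>" by (simp add: exp_minus field_simps)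
    finally show "dist (apply_bcontfun (Bcontfun (J \<xi>)) t) (apply_bcontfun (Bcontfun (J \<zeta>)) t) \<le> 1/2 * dist \<xi> \<zeta>"
      by (simp add: Bcontfun_inverse[OF Jb] J_def dist_norm u_def flip: scaleR_diff_right)
  qed
  have "\<exists>!\<xi>. Bcontfun (J \<xi>) = \<xi>"
    by (rule banach_fix_type[of "1/2"]) (use contr in auto)
  then obtain \<xi> where "Bcontfun (J \<xi>) = \<xi>" by blast
  then have fixp: "apply_bcontfun \<xi> = J \<xi>"
    by (metis Bcontfun_inverse Jb)
  have eq: "X \<xi> t = x0 + I \<xi> t" if "t \<ge> 0" for t
    using that by (simp add: X_def fixp J_def exp_minus)
  show ?thesis
  proof
    show "X \<xi> 0 = x0" by (simp add: eq I_def)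
    fix t :: real assume t: "t \<ge> 0"
    have "((\<lambda>t. x0 + I \<xi> t) has_vector_derivative G t (X \<xi> t)) (at t within {0..t+1})"
      unfolding I_def using integral_has_vector_derivative[OF contG, of t 0 "t+1"] t
      by (auto intro!: derivative_eq_intros)
    moreover have "at t within {0..t+1} = at t within {0..}"
      using t by (intro at_within_nhd[of _ "{..<t+1}"]) auto
    ultimately have "((\<lambda>t. x0 + I \<xi> t) has_vector_derivative G t (X \<xi> t)) (at t within {0..})"
      by simp
    then show "(X \<xi> has_vector_derivative G t (X \<xi> t)) (at t within {0..})"
      by (rule has_vector_derivative_transform[rotated 2]) (use t eq in auto)
  qed
qed

section \<open>Characteristic roots\<close>

lemma poly_det:
  fixes A :: "'a::comm_ring_1 poly^'n^'n"
  shows "poly (det A) z = det (\<chi> i j. poly (A $ i $ j) z)"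
  by (simp add: det_def poly_sum poly_prod)

definition cmat :: "real^'n^'m \<Rightarrow> complex^'n^'m" where
  "cmat M = (\<chi> i j. complex_of_real (M $ i $ j))"

definition cvec :: "real^'n \<Rightarrow> complex^'n" where
  "cvec v = (\<chi> i. complex_of_real (v $ i))"

lemma poly_char_poly_cmat: "poly (char_poly_cmat M) z = det (mat z - cmat M)"
  unfolding char_poly_cmat_def poly_det
  by (rule arg_cong[where f = det]) (simp add: vec_eq_iff mat_def cmat_def)

lemma det_of_real:
  "det (\<chi> i j. complex_of_real (B i j) :: complex^'n^'n) = of_real (det (\<chi> i j. B i j :: real^'n^'n))"
  by (simp add: det_def)

lemma poly_char_poly_cmat_real:
  "poly (char_poly_cmat M) (of_real x) = of_real (det (mat x - M))"
proof -
  have "mat (of_real x) - cmat M = (\<chi> i j. complex_of_real ((mat x - M) $ i $ j))"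
    by (simp add: vec_eq_iff mat_def cmat_def)
  then show ?thesis
    by (simp add: poly_char_poly_cmat det_of_real del: vector_minus_component)
qed

lemma mat_vector_mult: "mat c *v v = c *s v"
  by (simp add: matrix_vector_mult_def mat_def vec_eq_iff mult_delta_left)

lemma eigenvalue_imp_char_root:
  fixes M :: "real^'n^'n"
  assumes "M *v v = x *\<^sub>R v" "v \<noteq> 0"
  shows "poly (char_poly_cmat M) (of_real x) = 0"
proof -
  have "(mat x - M) *v v = 0"
    using assms by (simp add: matrix_vector_mult_diff_rdistrib mat_vector_mult scalar_mult_eq_scaleR)
  then have "\<not> invertible (mat x - M)"
    using assms(2) by (metis invertible_left_inverse matrix_left_invertible_ker)
  then show ?thesis
    by (simp add: poly_char_poly_cmat_real invertible_det_nz)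
qed


text \<open>A real number above the operator norm is not an eigenvalue. This is what licenses the
  factorisation of the polynomial according to the \<open>order\<close> of a root.\<close>

lemma char_poly_cmat_nonzero: "char_poly_cmat M \<noteq> 0"
proof -
  define x where "x = onorm (\<lambda>v. M *v v) + 1"
  have "v = 0" if "(mat x - M) *v v = 0" for v
  proof -
    have "M *v v = x *\<^sub>R v"
      using that by (simp add: matrix_vector_mult_diff_rdistrib mat_vector_mult scalar_mult_eq_scaleR)
    then have "\<bar>x\<bar> * norm v \<le> (x - 1) * norm v"
      using onorm[OF matrix_vector_mul_bounded_linear, of M v] by (simp add: x_def)
    moreover have "x \<ge> 0"
      using onorm_pos_le[OF matrix_vector_mul_bounded_linear, of M] by (simp add: x_def)
    ultimately have "norm v \<le> 0" by (simp add: algebra_simps)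
    then show "v = 0" by simp
  qed
  then have "invertible (mat x - M)"
    by (metis invertible_left_inverse matrix_left_invertible_ker)
  then have "poly (char_poly_cmat M) (of_real x) \<noteq> 0"
    by (simp add: poly_char_poly_cmat_real invertible_det_nz)
  then show ?thesis by auto
qed

text \<open>If \<open>v\<close> were independent of \<open>u\<close>, one could replace two columns of the identity by \<open>u\<close> and
  \<open>v\<close> to get an invertible matrix \<open>S\<close>; in the two corresponding columns of \<open>(x - M) S\<close> one sees the
  factor \<open>(x - 1)\<^sup>2\<close> of its determinant.\<close>

lemma simple_root_imp_no_jordan_chain:
  fixes M :: "real^'n^'n"
  assumes order: "order 1 (char_poly_cmat M) = 1"
    and u: "M *v u = u" "u \<noteq> 0" and v: "M *v v - v = b *\<^sub>R u"
  shows "\<exists>c. v = c *\<^sub>R u"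
proof (rule ccontr)
  assume indep: "\<nexists>c. v = c *\<^sub>R u"
  obtain i where i: "u $ i \<noteq> 0" using u(2) by (auto simp: vec_eq_iff)
  have "\<exists>j. u $ i * v $ j \<noteq> u $ j * v $ i"
  proof (rule ccontr)
    assume "\<not> ?thesis"
    then have "v = (v $ i / u $ i) *\<^sub>R u"
      using i by (auto simp: vec_eq_iff field_simps)
    then show False using indep by blast
  qed
  then obtain j where j: "u $ i * v $ j \<noteq> u $ j * v $ i" by blast
  then have ij: "i \<noteq> j" by auto
  define R where "R k = (if k = i then u else if k = j then v else axis k 1)" for k
  \<comment> \<open>The vectors are stored as rows, so that the row rules for determinants apply;
    multiplication by the transpose of \<open>mat x - M\<close> then acts on each row
    separately.\<close>
  define S where "S = (\<chi> k. R k)"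
  have "det S \<noteq> 0"
  proof
    assume "det S = 0"
    then have "\<not> invertible (transpose S)"
      by (simp add: invertible_det_nz)
    then obtain c where c: "transpose S *v c = 0" "c \<noteq> 0"
      by (metis invertible_left_inverse matrix_left_invertible_ker)
    have eq: "(\<Sum>k\<in>UNIV. c $ k *\<^sub>R R k) = 0"
      using c(1) by (simp add: vec_eq_iff matrix_vector_mult_def transpose_def S_def mult.commute)
    have split: "(\<Sum>k\<in>UNIV. c $ k *\<^sub>R R k) = c $ i *\<^sub>R u + c $ j *\<^sub>R v + (\<Sum>k\<in>UNIV - {i, j}. c $ k *\<^sub>R axis k 1)"
      using ij by (subst sum.subset_diff[of "{i,j}"]) (auto simp: R_def add.commute intro!: sum.cong)
    have comp: "c $ i * u $ l + c $ j * v $ l + (if l \<in> {i, j} then 0 else c $ l) = 0" for l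
    proof -
      have "(\<Sum>k\<in>UNIV - {i, j}. c $ k * axis k 1 $ l) = (\<Sum>k\<in>UNIV - {i, j}. if k = l then c $ l else 0)"
        by (intro sum.cong) (auto simp: axis_def)
      then show ?thesis
        using arg_cong[OF eq, of "\<lambda>w. w $ l"] by (auto simp: split sum.delta split: if_splits)
    qed
    have e1: "c $ i * u $ i + c $ j * v $ i = 0" and e2: "c $ i * u $ j + c $ j * v $ j = 0"
      using comp[of i] comp[of j] by auto
    have "c $ j * (u $ i * v $ j - u $ j * v $ i) = 0" 
      using e1 e2 by algebra
    then have cj: "c $ j = 0" using j by simp
    then have ci: "c $ i = 0" using e1 i by simp
    have "c $ l = 0" for l using comp[of l] ci cj by (auto split: if_splits)
    then show False using c(2) by (simp add: vec_eq_iff)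
  qed
  define Q where "Q x k = (if k = i then u else if k = j then (x - 1) *\<^sub>R v - b *\<^sub>R u else x *\<^sub>R axis k 1 - M *v axis k 1)" for x k
  \<comment> \<open>What remains of the determinant after \<open>x - 1\<close> has been extracted
    from the rows \<open>i\<close> and \<open>j\<close>. Only its continuity at 1 matters.\<close>
  define g where "g x = det (\<chi> k. if k = j then v else Q x k)" for x :: real
  have key: "det (mat x - M) * det S = (x - 1)^2 * g x" for x
  proof -
    have row: "(S ** transpose (mat x - M)) $ k = x *\<^sub>R R k - M *v R k" for k
    proof -
      have "(S ** transpose (mat x - M)) $ k = (mat x - M) *v (S $ k)"
        by (simp add: vec_eq_iff matrix_matrix_mult_def matrix_vector_mult_def transpose_def mult.commute)
      also have "\<dots> = x *\<^sub>R R k - M *v R k"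
        by (simp add: S_def matrix_vector_mult_diff_rdistrib mat_vector_mult scalar_mult_eq_scaleR)
      finally show ?thesis .
    qed
    have Mv: "M *v v = v + b *\<^sub>R u" using v by (simp add: algebra_simps)
    have "det (mat x - M) * det S = det (S ** transpose (mat x - M))"
      by (simp add: det_mul)
    also have "S ** transpose (mat x - M) = (\<chi> k. if k = i then (x - 1) *s u else Q x k)"
    proof -
      have "x *\<^sub>R R k - M *v R k = (if k = i then (x - 1) *s u else Q x k)" for k
        using ij by (simp add: R_def Q_def u Mv scalar_mult_eq_scaleR scaleR_diff_left)
      then show ?thesis by (simp add: vec_eq_iff[of "S ** _"] row)
    qed
    also have "det \<dots> = (x - 1) * det (\<chi> k. if k = i then u else Q x k)"
      by (rule det_row_mul)
    also have "(\<chi> k. if k = i then u else Q x k) = (\<chi> k. if k = j then (x - 1) *s v + (- b) *s u else Q x k)"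
      using ij by (auto simp: vec_eq_iff Q_def left_diff_distrib)
    also have "det \<dots> = det (\<chi> k. if k = j then (x - 1) *s v else Q x k) + det (\<chi> k. if k = j then (- b) *s u else Q x k)"
      by (rule det_row_add)
    also have "det (\<chi> k. if k = j then (- b) *s u else Q x k) = (- b) * det (\<chi> k. if k = j then u else Q x k)"
      by (rule det_row_mul)
    also have "det (\<chi> k. if k = j then u else Q x k) = 0"
      by (rule det_identical_rows[OF ij]) (use ij in \<open>simp add: row_def Q_def\<close>)
    also have "det (\<chi> k. if k = j then (x - 1) *s v else Q x k) = (x - 1) * g x"
      unfolding g_def by (rule det_row_mul)
    finally show ?thesis by (simp add: power2_eq_square)
  qed
  have contg: "isCont g x" for x
  proof -
    have "isCont (\<lambda>x. (if k = j then v else Q x k) $ l) x" for k l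
      by (cases "k = j"; cases "k = i") (auto simp: Q_def intro!: continuous_intros)
    then show ?thesis
      unfolding g_def det_def vec_lambda_beta
      by (intro continuous_sum continuous_mult continuous_const continuous_prod)
  qed
  have nz: "char_poly_cmat M \<noteq> 0"
    by (rule char_poly_cmat_nonzero)
  obtain p where p: "char_poly_cmat M = [:-1, 1:] * p" "\<not> [:-1, 1:] dvd p"
    using order_decomp[OF nz, of 1] order by auto
  have p1: "poly p 1 \<noteq> 0" using p(2) by (simp add: poly_eq_0_iff_dvd)
  \<comment> \<open>After cancelling one factor \<open>x - 1\<close> another one is left on the
    right, so the cofactor \<open>p\<close> of the simple root would vanish in the limit at
    1.\<close>
  have eq: "poly p (of_real x) * of_real (det S) = of_real ((x - 1) * g x)" if "x \<noteq> 1" for x :: real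
  proof -
    have "of_real (x - 1) * (poly p (of_real x) * of_real (det S)) = of_real (x - 1) * (of_real ((x - 1) * g x) :: complex)"
      using poly_char_poly_cmat_real[of M x] arg_cong[OF key[of x], of complex_of_real]
      by (simp add: p(1) power2_eq_square algebra_simps)
    then show ?thesis using that by simp
  qed
  have "((\<lambda>x::real. poly p (of_real x) * of_real (det S)) \<longlongrightarrow> poly p (of_real 1) * of_real (det S)) (at 1)"
    by (intro tendsto_intros)
  moreover have "((\<lambda>x. complex_of_real ((x - 1) * g x)) \<longlongrightarrow> of_real ((1 - 1) * g 1)) (at 1)"
    using contg[of 1] by (intro tendsto_intros) (simp add: isCont_def)
  then have "((\<lambda>x::real. poly p (of_real x) * of_real (det S)) \<longlongrightarrow> of_real ((1 - 1) * g 1)) (at 1)"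
    by (rule Lim_transform_eventually) (auto simp: eventually_at_filter eq)
  ultimately have "poly p (of_real 1) * of_real (det S) = of_real ((1 - 1) * g 1)"
    by (intro tendsto_unique[of "at (1::real)"]) auto
  then show False using p1 \<open>det S \<noteq> 0\<close> by simp
qed

text \<open>Since there is no Jordan chain above \<open>u\<close>, \<open>u\<close> is not in the
  range of \<open>M - 1\<close>; its component orthogonal to that range is therefore nonzero and,
  rescaled, is the left eigenvector. The last claim is the case \<open>b = 0\<close> of the chain
  lemma: the eigenspace is spanned by \<open>u\<close>.\<close>

lemma left_eigenvector_exists:
  fixes M :: "real^'n^'n"
  assumes order: "order 1 (char_poly_cmat M) = 1" and u: "M *v u = u" "u \<noteq> 0"
  obtains p where "\<And>x. p \<bullet> (M *v x) = p \<bullet> x" "p \<bullet> u = 1"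
    "\<And>h. M *v h = h \<Longrightarrow> p \<bullet> h = 0 \<Longrightarrow> h = 0"
proof -
  define V where "V = range (\<lambda>x. M *v x - x)"
  have lin: "linear (\<lambda>x. M *v x - x)"
    by (intro linear_compose_sub linear_ident) auto
  have V: "subspace V"
    unfolding V_def by (intro linear_subspace_image lin) auto
  obtain r s where rs: "r \<in> span V" "\<And>w. w \<in> span V \<Longrightarrow> orthogonal s w" "u = r + s"
    using orthogonal_subspace_decomp_exists[of V u] by blast
  have rV: "r \<in> V" using rs(1) V by (simp add: span_eq_iff[THEN iffD2])
  have "s \<noteq> 0"
  proof
    assume "s = 0"
    then obtain v where v: "M *v v - v = u" using rs(3) rV by (auto simp: V_def)
    then obtain c where "v = c *\<^sub>R u"
      using simple_root_imp_no_jordan_chain[OF order u, of v 1] by auto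
    then have "u = 0" using v u(1) by (simp add: matrix_vector_mult_scaleR)
    then show False using u(2) by simp
  qed
  have su: "s \<bullet> u = s \<bullet> s"
    using rs by (simp add: inner_add_right orthogonal_def)
  define p where "p = (1 / (s \<bullet> s)) *\<^sub>R s"
  have pu: "p \<bullet> u = 1" using su \<open>s \<noteq> 0\<close> by (simp add: p_def)
  have "s \<bullet> (M *v x - x) = 0" for x
    using rs(2)[of "M *v x - x"] by (auto simp: orthogonal_def V_def intro: span_base)
  then have pM: "p \<bullet> (M *v x) = p \<bullet> x" for x
    by (simp add: p_def inner_diff_right)
  have "h = 0" if h: "M *v h = h" "p \<bullet> h = 0" for h
  proof -
    obtain c where "h = c *\<^sub>R u"
      using simple_root_imp_no_jordan_chain[OF order u, of h 0] h by auto
    then show "h = 0" using h(2) pu by simp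
  qed
  then show ?thesis using that pM pu by blast
qed

section \<open>Growth of matrix powers through the resolvent\<close>

lemma holomorphic_on_det:
  fixes B :: "complex \<Rightarrow> 'n::finite \<Rightarrow> 'n \<Rightarrow> complex"
  assumes "\<And>i j. (\<lambda>s. B s i j) holomorphic_on S"
  shows "(\<lambda>s. det (\<chi> i j. B s i j)) holomorphic_on S"
  unfolding det_def using assms by (auto intro!: holomorphic_intros)

text \<open>The entries of the resolvent \<open>(1 - s M)\<^sup>-\<^sup>1 b\<close> are holomorphic in the unit disc, hence
  their Taylor coefficients, which are the entries of \<open>M\<^sup>k b\<close>, are
  \<open>O(\<beta>\<^sup>k)\<close> for every \<open>\<beta> > 1\<close>.\<close>

lemma power_growth_of_char_roots_entry:
  fixes M :: "real^'n^'n"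
  assumes roots: "\<And>z. poly (char_poly_cmat M) z = 0 \<Longrightarrow> cmod z \<le> 1" and \<beta>: "\<beta> > 1"
  shows "\<exists>C. \<forall>k. \<bar>((\<lambda>x. M *v x) ^^ k) b $ i\<bar> \<le> C * \<beta> ^ k"
proof -
  define A where "A s = (\<chi> i j. (if i = j then 1 else 0) - s * complex_of_real (M $ i $ j))" for s
  have detA: "det (A s) \<noteq> 0" if "s \<in> ball 0 1" for s
  proof (cases "s = 0")
    case True
    then have "A s = mat 1" by (simp add: A_def mat_def)
    then show ?thesis by simp
  next
    case False
    \<comment> \<open>For \<open>s\<close> other than 0 the determinant of \<open>1 - s M\<close>
      vanishes only if \<open>1 / s\<close> is a characteristic root, which is impossible in the
      open unit disc.\<close>
    have "A s = (\<chi> k. s *s (mat (1/s) - cmat M) $ k)"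
      using False by (simp add: vec_eq_iff A_def mat_def cmat_def right_diff_distrib)
    then have "det (A s) = s ^ CARD('n) * det (mat (1/s) - cmat M)"
      using det_rows_mul[of "\<lambda>_. s" "\<lambda>k. (mat (1/s) - cmat M) $ k"] by (simp add: vec_lambda_eta del: vector_minus_component vector_ssub_ldistrib)
    moreover have "cmod (1/s) > 1"
      using that False by (simp add: norm_divide)
    then have "det (mat (1/s) - cmat M) \<noteq> 0"
      using roots[of "1/s"] by (auto simp: poly_char_poly_cmat)
    ultimately show ?thesis using False by simp
  qed
  \<comment> \<open>Cramer's rule exhibits the resolvent as a quotient of determinants that are
    holomorphic in \<open>s\<close>.\<close>
  define f where "f s k = det (\<chi> i j. if j = k then cvec b $ i else A s $ i $ j) / det (A s)" for s k
  have f: "A s *v (\<chi> k. f s k) = cvec b" if "s \<in> ball 0 1" for s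
    using cramer[OF detA[OF that], of "\<chi> k. f s k" "cvec b"]
    by (simp add: f_def)
  have hol: "(\<lambda>s. f s k) holomorphic_on ball 0 1" for k
  proof -
    have "(\<lambda>s. if j = k then cvec b $ i else A s $ i $ j) holomorphic_on ball 0 1" for i j
      by (cases "j = k") (auto simp: A_def intro!: holomorphic_intros)
    moreover have "A s = (\<chi> i j. (if i = j then 1 else 0) - s * complex_of_real (M $ i $ j))" for s
      by (simp add: A_def)
    then have "(\<lambda>s. det (A s)) holomorphic_on ball 0 1"
      by (simp only:) (intro holomorphic_on_det holomorphic_intros)
    ultimately show ?thesis
      unfolding f_def using detA by (intro holomorphic_on_divide holomorphic_on_det)
  qed
  define a where "a k n = (deriv ^^ n) (\<lambda>s. f s k) 0 / fact n" for k n
  have sums: "(\<lambda>n. a k n * s ^ n) sums f s k" if "s \<in> ball 0 1" for k s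
    using holomorphic_power_series[OF hol that] by (simp add: a_def)
  have feq: "f s k = of_real (b $ k) + s * (\<Sum>l\<in>UNIV. of_real (M $ k $ l) * f s l)" if "s \<in> ball 0 1" for s k
  proof -
    have "of_real (b $ k) = (\<Sum>l\<in>UNIV. ((if k = l then 1 else 0) - s * complex_of_real (M $ k $ l)) * f s l)"
      using arg_cong[OF f[OF that], of "\<lambda>v. v $ k"] by (simp add: matrix_vector_mult_def A_def cvec_def)
    also have "\<dots> = f s k - s * (\<Sum>l\<in>UNIV. of_real (M $ k $ l) * f s l)"
      by (simp add: left_diff_distrib sum_subtractf sum_distrib_left mult.assoc
          if_distrib[where f="\<lambda>a. a * _"] cong: if_cong)
    finally show ?thesis by simp
  qed
  \<comment> \<open>The Taylor coefficients of the right-hand side of \<open>feq\<close>. Equating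
    them with those of \<open>f\<close> shows that each coefficient vector is \<open>M\<close>
    applied to the previous one.\<close>
  define c where "c k n = (case n of 0 \<Rightarrow> of_real (b $ k) | Suc n \<Rightarrow> (\<Sum>l\<in>UNIV. of_real (M $ k $ l) * a l n))" for k n
  have sums': "(\<lambda>n. c k n * s ^ n) sums f s k" if "s \<in> ball 0 1" for k s
  proof -
    have "(\<lambda>n. s * (\<Sum>l\<in>UNIV. of_real (M $ k $ l) * (a l n * s ^ n))) sums (s * (\<Sum>l\<in>UNIV. of_real (M $ k $ l) * f s l))"
      by (intro sums_mult sums_sum sums that)
    then have "(\<lambda>n. c k (Suc n) * s ^ Suc n) sums (f s k - of_real (b $ k))"
      using feq[OF that, of k] by (simp add: c_def sum_distrib_left sum_distrib_right algebra_simps)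
    then show ?thesis
      using sums_Suc_iff[of "\<lambda>n. c k n * s ^ n"] by (simp add: c_def)
  qed
  have ac: "a k = c k" for k
  proof -
    define d where "d n = a k n - c k n" for n
    have d: "(\<lambda>n. d n * (s - 0) ^ n) sums 0" if "norm (s - 0) < 1" for s
      using sums_diff[OF sums sums', of s s k k] that by (simp add: d_def left_diff_distrib)
    have "d n = 0" for n
    proof (cases "n = 0")
      case True
      then show ?thesis using d[of 0] by simp
    next
      case False
      show ?thesis
      proof (rule ccontr)
        assume "d n \<noteq> 0"
        from powser_0_nonzero[of 1 0 d "\<lambda>_. 0" n, OF _ d refl this] False obtain s
          where "0 < s" "\<And>z::complex. z \<in> cball 0 s - {0} \<Longrightarrow> (0::complex) \<noteq> 0" by auto
        from this(2)[of "of_real s"] this(1) show False by simp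
      qed
    qed
    then show ?thesis by (simp add: fun_eq_iff d_def)
  qed
  have an: "a k n = of_real (((\<lambda>x. M *v x) ^^ n) b $ k)" for k n
  proof (induction n arbitrary: k)
    case 0
    show ?case by (simp add: ac c_def)
  next
    case (Suc n)
    have "a k (Suc n) = (\<Sum>l\<in>UNIV. of_real (M $ k $ l) * a l n)" by (subst ac) (simp add: c_def)
    then show ?case using Suc by (simp add: matrix_vector_mult_def)
  qed
  \<comment> \<open>The point \<open>1 / \<beta>\<close> lies in the disc of convergence, and the
    terms of a convergent series are bounded.\<close>
  have "of_real (1/\<beta>) \<in> ball (0::complex) 1" using \<beta> by (simp add: norm_divide)
  then have "summable (\<lambda>n. a i n * of_real (1/\<beta>) ^ n)" using sums sums_summable by blast
  then have "Bseq (\<lambda>n. a i n * of_real (1/\<beta>) ^ n)"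
    using summable_imp_Bseq by blast
  then obtain C where C: "\<And>n. cmod (a i n * of_real (1/\<beta>) ^ n) \<le> C"
    by (auto simp: Bseq_def)
  have "\<bar>((\<lambda>x. M *v x) ^^ k) b $ i\<bar> \<le> C * \<beta> ^ k" for k
    using C[of k] \<beta> by (simp add: an norm_mult norm_power norm_divide field_simps)
  then show ?thesis by blast
qed

lemma bounded_linear_funpow:
  assumes "bounded_linear (M :: 'a::real_normed_vector \<Rightarrow> 'a)"
  shows "bounded_linear (M ^^ k)"
proof (induction k)
  case (Suc k)
  then show ?case using bounded_linear_compose[OF assms Suc] by (simp add: comp_def)
qed (simp add: id_def)

text \<open>Roots on the unit circle may carry Jordan blocks, hence polynomial growth; this is why
  every rate \<open>\<beta> > 1\<close> is offered and not the rate 1.\<close>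

lemma power_growth_of_char_roots:
  fixes M :: "real^'n^'n"
  assumes roots: "\<And>z. poly (char_poly_cmat M) z = 0 \<Longrightarrow> cmod z \<le> 1" and \<beta>: "\<beta> > 1"
  shows "\<exists>C. \<forall>k x. norm (((\<lambda>x. M *v x) ^^ k) x) \<le> C * \<beta> ^ k * norm x"
proof -
  let ?f = "\<lambda>k. (\<lambda>x. M *v x) ^^ k"
  have "\<exists>c. \<forall>k. \<bar>?f k (axis l 1) $ i\<bar> \<le> c * \<beta> ^ k" for l i
    by (rule power_growth_of_char_roots_entry[OF _ \<beta>]) (rule roots)
  then obtain c where c: "\<And>l i k. \<bar>?f k (axis l 1) $ i\<bar> \<le> c l i * \<beta> ^ k" by metis
  have lin: "linear (?f k)" for k
    by (intro bounded_linear.linear bounded_linear_funpow matrix_vector_mul_bounded_linear)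
  have "norm (?f k x) \<le> (\<Sum>i\<in>UNIV. \<Sum>l\<in>UNIV. c l i) * \<beta> ^ k * norm x" for k x
  proof -
    have "?f k x = ?f k (\<Sum>l\<in>UNIV. x $ l *\<^sub>R axis l 1)"
      using basis_expansion[of x] by (simp add: scalar_mult_eq_scaleR)
    also have "\<dots> = (\<Sum>l\<in>UNIV. x $ l *\<^sub>R ?f k (axis l 1))"
      by (simp add: linear_sum[OF lin] linear_scale[OF lin])
    finally have eq: "?f k x = (\<Sum>l\<in>UNIV. x $ l *\<^sub>R ?f k (axis l 1))" .
    have "norm (?f k x) \<le> (\<Sum>i\<in>UNIV. \<bar>?f k x $ i\<bar>)" by (rule norm_le_l1_cart)
    also have "\<dots> \<le> (\<Sum>i\<in>UNIV. \<Sum>l\<in>UNIV. norm x * (c l i * \<beta> ^ k))"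
    proof (rule sum_mono)
      fix i
      have "\<bar>?f k x $ i\<bar> = \<bar>\<Sum>l\<in>UNIV. x $ l * ?f k (axis l 1) $ i\<bar>" by (subst eq) simp
      also have "\<dots> \<le> (\<Sum>l\<in>UNIV. \<bar>x $ l * ?f k (axis l 1) $ i\<bar>)" by (rule sum_abs)
      also have "\<dots> \<le> (\<Sum>l\<in>UNIV. norm x * (c l i * \<beta> ^ k))"
        unfolding abs_mult by (intro sum_mono mult_mono component_le_norm_cart c) auto
      finally show "\<bar>?f k x $ i\<bar> \<le> (\<Sum>l\<in>UNIV. norm x * (c l i * \<beta> ^ k))" .
    qed
    also have "\<dots> = (\<Sum>i\<in>UNIV. \<Sum>l\<in>UNIV. c l i) * \<beta> ^ k * norm x"
      by (simp add: sum_distrib_left sum_distrib_right mult_ac)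
    finally show ?thesis .
  qed
  then show ?thesis by blast
qed

section \<open>Linear differential equations\<close>

text \<open>\<open>W t\<close> is the principal solution operator from time 0 to time
  \<open>t\<close>. Linearity of \<open>W t\<close> is not demanded, since it follows from
  uniqueness; the one-sided derivatives at the ends of the interval match the finite time windows
  used below.\<close>

definition linear_flow :: "(real \<Rightarrow> 'a::real_normed_vector \<Rightarrow>\<^sub>L 'a) \<Rightarrow> real \<Rightarrow> (real \<Rightarrow> 'a \<Rightarrow> 'a) \<Rightarrow> bool" where
  "linear_flow A T W \<longleftrightarrow> (\<forall>x. W 0 x = x) \<and>
     (\<forall>x. \<forall>t\<in>{0..T}. ((\<lambda>t. W t x) has_vector_derivative A t (W t x)) (at t within {0..T}))"

lemma linear_flow_exists:
  fixes A :: "real \<Rightarrow> 'a::euclidean_space \<Rightarrow>\<^sub>L 'a"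
  assumes cont: "continuous_on UNIV A" and K: "\<And>t. norm (A t) \<le> K"
  obtains W where "linear_flow A T W"
proof -
  have K0: "K \<ge> 0" using K[of 0] norm_ge_zero order_trans by blast
  have "\<exists>w. w 0 = x \<and> (\<forall>t\<ge>0. (w has_vector_derivative A t (w t)) (at t within {0..}))" for x
  proof (rule picard_global[of "\<lambda>t. blinfun_apply (A t)" "K + 1" x "K * norm x"])
    show "continuous_on UNIV (\<lambda>p. A (fst p) (snd p))"
      by (intro continuous_intros continuous_on_compose2[OF cont]) auto
    show "norm (A t y - A t z) \<le> (K + 1) * norm (y - z)" for t y z
    proof -
      have "norm (A t (y - z)) \<le> norm (A t) * norm (y - z)" by (rule norm_blinfun)
      also have "\<dots> \<le> (K + 1) * norm (y - z)" using K[of t] by (intro mult_right_mono) auto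
      finally show ?thesis by (simp add: blinfun.diff_right)
    qed
    show "norm (A t x) \<le> K * norm x" for t
      using norm_blinfun[of "A t" x] mult_right_mono[OF K[of t], of "norm x"] by simp
  qed (use K0 in auto)
  then obtain w where w: "\<And>x. w x 0 = x"
    "\<And>x t. t \<ge> 0 \<Longrightarrow> (w x has_vector_derivative A t (w x t)) (at t within {0..})"
    by metis
  have "linear_flow A T (\<lambda>t x. w x t)"
    unfolding linear_flow_def using w(1)
    by (auto intro: has_vector_derivative_within_subset[OF w(2)])
  then show ?thesis by (rule that)
qed

lemma linear_gronwall:
  fixes A :: "real \<Rightarrow> 'a::banach \<Rightarrow>\<^sub>L 'a"
  assumes K: "\<And>t. t \<in> {0..T} \<Longrightarrow> norm (A t) \<le> K" "K \<ge> 0"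
    and y: "\<And>t. t \<in> {0..T} \<Longrightarrow> (y has_vector_derivative A t (y t) + g t) (at t within {0..T})"
    and g: "\<And>t. t \<in> {0..T} \<Longrightarrow> norm (g t) \<le> c" and t: "t \<in> {0..T}"
  shows "norm (y t) \<le> (norm (y 0) + c * t) * exp (K * t)"
proof (rule gronwall[OF y _ K(2) _ t])
  show "c \<ge> 0" using g[OF t] norm_ge_zero order_trans by blast
  fix s assume s: "s \<in> {0..T}"
  have "norm (A s (y s) + g s) \<le> norm (A s (y s)) + norm (g s)" by (rule norm_triangle_ineq)
  also have "\<dots> \<le> norm (A s) * norm (y s) + c"
    using g[OF s] norm_blinfun[of "A s" "y s"] by linarith
  also have "\<dots> \<le> K * norm (y s) + c"
    using K(1)[OF s] by (intro add_right_mono mult_right_mono) auto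
  finally show "norm (A s (y s) + g s) \<le> K * norm (y s) + c" .
qed

context
  fixes A :: "real \<Rightarrow> 'a::banach \<Rightarrow>\<^sub>L 'a" and K T W
  assumes K: "\<And>t. norm (A t) \<le> K" and W: "linear_flow A T W"
begin

private lemma K0: "K \<ge> 0" using K[of 0] norm_ge_zero order_trans by blast

text \<open>The difference solves the same forced equation with initial value 0. This is the source
  of uniqueness, of the dependence of the monodromy on the coupling, and of the first-order
  description of perturbed orbits.\<close>

lemma linear_flow_perturbation:
  assumes y: "\<And>t. t \<in> {0..T} \<Longrightarrow> (y has_vector_derivative A t (y t) + g t) (at t within {0..T})"
    and g: "\<And>t. t \<in> {0..T} \<Longrightarrow> norm (g t) \<le> c" and t: "t \<in> {0..T}"
  shows "norm (y t - W t (y 0)) \<le> c * t * exp (K * t)"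
proof -
  have "norm (y t - W t (y 0)) \<le> (norm (y 0 - W 0 (y 0)) + c * t) * exp (K * t)"
  proof (rule linear_gronwall[OF K K0 _ g t])
    fix s assume "s \<in> {0..T}"
    then have "((\<lambda>t. y t - W t (y 0)) has_vector_derivative A s (y s) + g s - A s (W s (y 0))) (at s within {0..T})"
      using W y by (intro has_vector_derivative_diff) (auto simp: linear_flow_def)
    then show "((\<lambda>t. y t - W t (y 0)) has_vector_derivative A s (y s - W s (y 0)) + g s) (at s within {0..T})"
      by (simp add: blinfun.diff_right algebra_simps)
  qed
  then show ?thesis using W by (simp add: linear_flow_def)
qed

lemma linear_flow_unique:
  assumes y: "\<And>t. t \<in> {0..T} \<Longrightarrow> (y has_vector_derivative A t (y t)) (at t within {0..T})"
    and t: "t \<in> {0..T}"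
  shows "y t = W t (y 0)"
proof -
  have "norm (y t - W t (y 0)) \<le> 0 * t * exp (K * t)"
    by (rule linear_flow_perturbation[where g = "\<lambda>_. 0", OF _ _ t]) (use y in auto)
  then show ?thesis by simp
qed

lemma linear_flow_norm_le:
  assumes t: "t \<in> {0..T}"
  shows "norm (W t x) \<le> exp (K * t) * norm x"
proof -
  have "norm (W t x) \<le> (norm (W 0 x) + 0 * t) * exp (K * t)"
    by (rule linear_gronwall[where A = A and g = "\<lambda>_. 0", OF K K0 _ _ t]) (use W in \<open>auto simp: linear_flow_def\<close>)
  then show ?thesis using W by (simp add: linear_flow_def mult.commute)
qed

lemma linear_flow_linear:
  assumes t: "t \<in> {0..T}"
  shows "linear (W t)"
proof (rule linearI)
  fix x z
  have "W t x + W t z = W t (W 0 x + W 0 z)"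
    by (rule linear_flow_unique[where y = "\<lambda>t. W t x + W t z", OF _ t])
      (use W in \<open>auto simp: linear_flow_def blinfun.add_right intro: has_vector_derivative_add\<close>)
  then show "W t (x + z) = W t x + W t z" using W by (simp add: linear_flow_def)
next
  fix r x
  have "r *\<^sub>R W t x = W t (r *\<^sub>R W 0 x)"
    by (rule linear_flow_unique[where y = "\<lambda>t. r *\<^sub>R W t x", OF _ t])
      (use W in \<open>auto simp: linear_flow_def blinfun.scaleR_right
        intro: bounded_linear.has_vector_derivative[OF bounded_linear_scaleR_right]\<close>)
  then show "W t (r *\<^sub>R x) = r *\<^sub>R W t x" using W by (simp add: linear_flow_def)
qed

lemma linear_flow_bounded_linear:
  assumes t: "t \<in> {0..T}"
  shows "bounded_linear (W t)"
proof (rule bounded_linear_intro[where K = "exp (K * t)"])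
  show "norm (W t x) \<le> norm x * exp (K * t)" for x
    using linear_flow_norm_le[OF t, of x] by (simp add: mult.commute)
qed (rule linear_add[OF linear_flow_linear[OF t]] linear_scale[OF linear_flow_linear[OF t]])+

end

text \<open>Solving the adjoint equation backwards from \<open>p\<close> at time \<open>T\<close> returns to \<open>p\<close> at time \<open>0\<close>,
  because the pairing of solutions with adjoint solutions is constant in time.\<close>

lemma adjoint_solution_exists:
  fixes A :: "real \<Rightarrow> 'a::euclidean_space \<Rightarrow>\<^sub>L 'a"
  assumes cont: "continuous_on UNIV A" and K: "\<And>t. norm (A t) \<le> K"
    and T: "T \<ge> 0" and W: "linear_flow A T W" and p: "\<And>x. p \<bullet> W T x = p \<bullet> x"
  obtains q where "continuous_on {0..T} q" "q 0 = p" "q T = p"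
    "\<And>y g. (\<And>t. t \<in> {0..T} \<Longrightarrow> (y has_vector_derivative A t (y t) + g t) (at t within {0..T})) \<Longrightarrow>
       ((\<lambda>t. q t \<bullet> g t) has_integral (p \<bullet> (y T - y 0))) {0..T}"
proof -
  have K0: "K \<ge> 0" using K[of 0] norm_ge_zero order_trans by blast
  \<comment> \<open>The adjoint in reversed time, so that the backward problem with final value
    \<open>p\<close> becomes a forward one.\<close>
  define B where "B t = adjoint (blinfun_apply (A (T - t)))" for t
  have B: "x \<bullet> B t y = A (T - t) x \<bullet> y" for x y t
    unfolding B_def by (rule adjoint_works) (simp add: bounded_linear.linear[OF blinfun.bounded_linear_right])
  have linB: "linear (B t)" for t
    unfolding B_def by (rule adjoint_linear) (simp add: bounded_linear.linear[OF blinfun.bounded_linear_right])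
  have nB: "norm (B t y) \<le> K * norm y" for t y
  proof -
    have "norm (B t y) * norm (B t y) = B t y \<bullet> B t y"
      by (simp add: power2_eq_square flip: power2_norm_eq_inner)
    also have "\<dots> = A (T - t) (B t y) \<bullet> y" by (rule B)
    also have "\<dots> \<le> norm (A (T - t) (B t y)) * norm y" by (rule norm_cauchy_schwarz)
    also have "\<dots> \<le> (norm (A (T - t)) * norm (B t y)) * norm y"
      by (intro mult_right_mono norm_blinfun) auto
    also have "\<dots> \<le> (K * norm (B t y)) * norm y"
      by (intro mult_right_mono K) auto
    finally have "norm (B t y) * norm (B t y) \<le> norm (B t y) * (K * norm y)"
      by (simp add: algebra_simps)
    then show ?thesis using K0
      by (cases "norm (B t y) = 0") (auto simp: mult_le_cancel_left)
  qed
  have contB: "continuous_on UNIV (\<lambda>z. B (fst z) (snd z))"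
  proof -
    have "B t y = (\<Sum>b\<in>Basis. (A (T - t) b \<bullet> y) *\<^sub>R b)" for t y
    proof -
      have "B t y = (\<Sum>b\<in>Basis. (B t y \<bullet> b) *\<^sub>R b)"
        by (rule euclidean_representation[symmetric])
      moreover have "B t y \<bullet> b = A (T - t) b \<bullet> y" for b
        using B[of b t y] by (simp add: inner_commute)
      ultimately show ?thesis by simp
    qed
    then show ?thesis
      by (simp only:) (intro continuous_intros continuous_on_compose2[OF cont], auto intro!: continuous_intros)
  qed
  obtain r where r: "r 0 = p" "\<And>t. t \<ge> 0 \<Longrightarrow> (r has_vector_derivative B t (r t)) (at t within {0..})"
  proof (rule picard_global[of B "K + 1" p "K * norm p", OF contB])
    fix t :: real and x y
    have "norm (B t x - B t y) \<le> K * norm (x - y)"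
      using nB[of t "x - y"] by (simp add: linear_diff[OF linB])
    also have "\<dots> \<le> (K + 1) * norm (x - y)" by (simp add: algebra_simps)
    finally show "norm (B t x - B t y) \<le> (K + 1) * norm (x - y)" .
  qed (use nB K0 in auto)
  define q where "q t = r (T - t)" for t
  have dq: "(q has_vector_derivative - B (T - t) (q t)) (at t within {0..T})" if "t \<in> {0..T}" for t
  proof -
    have "(r has_vector_derivative B (T - t) (r (T - t))) (at (T - t) within (\<lambda>t. T - t) ` {0..T})"
      using that by (intro has_vector_derivative_within_subset[OF r(2)]) auto
    moreover have "((\<lambda>t. T - t) has_vector_derivative (- 1)) (at t within {0..T})"
      by (auto intro!: derivative_eq_intros)
    ultimately have "((r \<circ> (\<lambda>t. T - t)) has_vector_derivative (- 1) *\<^sub>R B (T - t) (r (T - t))) (at t within {0..T})"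
      by (intro vector_diff_chain_within)
    then show ?thesis by (simp add: q_def[abs_def] comp_def)
  qed
  have contq: "continuous_on {0..T} q"
    using dq by (meson continuous_on_eq_continuous_within has_vector_derivative_continuous)
  have qT: "q T = p" by (simp add: q_def r)
  \<comment> \<open>The contributions of \<open>A\<close> to the derivative of
    \<open>q t \<bullet> y t\<close> cancel, and only the forcing survives.\<close>
  have main: "((\<lambda>t. q t \<bullet> g t) has_integral (q T \<bullet> y T - q 0 \<bullet> y 0)) {0..T}"
    if y: "\<And>t. t \<in> {0..T} \<Longrightarrow> (y has_vector_derivative A t (y t) + g t) (at t within {0..T})" for y g
  proof (rule fundamental_theorem_of_calculus[OF T])
    fix t assume t: "t \<in> {0..T}"
    have "((\<lambda>t. q t \<bullet> y t) has_vector_derivative (q t \<bullet> (A t (y t) + g t) + (- B (T - t) (q t)) \<bullet> y t)) (at t within {0..T})"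
      using bounded_bilinear.has_vector_derivative[OF bounded_bilinear_inner dq[OF t] y[OF t]] .
    moreover have "B (T - t) (q t) \<bullet> y t = q t \<bullet> A t (y t)"
      using B[of "y t" "T - t" "q t"] by (simp add: inner_commute)
    ultimately show "((\<lambda>t. q t \<bullet> y t) has_vector_derivative q t \<bullet> g t) (at t within {0..T})"
      by (simp add: inner_add_right)
  qed
  have "q 0 \<bullet> x = p \<bullet> x" for x
  proof -
    have "((\<lambda>t. q t \<bullet> 0) has_integral (q T \<bullet> W T x - q 0 \<bullet> W 0 x)) {0..T}"
      using W by (intro main) (auto simp: linear_flow_def)
    then show ?thesis using W by (simp add: qT p linear_flow_def)
  qed
  then have "q 0 = p" by (metis vector_eq_rdot)
  then show ?thesis
    using that[OF contq _ qT] main qT by (auto simp: inner_diff_right)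
qed

section \<open>Growth of iterates and perturbation of eigenvalues\<close>

text \<open>With \<open>n k\<close> the norm of \<open>M\<^sup>k\<close>, choose \<open>1 < a < r < b < a\<^sup>2\<close> around the spectral radius \<open>r\<close>; the
  times \<open>N\<close> are those at which \<open>n N / a\<^sup>N\<close> exceeds all its predecessors.\<close>

lemma growth_along_record_times:
  fixes M :: "'a::real_normed_vector \<Rightarrow> 'a"
  assumes M: "bounded_linear M" and q: "M q = g *\<^sub>R q" "q \<noteq> 0" and g: "g > 1"
  obtains a b C where "1 < a" "1 < b" "b < a\<^sup>2" "0 < C"
    "\<And>k x. norm ((M ^^ k) x) \<le> C * b ^ k * norm x"
    "\<And>n. \<exists>N\<ge>n. \<exists>v. norm ((M ^^ N) v) = 1 \<and> (\<forall>k\<le>N. norm ((M ^^ k) v) * a ^ (N - k) \<le> 2)"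
proof -
  define n where "n k = onorm (M ^^ k)" for k
  have bl: "bounded_linear (M ^^ k)" for k by (rule bounded_linear_funpow[OF M])
  have n: "norm ((M ^^ k) x) \<le> n k * norm x" for k x
    unfolding n_def by (rule onorm[OF bl])
  have n0: "n k \<ge> 0" for k unfolding n_def by (rule onorm_pos_le[OF bl])
  have Mq: "(M ^^ k) q = g ^ k *\<^sub>R q" for k
    by (induction k) (auto simp: q linear_scale[OF bounded_linear.linear[OF M]])
  have ng: "n k \<ge> g ^ k" for k
    using n[of k q] q g by (simp add: Mq)
  have nadd: "n (j + k) \<le> n j * n k" for j k
    unfolding n_def funpow_add by (rule onorm_compose[OF bl bl])
  have nmult: "n (m * i) \<le> n m ^ i" for m i
  proof (induction i)
    case 0
    show ?case by (simp add: n_def id_def onorm_id_le)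
  next
    case (Suc i)
    have "n (m * Suc i) \<le> n m * n (m * i)" using nadd[of m "m * i"] by simp
    also have "\<dots> \<le> n m * n m ^ i" by (intro mult_left_mono Suc n0)
    finally show ?case by simp
  qed
  \<comment> \<open>A form without roots: the infimum of \<open>S\<close> is the infimum of the
    \<open>m\<close>-th roots of \<open>n m\<close>, that is, the spectral radius.\<close>
  define S where "S = {x. x > 0 \<and> (\<exists>m\<ge>1. n m \<le> x ^ m)}"
  define r where "r = Inf S"
  have gS: "g \<le> x" if "x \<in> S" for x
  proof (rule ccontr)
    assume "\<not> g \<le> x"
    moreover from that obtain m where m: "m \<ge> 1" "n m \<le> x ^ m" "x > 0" by (auto simp: S_def)
    ultimately have "x ^ m < g ^ m" by (intro power_strict_mono) auto
    then show False using ng[of m] m by linarith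
  qed
  have "n 1 + 1 \<in> S" using n0[of 1] by (auto simp: S_def intro!: exI[of _ 1])
  then have Sne: "S \<noteq> {}" by blast
  have Sbdd: "bdd_below S" using gS by (auto simp: bdd_below_def)
  have r: "r > 1" using cInf_greatest[OF Sne gS] g unfolding r_def by linarith
  have "sqrt r < r" using r by (intro real_less_lsqrt) (auto simp: power2_eq_square)
  \<comment> \<open>Choosing \<open>a\<close> above the square root of \<open>r\<close> leaves room
    for a \<open>b\<close> between \<open>r\<close> and \<open>a\<^sup>2\<close>.\<close>
  then obtain a where a: "max 1 (sqrt r) < a" "a < r" using r dense[of "max 1 (sqrt r)" r] by auto
  then have a1: "a > 1" by simp
  have "sqrt r ^ 2 < a ^ 2" using a r by (intro power_strict_mono) auto
  then have "r < a\<^sup>2" using r by simp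
  then obtain b where b: "r < b" "b < a\<^sup>2" using dense by blast
  \<comment> \<open>The gap between \<open>a\<close> and \<open>a'\<close> makes
    \<open>n k / a ^ k\<close> unbounded, so that records occur arbitrarily late.\<close>
  obtain a' where a': "a < a'" "a' < r" using a dense by blast
  obtain x where x: "x \<in> S" "x < b" using cInf_lessD[OF Sne, of b] b by (auto simp: r_def)
  then obtain m where m: "m \<ge> 1" "n m \<le> x ^ m" "x > 0" by (auto simp: S_def)
  have nmb: "n m \<le> b ^ m"
    using m x power_mono[of x b m] by linarith
  \<comment> \<open>\<open>C\<close> pays for the remainder \<open>k mod m\<close>; the multiple of
    \<open>m\<close> is handled by submultiplicativity.\<close>
  define C where "C = (\<Sum>j<m. n j) + 1"
  have C: "C > 0" using n0 by (simp add: C_def add_nonneg_pos sum_nonneg)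
  have nb: "n k \<le> C * b ^ k" for k
  proof -
    have "n k = n (m * (k div m) + k mod m)" by simp
    also have "\<dots> \<le> n (m * (k div m)) * n (k mod m)" by (rule nadd)
    also have "\<dots> \<le> (b ^ m) ^ (k div m) * C"
    proof (rule mult_mono)
      show "n (m * (k div m)) \<le> (b ^ m) ^ (k div m)"
        using nmult[of m "k div m"] power_mono[OF nmb n0, of "k div m"] by linarith
      have "n (k mod m) \<le> (\<Sum>j<m. n j)"
        using m n0 by (intro member_le_sum) auto
      then show "n (k mod m) \<le> C" by (simp add: C_def)
    qed (use b r n0 in auto)
    also have "(b ^ m) ^ (k div m) \<le> b ^ k"
      unfolding power_mult[symmetric] using b r by (intro power_increasing) auto
    finally show ?thesis using C by (simp add: mult.commute)
  qed
  have na': "n k \<ge> a' ^ k" for k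
  proof (cases "k \<ge> 1")
    case True
    have "a' \<notin> S" using a' cInf_lower[OF _ Sbdd, of a'] by (auto simp: r_def)
    then show ?thesis using True a' a1 by (auto simp: S_def)
  next
    case False
    then have "k = 0" by simp
    then show ?thesis using ng[of 0] by simp
  qed
  define c where "c k = n k / a ^ k" for k
  have c: "c k \<ge> (a' / a) ^ k" for k
    using na'[of k] a1 by (simp add: c_def power_divide divide_right_mono)
  have rec: "\<exists>N\<ge>n0. \<forall>k\<le>N. c k \<le> c N" for n0
  proof -
    have "1 < a' / a" using a' a1 by simp
    then obtain N' where "Max (c ` {..n0}) < (a' / a) ^ N'"
      using real_arch_pow by blast
    then have lt: "Max (c ` {..n0}) < c N'" using c[of N'] by (rule less_le_trans)
    have N': "c k < c N'" if "k \<le> n0" for k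
      using that by (intro le_less_trans[OF Max_ge lt]) auto
    have "Max (c ` {..N'}) \<in> c ` {..N'}" by (rule Max_in) auto
    \<comment> \<open>\<open>N'\<close> beats all indices up to \<open>n0\<close>, so a maximiser
      over \<open>{..N'}\<close> lies beyond \<open>n0\<close>.\<close>
    then obtain N where N: "Max (c ` {..N'}) = c N" "N \<in> {..N'}" by (rule imageE)
    have cN: "c k \<le> c N" if "k \<le> N'" for k
      unfolding N(1)[symmetric] using that by (intro Max_ge) auto
    then have "N \<ge> n0" using N'[of N] cN[of N'] by (meson linorder_not_less nle_le order.refl)
    then show ?thesis using cN N(2) by (metis atMost_iff order.trans)
  qed
  have "\<exists>N\<ge>n0. \<exists>v. norm ((M ^^ N) v) = 1 \<and> (\<forall>k\<le>N. norm ((M ^^ k) v) * a ^ (N - k) \<le> 2)" for n0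
  proof -
    obtain N where N: "N \<ge> n0" "\<And>k. k \<le> N \<Longrightarrow> c k \<le> c N" using rec by blast
    have nN: "n N > 0" using ng[of N] g by (meson less_le_trans zero_less_one zero_less_power order.strict_trans)
    \<comment> \<open>A vector attaining half the operator norm is enough; this is where the
      constant 2 of the conclusion comes from.\<close>
    have "\<exists>u. norm ((M ^^ N) u) > n N / 2 * norm u"
    proof (rule ccontr)
      assume "\<not> ?thesis"
      then have "onorm (M ^^ N) \<le> n N / 2" using nN by (intro onorm_bound) (auto simp: not_less)
      then show False using nN by (simp add: n_def)
    qed
    then obtain u where u: "norm ((M ^^ N) u) > n N / 2 * norm u" by blast
    define s where "s = norm ((M ^^ N) u)"
    have "n N / 2 * norm u \<ge> 0" using nN by simp
    then have s: "s > 0" using u unfolding s_def by linarith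
    define v where "v = (1 / s) *\<^sub>R u"
    have Mv: "(M ^^ k) v = (1 / s) *\<^sub>R (M ^^ k) u" for k
      unfolding v_def by (rule linear_scale[OF bounded_linear.linear[OF bl]])
    have "norm ((M ^^ N) v) = 1" using s by (simp add: Mv s_def)
    moreover have "norm ((M ^^ k) v) * a ^ (N - k) \<le> 2" if k: "k \<le> N" for k
    proof -
      have "a ^ N = a ^ (N - k) * a ^ k" using k by (simp flip: power_add)
      then have "n k * a ^ (N - k) \<le> n N"
        using N(2)[OF k] a1 by (simp add: c_def divide_simps)
      then have "n k * a ^ (N - k) * norm u \<le> n N * norm u"
        by (intro mult_right_mono) auto
      also have "\<dots> \<le> 2 * s" using u unfolding s_def by simp
      finally have *: "n k * a ^ (N - k) * norm u \<le> 2 * s" .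
      have "norm ((M ^^ k) u) * a ^ (N - k) \<le> (n k * norm u) * a ^ (N - k)"
        using n[of k u] a1 by (intro mult_right_mono) auto
      also have "\<dots> \<le> 2 * s" using * by (simp add: mult_ac)
      finally show ?thesis using s by (simp add: Mv divide_simps)
    qed
    ultimately show ?thesis using N(1) by blast
  qed
  moreover have "norm ((M ^^ k) x) \<le> C * b ^ k * norm x" for k x
    by (rule order_trans[OF n mult_right_mono[OF nb norm_ge_zero]])
  ultimately show ?thesis
    using that[of a b C] a1 b C r by auto
qed

section \<open>From linear growth to nonlinear instability\<close>

text \<open>Follow \<open>T\<close> from a small multiple \<open>c\<close> of the vector
  \<open>v\<close> that is almost optimal for time \<open>N\<close>. At time \<open>k\<close> the
  linear orbit has size at most \<open>c * C1 / a ^ (N - k)\<close>; the quadratic error made there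
  carries the square of this factor and is amplified at rate \<open>b < a\<^sup>2\<close> up to time
  \<open>N\<close>. The errors add up to a geometric sum of order \<open>c\<^sup>2\<close>, whereas
  the observed linear part is at least \<open>c\<close>.\<close>

lemma quadratic_perturbation_unstable:
  fixes L T :: "'a::real_normed_vector \<Rightarrow> 'a" and D :: "'a \<Rightarrow> 'b::real_normed_vector"
  assumes L: "bounded_linear L" and D: "bounded_linear D"
    and a: "1 < a" and b: "0 < b" "b < a\<^sup>2" and C: "0 < C"
    and Lb: "\<And>k x. norm ((L ^^ k) x) \<le> C * b ^ k * norm x"
    and c0: "c0 > 0" and K: "K \<ge> 0"
    and R: "\<And>w. norm w \<le> c0 \<Longrightarrow> norm (T w - L w) \<le> K * (norm w)\<^sup>2"
    and rec: "\<And>n. \<exists>N\<ge>n. \<exists>v. norm (D ((L ^^ N) v)) \<ge> 1 \<and> (\<forall>k\<le>N. norm ((L ^^ k) v) * a ^ (N - k) \<le> C1)"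
    and C1: "C1 > 0"
  shows "\<exists>e>0. \<forall>r>0. \<exists>w N. norm w < r \<and> (\<forall>k\<le>N. norm ((T ^^ k) w) \<le> c0) \<and> norm (D ((T ^^ N) w)) \<ge> e"
proof -
  obtain Kd where Kd: "Kd > 0" "\<And>x. norm (D x) \<le> norm x * Kd"
    using bounded_linear.pos_bounded[OF D] by blast
  \<comment> \<open>Chosen so that the error recursion reproduces itself: the propagated error and
    the newly made one fit exactly into the bound for the next time.\<close>
  define H where "H = 4 * C * K * C1\<^sup>2 / (a\<^sup>2 - b)"
  have H0: "H \<ge> 0" using b C K by (simp add: H_def)
  have H: "H * b + 4 * C * K * C1\<^sup>2 = H * a\<^sup>2"
    using b by (simp add: H_def field_simps)
  \<comment> \<open>The three entries keep the orbit in the ball of radius \<open>c0\<close>, keep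
    the error below the linear part, and keep the error seen by \<open>D\<close> below
    \<open>c / 2\<close>.\<close>
  define c where "c = min (c0 / (2 * C1)) (min (C1 / (H + 1)) (1 / (2 * Kd * (H + 1))))"
  have c: "c > 0" using c0 C1 Kd H0 by (simp add: c_def)
  have "c \<le> c0 / (2 * C1)" "c \<le> C1 / (H + 1)" by (simp_all add: c_def)
  then have c1: "2 * c * C1 \<le> c0" and "c * (H + 1) \<le> C1"
    using C1 H0 by (simp_all add: pos_le_divide_eq mult_ac)
  moreover have "c * (H + 1) = c * H + c" by (simp add: algebra_simps)
  ultimately have c2: "c * H \<le> C1" using c by linarith
  have "c * (2 * Kd * (H + 1)) \<le> 1 / (2 * Kd * (H + 1)) * (2 * Kd * (H + 1))"
    using H0 Kd by (intro mult_right_mono) (auto simp: c_def)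
  then have "c * (2 * Kd * (H + 1)) \<le> 1" using H0 Kd by simp
  moreover have "c * (2 * Kd * (H + 1)) = 2 * (Kd * c * H) + 2 * (Kd * c)" by (simp add: algebra_simps)
  moreover have "Kd * c > 0" using Kd c by simp
  ultimately have c3: "Kd * c * H \<le> 1 / 2" by linarith
  have "\<exists>w N. norm w < r \<and> (\<forall>k\<le>N. norm ((T ^^ k) w) \<le> c0) \<and> norm (D ((T ^^ N) w)) \<ge> c / 2" if r: "r > 0" for r
  proof -
    \<comment> \<open>A late stopping time makes the starting point small, because
      \<open>norm v\<close> is at most \<open>C1 / a ^ N\<close>.\<close>
    obtain n where n: "c * C1 / r < a ^ n" using real_arch_pow[OF a] by blast
    obtain N v where N: "N \<ge> n" "norm (D ((L ^^ N) v)) \<ge> 1"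
      "\<And>k. k \<le> N \<Longrightarrow> norm ((L ^^ k) v) * a ^ (N - k) \<le> C1"
      using rec by blast
    define p where "p k = 1 / a ^ (N - k)" for k
    have p: "0 < p k" "p k \<le> 1" for k using a by (auto simp: p_def divide_simps)
    have pS: "p k ^ 2 * a ^ 2 = p (Suc k) ^ 2" if "k < N" for k
    proof -
      have "a ^ (N - k) = a * a ^ (N - Suc k)" using that by (metis Suc_diff_Suc power_Suc)
      then show ?thesis using a by (simp add: p_def field_simps)
    qed
    define w where "w = c *\<^sub>R v"
    define e where "e k = (T ^^ k) w - c *\<^sub>R (L ^^ k) v" for k
    have Lv: "norm ((L ^^ k) v) \<le> C1 * p k" if "k \<le> N" for k
      using N(3)[OF that] a by (simp add: p_def pos_le_divide_eq)
    have lin: "linear (L ^^ j)" for j by (intro bounded_linear.linear bounded_linear_funpow L)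
    have Tk: "norm ((T ^^ k) w) \<le> 2 * c * C1 * p k"
      if k: "k \<le> N" and P: "norm (e k) \<le> c\<^sup>2 * H * p k ^ 2" for k
    proof -
      have "norm ((T ^^ k) w) \<le> norm (e k) + norm (c *\<^sub>R (L ^^ k) v)"
        unfolding e_def using norm_triangle_ineq[of "(T ^^ k) w - c *\<^sub>R (L ^^ k) v" "c *\<^sub>R (L ^^ k) v"] by simp
      also have "\<dots> \<le> c * p k * (c * H) * p k + c * (C1 * p k)"
        using P Lv[OF k] c by (intro add_mono) (auto simp: power2_eq_square mult_ac)
      also have "c * p k * (c * H) * p k \<le> c * p k * C1 * 1"
        using c p[of k] c2 H0 C1 by (intro mult_mono mult_left_mono) auto
      finally show ?thesis by (simp add: algebra_simps)
    qed
    \<comment> \<open>All future images of the error are bounded at once. Estimating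
      \<open>e k\<close> alone would cost a factor \<open>C\<close> in every step and ruin the
      rate.\<close>
    have P: "\<forall>j. norm ((L ^^ j) (e k)) \<le> c\<^sup>2 * H * b ^ j * p k ^ 2" if "k \<le> N" for k
      using that
    proof (induction k)
      case 0
      show ?case using c H0 b p[of 0] by (simp add: e_def w_def linear_0[OF lin])
    next
      case (Suc k)
      then have IH: "norm ((L ^^ j) (e k)) \<le> c\<^sup>2 * H * b ^ j * p k ^ 2" for j by simp
      have wk: "norm ((T ^^ k) w) \<le> 2 * c * C1 * p k" using Tk[of k] IH[of 0] Suc.prems by simp
      also have "\<dots> \<le> 2 * c * C1 * 1" using c C1 p[of k] by (intro mult_left_mono) auto
      also have "\<dots> \<le> c0" using c1 by simp
      finally have "norm (T ((T ^^ k) w) - L ((T ^^ k) w)) \<le> K * (norm ((T ^^ k) w))\<^sup>2" by (rule R)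
      also have "\<dots> \<le> K * (2 * c * C1 * p k)\<^sup>2" using wk K by (intro mult_left_mono power_mono) auto
      finally have Rk: "norm (T ((T ^^ k) w) - L ((T ^^ k) w)) \<le> K * (2 * c * C1 * p k)\<^sup>2" .
      have eS: "e (Suc k) = (T ((T ^^ k) w) - L ((T ^^ k) w)) + L (e k)"
        using L by (simp add: e_def linear_diff linear_scale bounded_linear.linear)
      show ?case
      proof
        fix j
        have "(L ^^ j) (e (Suc k)) = (L ^^ j) (T ((T ^^ k) w) - L ((T ^^ k) w)) + (L ^^ Suc j) (e k)"
          by (simp add: eS linear_add[OF lin] funpow_swap1)
        then have "norm ((L ^^ j) (e (Suc k))) \<le> norm ((L ^^ j) (T ((T ^^ k) w) - L ((T ^^ k) w))) + norm ((L ^^ Suc j) (e k))"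
          by (metis norm_triangle_ineq)
        also have "\<dots> \<le> C * b ^ j * (K * (2 * c * C1 * p k)\<^sup>2) + c\<^sup>2 * H * b ^ Suc j * p k ^ 2"
          using order_trans[OF Lb mult_left_mono[OF Rk]] C b IH[of "Suc j"]
          by (intro add_mono) auto
        also have "\<dots> = c\<^sup>2 * b ^ j * p k ^ 2 * (H * b + 4 * C * K * C1\<^sup>2)"
          by (simp add: power2_eq_square algebra_simps)
        also have "\<dots> = c\<^sup>2 * H * b ^ j * (p k ^ 2 * a ^ 2)" unfolding H by (simp add: mult_ac)
        finally show "norm ((L ^^ j) (e (Suc k))) \<le> c\<^sup>2 * H * b ^ j * p (Suc k) ^ 2"
          using pS[of k] Suc.prems by simp
      qed
    qed
    then have Pe: "norm (e k) \<le> c\<^sup>2 * H * p k ^ 2" if "k \<le> N" for k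
      using that by (metis funpow_0 mult.right_neutral power_0)
    have "norm ((T ^^ k) w) \<le> c0" if "k \<le> N" for k
    proof -
      have "norm ((T ^^ k) w) \<le> 2 * c * C1 * p k" by (rule Tk[OF that Pe[OF that]])
      also have "\<dots> \<le> 2 * c * C1 * 1" using c C1 p[of k] by (intro mult_left_mono) auto
      also have "\<dots> \<le> c0" using c1 by simp
      finally show ?thesis .
    qed
    moreover have "norm (D ((T ^^ N) w)) \<ge> c / 2"
    proof -
      have "norm (e N) \<le> c\<^sup>2 * H" using Pe[of N] by (simp add: p_def)
      then have "norm (D (e N)) \<le> c\<^sup>2 * H * Kd"
        using Kd(2)[of "e N"] mult_right_mono[of "norm (e N)" "c\<^sup>2 * H" Kd] Kd(1) by linarith
      also have "\<dots> = c * (Kd * c * H)" by (simp add: power2_eq_square)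
      also have "\<dots> \<le> c * (1 / 2)" using c3 c by (intro mult_left_mono) auto
      finally have De: "norm (D (e N)) \<le> c / 2" by simp
      have "D ((T ^^ N) w) = c *\<^sub>R D ((L ^^ N) v) + D (e N)"
        using D by (simp add: e_def linear_diff linear_scale bounded_linear.linear)
      then have "norm (D ((T ^^ N) w)) \<ge> norm (c *\<^sub>R D ((L ^^ N) v)) - norm (D (e N))"
        by (metis norm_diff_ineq)
      moreover have "norm (c *\<^sub>R D ((L ^^ N) v)) \<ge> c" using N(2) c by simp
      ultimately show ?thesis using De by linarith
    qed
    moreover have "norm w < r"
    proof -
      have "norm v * a ^ N \<le> C1" using N(3)[of 0] by simp
      moreover have "c * C1 / r < a ^ N"
        using n power_increasing[OF N(1), of a] a by linarith
      then have "c * C1 < r * a ^ N" using r by (simp add: divide_simps mult.commute)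
      moreover have "c * (norm v * a ^ N) \<le> c * C1" using c calculation(1) by (intro mult_left_mono) auto
      ultimately have "(c * norm v) * a ^ N < r * a ^ N" by (simp add: mult.assoc)
      then show ?thesis using a c by (simp add: w_def)
    qed
    ultimately show ?thesis by blast
  qed
  then show ?thesis using c by (intro exI[of _ "c / 2"]) auto
qed

text \<open>A number \<open>x\<close> is an eigenvalue of \<open>M d\<close> if \<open>p \<bullet> v = 1\<close> for the solution \<open>v\<close> of
  \<open>x v - M d v + (p \<bullet> v) u = u\<close>. This equation is uniformly solvable for \<open>x \<in> [1, 2]\<close> and small \<open>d\<close>,
  and \<open>p \<bullet> v\<close> is larger than 1 at \<open>x = 1\<close> and smaller than 1 at \<open>x = 2\<close>.\<close>

lemma simple_eigenvalue_perturbation: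
  fixes M :: "real \<Rightarrow> 'a::euclidean_space \<Rightarrow> 'a" and u p :: 'a
  assumes lin: "\<And>d. d \<ge> 0 \<Longrightarrow> linear (M d)"
    and u: "M 0 u = u" and p: "\<And>x. p \<bullet> M 0 x = p \<bullet> x" and pu: "p \<bullet> u = 1"
    and ker: "\<And>h. M 0 h = h \<Longrightarrow> p \<bullet> h = 0 \<Longrightarrow> h = 0"
    and ev: "\<And>x v. M 0 v = x *\<^sub>R v \<Longrightarrow> v \<noteq> 0 \<Longrightarrow> x \<le> 1"
    and C: "C \<ge> 0" "\<And>d x. 0 \<le> d \<Longrightarrow> d \<le> 1 \<Longrightarrow> norm (M d x - M 0 x) \<le> C * d * norm x"
    and s: "s > 0" "\<And>d. 0 \<le> d \<Longrightarrow> d \<le> 1 \<Longrightarrow> p \<bullet> (M d u - u) \<ge> s * d - C2 * d\<^sup>2" and C2: "C2 \<ge> 0"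
  shows "\<exists>d0>0. \<forall>d. 0 < d \<and> d < d0 \<longrightarrow> (\<exists>x>1. \<exists>q. q \<noteq> 0 \<and> M d q = x *\<^sub>R q)"
proof -
  \<comment> \<open>The rank-one border removes the kernel at \<open>x = 1\<close>; when
    \<open>p \<bullet> v = 1\<close> it equals the right-hand side \<open>u\<close>, leaving the
    eigenvalue equation.\<close>
  define B where "B x d v = x *\<^sub>R v - M d v + (p \<bullet> v) *\<^sub>R u" for x d v
  have linB: "linear (B x d)" if "d \<ge> 0" for x d
    unfolding B_def using lin[OF that]
    by (intro linearI) (auto simp: linear_add linear_scale inner_add_right algebra_simps)
  have inj: "v = 0" if x: "x \<in> {1..2}" and v: "B x 0 v = 0" for x v
  proof -
    have "p \<bullet> B x 0 v = x * (p \<bullet> v)" by (simp add: B_def inner_diff_right inner_add_right p pu)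
    then have pv: "p \<bullet> v = 0" using v x by auto
    then have Mv: "M 0 v = x *\<^sub>R v" using v by (simp add: B_def)
    show "v = 0"
    proof (rule ccontr)
      assume "v \<noteq> 0"
      then have "x = 1" using ev[OF Mv] x by auto
      then show False using ker[of v] Mv pv \<open>v \<noteq> 0\<close> by auto
    qed
  qed
  obtain c where c: "c > 0" "\<And>x v. x \<in> {1..2} \<Longrightarrow> c * norm v \<le> norm (B x 0 v)"
  proof -
    define Z where "Z = {1..2::real} \<times> sphere (0::'a) 1"
    have Zc: "compact Z" unfolding Z_def by (intro compact_Times) auto
    have cont: "continuous_on Z (\<lambda>z. norm (B (fst z) 0 (snd z)))"
      unfolding B_def
      by (intro continuous_intros continuous_on_compose2[OF linear_continuous_on[OF linear_conv_bounded_linear[THEN iffD1, OF lin]]]) auto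
    have "Z \<noteq> {}"
      unfolding Z_def using vector_choose_size[of 1] by auto
    then obtain z where z: "z \<in> Z" "\<And>y. y \<in> Z \<Longrightarrow> norm (B (fst z) 0 (snd z)) \<le> norm (B (fst y) 0 (snd y))"
      using continuous_attains_inf[OF Zc _ cont] by blast
    define c where "c = norm (B (fst z) 0 (snd z))"
    have "c > 0" using z(1) inj[of "fst z" "snd z"] unfolding c_def Z_def by auto
    moreover have "c * norm v \<le> norm (B x 0 v)" if "x \<in> {1..2}" for x v
    proof (cases "v = 0")
      case True
      then show ?thesis by simp
    next
      case False
      have "c \<le> norm (B x 0 ((1 / norm v) *\<^sub>R v))"
        using z(2)[of "(x, (1 / norm v) *\<^sub>R v)"] that False by (auto simp: c_def Z_def)
      also have "\<dots> = norm (B x 0 v) / norm v"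
        by (simp add: linear_scale[OF linB])
      finally show ?thesis using False by (simp add: divide_simps)
    qed
    ultimately show ?thesis using that by blast
  qed
  define Q where "Q = norm p * C * (2 / c * norm u)"
  have Q0: "Q \<ge> 0" using c C by (simp add: Q_def)
  \<comment> \<open>In order: the range in which \<open>C\<close> is valid, keeping half of the
    lower bound \<open>c\<close>, letting \<open>s * d\<close> dominate the terms in
    \<open>d\<^sup>2\<close>, and keeping \<open>Q * d\<close> below 1.\<close>
  define d0 where "d0 = Min {1, c / (2 * C + 1), s / (C2 + Q * C + 1), 1 / (Q + 1)}"
  have d0: "d0 > 0" using c C s C2 Q0 by (simp add: d0_def add_nonneg_pos)
  have "\<exists>x>1. \<exists>q. q \<noteq> 0 \<and> M d q = x *\<^sub>R q" if d: "0 < d" "d < d0" for d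
  proof -
    have d1: "d \<le> 1" using d by (simp add: d0_def)
    have "d * (2 * C + 1) < c" using d C by (simp add: d0_def pos_less_divide_eq)
    then have dc: "C * d \<le> c / 2" using d by (simp add: algebra_simps)
    have "d * (C2 + Q * C + 1) < s" using d C C2 Q0
      by (simp add: d0_def pos_less_divide_eq add_nonneg_pos)
    then have ds: "C2 * d + Q * C * d < s" using d by (simp add: algebra_simps)
    have "d * (Q + 1) < 1" using d Q0 by (simp add: d0_def pos_less_divide_eq)
    then have dQ: "Q * d < 1" using d by (simp add: algebra_simps)
    have low: "c / 2 * norm v \<le> norm (B x d v)" if "x \<in> {1..2}" for x v
    proof -
      have "norm (B x 0 v) \<le> norm (B x d v) + norm (M d v - M 0 v)"
        using norm_triangle_ineq[of "B x d v" "M d v - M 0 v"] by (simp add: B_def algebra_simps)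
      moreover have "norm (M d v - M 0 v) \<le> c / 2 * norm v"
        using order_trans[OF C(2)[of d v] mult_right_mono[OF dc]] d d1 by simp
      ultimately show ?thesis using c(2)[OF that, of v] by simp
    qed
    have "\<exists>v. B x d v = u" if "x \<in> {1..2}" for x
    proof -
      have "v = 0" if "B x d v = 0" for v
        using low[OF \<open>x \<in> {1..2}\<close>, of v] that c(1) by (simp add: mult_le_0_iff)
      then have "inj (B x d)" using linear_injective_0[OF linB] d by auto
      then have "surj (B x d)" using linear_injective_imp_surjective[OF linB] d by auto
      then show ?thesis by (metis surjD)
    qed
    then obtain V where V: "\<And>x. x \<in> {1..2} \<Longrightarrow> B x d (V x) = u" by metis
    have nV: "norm v \<le> 2 / c * norm (B x d v)" if "x \<in> {1..2}" for v x
      using low[OF that, of v] c by (simp add: field_simps)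
    have nV': "norm (V x) \<le> 2 / c * norm u" if "x \<in> {1..2}" for x
      using nV[OF that, of "V x"] V[OF that] by simp
    have pMd: "\<bar>p \<bullet> (M d v - M 0 v)\<bar> \<le> norm p * (C * d * norm v)" for v
      using order_trans[OF Cauchy_Schwarz_ineq2 mult_left_mono[OF C(2)[of d v]]] d d1 by auto
    have "continuous_on {1..2} (\<lambda>x. p \<bullet> V x)"
    proof -
      have "((2 / c)\<^sup>2 * norm u)-lipschitz_on {1..2} V"
      proof (rule lipschitz_onI)
        fix x y :: real assume xy: "x \<in> {1..2}" "y \<in> {1..2}"
        have "B x d (V x - V y) = B x d (V x) - B x d (V y)"
          using d by (intro linear_diff linB) auto
        also have "\<dots> = B y d (V y) - B x d (V y)" using V xy by simp
        also have "\<dots> = (y - x) *\<^sub>R V y" by (simp add: B_def algebra_simps)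
        finally have "norm (V x - V y) \<le> 2 / c * (\<bar>y - x\<bar> * norm (V y))"
          using nV[OF xy(1), of "V x - V y"] by simp
        also have "\<dots> \<le> 2 / c * (\<bar>y - x\<bar> * (2 / c * norm u))"
          using nV'[OF xy(2)] c by (intro mult_left_mono) auto
        also have "\<dots> = (2 / c)\<^sup>2 * norm u * \<bar>x - y\<bar>"
          by (simp add: power2_eq_square abs_minus_commute)
        finally show "dist (V x) (V y) \<le> (2 / c)\<^sup>2 * norm u * dist x y" by (simp add: dist_norm)
      qed simp
      then have "continuous_on {1..2} V" by (rule lipschitz_on_continuous_on)
      then show ?thesis by (intro continuous_intros)
    qed
    \<comment> \<open>For \<open>d = 0\<close>, pairing with \<open>p\<close> gives
      \<open>p \<bullet> V x = 1 / x\<close>; at \<open>x = 2\<close> the value 1/2 leaves ample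
      room for the perturbation.\<close>
    moreover have "p \<bullet> V 2 \<le> 1"
    proof -
      have "p \<bullet> B 2 d (V 2) = 1" using V[of 2] pu by simp
      moreover have "p \<bullet> B 2 d (V 2) = 2 * (p \<bullet> V 2) - p \<bullet> (M d (V 2) - M 0 (V 2))"
        by (simp add: B_def inner_add_right inner_diff_right p pu)
      moreover have "norm p * (C * d * norm (V 2)) \<le> norm p * (C * d * (2 / c * norm u))"
        using nV'[of 2] C d by (intro mult_left_mono) auto
      then have "norm p * (C * d * norm (V 2)) \<le> Q * d" by (simp add: Q_def mult_ac)
      ultimately show ?thesis using pMd[of "V 2"] dQ by linarith
    qed
    moreover have g1: "p \<bullet> V 1 > 1"
    proof -
      \<comment> \<open>At \<open>x = 1\<close> the unperturbed value is exactly 1, so the first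
        order decides. As \<open>h\<close> is \<open>O(d)\<close>, it affects the pairing only at
        order \<open>d\<^sup>2\<close>.\<close>
      define h where "h = V 1 - u"
      have "B 1 d h = B 1 d (V 1) - B 1 d u"
        unfolding h_def using d by (intro linear_diff linB) auto
      also have "\<dots> = M d u - M 0 u" using V[of 1] u pu by (simp add: B_def)
      finally have "norm h \<le> 2 / c * norm (M d u - M 0 u)" using nV[of 1 h] by simp
      also have "\<dots> \<le> 2 / c * (C * d * norm u)" using C(2)[of d u] d d1 c by (intro mult_left_mono) auto
      finally have h: "norm h \<le> 2 / c * (C * d * norm u)" .
      have "p \<bullet> B 1 d (V 1) = 1" using V[of 1] pu by simp
      moreover have "p \<bullet> B 1 d (V 1) = p \<bullet> V 1 - p \<bullet> (M d (V 1) - M 0 (V 1))"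
        by (simp add: B_def inner_add_right inner_diff_right p pu)
      moreover have "M d (V 1) - M 0 (V 1) = (M d u - u) + (M d h - M 0 h)"
      proof -
        have "V 1 = u + h" by (simp add: h_def)
        then show ?thesis using d lin[of d] lin[of 0] u by (simp add: linear_add)
      qed
      moreover have "norm p * (C * d * norm h) \<le> norm p * (C * d * (2 / c * (C * d * norm u)))"
        using h C d by (intro mult_left_mono) auto
      then have "norm p * (C * d * norm h) \<le> Q * C * d * d" by (simp add: Q_def mult_ac)
      moreover have "(C2 * d + Q * C * d) * d < s * d" using ds d by simp
      then have "C2 * d\<^sup>2 + Q * C * d * d < s * d" by (simp add: power2_eq_square algebra_simps)
      ultimately show ?thesis using pMd[of h] s(2)[of d] d d1 by (simp add: inner_add_right)
    qed
    ultimately obtain x where x: "1 \<le> x" "x \<le> 2" "p \<bullet> V x = 1"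
      using IVT2'[of "\<lambda>x. p \<bullet> V x" 2 1 1] by auto
    have "x \<noteq> 1" using x(3) g1 by auto
    then have "x > 1" using x(1) by simp
    moreover have "V x \<noteq> 0" using x(3) by auto
    moreover have "M d (V x) = x *\<^sub>R V x" using V[of x] x by (simp add: B_def)
    ultimately show ?thesis by blast
  qed
  then show ?thesis using d0 by blast
qed

section \<open>Periodic orbits and transversal multipliers\<close>

lemma C2_map_continuous:
  assumes "C2_map F F'"
  shows "continuous_on UNIV F" "continuous_on UNIV F'"
proof -
  obtain F'' where F'': "\<And>x. (F' has_derivative blinfun_apply (F'' x)) (at x)"
    and F': "\<And>x. (F has_derivative blinfun_apply (F' x)) (at x)"
    using assms unfolding C2_map_def by blast
  show "continuous_on UNIV F" "continuous_on UNIV F'"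
    using has_derivative_continuous[OF F'] has_derivative_continuous[OF F'']
    by (simp_all add: continuous_at_imp_continuous_on)
qed

text \<open>Continuity bounds \<open>F\<close>, \<open>F'\<close> and the second derivative on the
  compact ball; its convexity turns these into Lipschitz and Taylor bounds along segments.\<close>

lemma C2_map_estimates:
  assumes "C2_map F F'"
  obtains K B where "K > 0" "B > 0" "\<And>x. norm x \<le> r \<Longrightarrow> norm (F x) \<le> K"
    "\<And>x. norm x \<le> r \<Longrightarrow> norm (F' x) \<le> K"
    "\<And>x y. norm x \<le> r \<Longrightarrow> norm y \<le> r \<Longrightarrow> norm (F x - F y) \<le> K * norm (x - y)"
    "\<And>x y. norm x \<le> r \<Longrightarrow> norm y \<le> r \<Longrightarrow> norm (F y - F x - F' x (y - x)) \<le> B * (norm (y - x))\<^sup>2"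
proof -
  obtain F'' where F'': "continuous_on UNIV F''" "\<And>x. (F' has_derivative blinfun_apply (F'' x)) (at x)"
    and F': "\<And>x. (F has_derivative blinfun_apply (F' x)) (at x)"
    using assms unfolding C2_map_def by blast
  define S where "S = cball (0::'a) r"
  have mem: "x \<in> S \<longleftrightarrow> norm x \<le> r" for x by (simp add: S_def)
  have conv: "convex S" by (simp add: S_def)
  have "bounded ((\<lambda>x. norm (f x)) ` S)" if "continuous_on UNIV f" for f :: "'a \<Rightarrow> 'b::real_normed_vector"
    unfolding S_def by (intro compact_imp_bounded compact_continuous_image continuous_intros
        continuous_on_subset[OF that]) auto
  then have bnd: "\<exists>K>0. \<forall>x\<in>S. norm (f x) \<le> K" if "continuous_on UNIV f" for f :: "'a \<Rightarrow> 'b::real_normed_vector"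
    using that unfolding bounded_pos by fastforce
  obtain K1 where K1: "K1 > 0" "\<And>x. x \<in> S \<Longrightarrow> norm (F x) \<le> K1"
    using bnd[OF C2_map_continuous(1)[OF assms]] by blast
  obtain K2 where K2: "K2 > 0" "\<And>x. x \<in> S \<Longrightarrow> norm (F' x) \<le> K2"
    using bnd[OF C2_map_continuous(2)[OF assms]] by blast
  obtain B where B: "B > 0" "\<And>x. x \<in> S \<Longrightarrow> norm (F'' x) \<le> B"
    using bnd[OF F''(1)] by blast
  define K where "K = max K1 K2"
  have K: "K > 0" "\<And>x. x \<in> S \<Longrightarrow> norm (F x) \<le> K" "\<And>x. x \<in> S \<Longrightarrow> norm (F' x) \<le> K"
    using K1 K2 unfolding K_def by (auto simp: le_max_iff_disj)
  have lip: "norm (F x - F y) \<le> K * norm (x - y)" if "x \<in> S" "y \<in> S" for x y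
    by (rule differentiable_bound[OF conv has_derivative_at_withinI[OF F'] _ that])
      (use K(3) in \<open>simp flip: norm_blinfun.rep_eq\<close>)
  have lip': "norm (F' x - F' y) \<le> B * norm (x - y)" if "x \<in> S" "y \<in> S" for x y
    by (rule differentiable_bound[OF conv has_derivative_at_withinI[OF F''(2)] _ that])
      (use B(2) in \<open>simp flip: norm_blinfun.rep_eq\<close>)
  have quad: "norm (F y - F x - F' x (y - x)) \<le> B * (norm (y - x))\<^sup>2" if "x \<in> S" "y \<in> S" for x y
  proof -
    have seg: "closed_segment x y \<subseteq> S"
      by (rule closed_segment_subset[OF that conv])
    have "norm (F y - F x - F' x (y - x)) \<le> norm (y - x) * (B * norm (y - x))"
    proof (rule differentiable_bound_linearization[where S = "closed_segment x y" and f' = "\<lambda>z. blinfun_apply (F' z)"])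
      show "x + t *\<^sub>R (y - x) \<in> closed_segment x y" if "t \<in> {0..1}" for t
        using that by (auto simp: closed_segment_def algebra_simps intro!: exI[of _ t])
      show "(F has_derivative blinfun_apply (F' z)) (at z within closed_segment x y)" for z
        by (rule has_derivative_at_withinI[OF F'])
      show "onorm (blinfun_apply (F' z) - blinfun_apply (F' x)) \<le> B * norm (y - x)"
        if z: "z \<in> closed_segment x y" for z
      proof -
        have "onorm (blinfun_apply (F' z) - blinfun_apply (F' x)) = norm (F' z - F' x)"
          by (simp add: norm_blinfun.rep_eq minus_blinfun.rep_eq fun_diff_def)
        also have "\<dots> \<le> B * norm (z - x)" using seg z \<open>x \<in> S\<close> by (intro lip') auto
        also have "\<dots> \<le> B * norm (y - x)"
          using segment_bound(1)[OF z] B(1) by (intro mult_left_mono) auto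
        finally show ?thesis .
      qed
    qed auto
    then show ?thesis by (simp add: power2_eq_square mult_ac)
  qed
  show ?thesis using that[of K B] K B(1) lip quad by (auto simp: mem)
qed

text \<open>The mean value inequality applied after subtracting uniform motion. With
  \<open>v = 0\<close> it is a Lipschitz bound, with a typical velocity \<open>v\<close> a
  first-order expansion of the displacement.\<close>

lemma has_vector_derivative_norm_bound:
  fixes x :: "real \<Rightarrow> 'a::real_normed_vector"
  assumes "\<And>t. t \<in> {a..b} \<Longrightarrow> (x has_vector_derivative x' t) (at t within {a..b})"
    and "\<And>t. t \<in> {a..b} \<Longrightarrow> norm (x' t - v) \<le> B" and "s \<in> {a..b}" "t \<in> {a..b}"
  shows "norm (x t - x s - (t - s) *\<^sub>R v) \<le> B * \<bar>t - s\<bar>"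
proof -
  have "norm ((\<lambda>t. x t - t *\<^sub>R v) t - (\<lambda>t. x t - t *\<^sub>R v) s) \<le> B * norm (t - s)"
  proof (rule differentiable_bound[where S = "{a..b}"])
    fix r assume r: "r \<in> {a..b}"
    show "((\<lambda>t. x t - t *\<^sub>R v) has_derivative (\<lambda>h. h *\<^sub>R (x' r - v))) (at r within {a..b})"
      using assms(1)[OF r] unfolding has_vector_derivative_def
      by (auto intro!: derivative_eq_intros simp: scaleR_diff_right)
    show "onorm (\<lambda>h. h *\<^sub>R (x' r - v)) \<le> B"
    proof (rule onorm_bound)
      show "B \<ge> 0" using assms(2)[OF r] norm_ge_zero order_trans by blast
      show "norm (h *\<^sub>R (x' r - v)) \<le> B * norm h" for h
        using mult_left_mono[OF assms(2)[OF r], of "\<bar>h\<bar>"] by (simp add: mult.commute)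
    qed
  qed (use assms in auto)
  then show ?thesis by (simp add: algebra_simps)
qed

lemma periodic_range:
  fixes x :: "real \<Rightarrow> 'a"
  assumes "\<And>t. x (t + p) = x t" "p > 0"
  obtains s where "s \<in> {0..p}" "x s = x t"
proof -
  interpret periodic_fun_simple x p by unfold_locales (rule assms)
  define s where "s = t - of_int \<lfloor>t / p\<rfloor> * p"
  have "x (s + of_int \<lfloor>t / p\<rfloor> * p) = x s" by (rule plus_of_int)
  moreover have "of_int \<lfloor>t / p\<rfloor> * p \<le> t"
    using assms(2) by (simp add: pos_le_divide_eq[symmetric])
  moreover have "t < (of_int \<lfloor>t / p\<rfloor> + 1) * p"
    using assms(2) by (simp add: pos_divide_less_eq[symmetric])
  ultimately show ?thesis using that[of s] by (auto simp: s_def algebra_simps)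
qed

locale periodic_orbit =
  fixes F :: "'a::euclidean_space \<Rightarrow> 'a" and F' :: "'a \<Rightarrow> 'a \<Rightarrow>\<^sub>L 'a"
    and \<phi> :: "real \<Rightarrow> 'a" and P :: real
  assumes C2: "C2_map F F'" and P: "P > 0"
    and \<phi>: "\<And>t. (\<phi> has_vector_derivative F (\<phi> t)) (at t)"
    and \<phi>_per: "\<And>t. \<phi> (t + P) = \<phi> t"
begin

lemma cont_\<phi>: "continuous_on S \<phi>"
  using \<phi> by (intro continuous_at_imp_continuous_on) (auto dest: has_vector_derivative_continuous)

lemma bounded_\<phi>:
  obtains r where "r > 0" "\<And>t. norm (\<phi> t) \<le> r"
proof -
  have "bounded (\<phi> ` {0..P})"
    by (intro compact_imp_bounded compact_continuous_image cont_\<phi>) auto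
  then obtain r where r: "r > 0" "\<And>t. t \<in> {0..P} \<Longrightarrow> norm (\<phi> t) \<le> r"
    unfolding bounded_pos by auto
  have "norm (\<phi> t) \<le> r" for t
    using periodic_range[of \<phi> P t, OF \<phi>_per P] r(2) by metis
  then show ?thesis using that r(1) by blast
qed

lemma cont_F': "continuous_on S (\<lambda>t. F' (\<phi> t))"
  by (rule continuous_on_compose2[OF C2_map_continuous(2)[OF C2] cont_\<phi>]) auto

lemma \<phi>_P: "\<phi> P = \<phi> 0" using \<phi>_per[of 0] by simp

text \<open>Differentiating the orbit equation shows that the velocity solves the variational
  equation; periodicity then makes \<open>F (\<phi> 0)\<close> an eigenvector of the monodromy for
  the multiplier 1.\<close>

lemma velocity: "((\<lambda>t. F (\<phi> t)) has_vector_derivative F' (\<phi> t) (F (\<phi> t))) (at t)"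
proof -
  have "(F has_derivative F' (\<phi> t)) (at (\<phi> t))" using C2 by (simp add: C2_map_def)
  from vector_derivative_diff_chain_within[OF \<phi> has_derivative_at_withinI[OF this]]
  show ?thesis by (simp add: comp_def)
qed

end

text \<open>Simplicity of the multiplier 1 as linear algebra: \<open>p\<close> is a left eigenvector
  of the monodromy \<open>W P\<close>, normalised on the velocity, and no fixed vector other than 0
  lies in the hyperplane orthogonal to \<open>p\<close>.\<close>

locale hyperbolic_orbit = periodic_orbit F F' \<phi> P
  for F :: "'a::euclidean_space \<Rightarrow> 'a" and F' \<phi> P +
  fixes W :: "real \<Rightarrow> 'a \<Rightarrow> 'a" and p :: 'a
  assumes W: "linear_flow (\<lambda>t. F' (\<phi> t)) P W"
    and p: "\<And>x. p \<bullet> W P x = p \<bullet> x" and pu: "p \<bullet> F (\<phi> 0) = 1"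
    and ker: "\<And>h. W P h = h \<Longrightarrow> p \<bullet> h = 0 \<Longrightarrow> h = 0"
begin

lemma norm_F'_\<phi>:
  obtains K where "K > 0" "\<And>t. norm (F' (\<phi> t)) \<le> K"
proof -
  obtain r where r: "r > 0" "\<And>t. norm (\<phi> t) \<le> r" using bounded_\<phi> by blast
  then show ?thesis using C2_map_estimates[OF C2, of r] that by metis
qed

lemma W_velocity:
  assumes "t \<in> {0..P}"
  shows "W t (F (\<phi> 0)) = F (\<phi> t)"
proof -
  obtain K where K: "K > 0" "\<And>t. norm (F' (\<phi> t)) \<le> K" using norm_F'_\<phi> by blast
  show ?thesis
    by (rule linear_flow_unique[OF K(2) W _ assms, of "\<lambda>t. F (\<phi> t)", symmetric])
      (rule has_vector_derivative_at_within[OF velocity])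
qed

text \<open>Adding the rank-one map with image along the velocity makes \<open>W P - 1\<close>
  injective, hence bounded below; on the hyperplane orthogonal to \<open>p\<close> the added term
  vanishes.\<close>

lemma W_lower_bound:
  obtains c where "c > 0" "\<And>h. p \<bullet> h = 0 \<Longrightarrow> c * norm h \<le> norm (W P h - h)"
proof -
  obtain K where K: "K > 0" "\<And>t. norm (F' (\<phi> t)) \<le> K" using norm_F'_\<phi> by blast
  have lin: "linear (W P)" using P by (intro linear_flow_linear[OF K(2) W]) auto
  define f where "f h = W P h - h + (p \<bullet> h) *\<^sub>R F (\<phi> 0)" for h
  have linf: "linear f"
    unfolding f_def using lin
    by (intro linearI) (auto simp: linear_add linear_scale inner_add_right algebra_simps)
  have pf: "p \<bullet> f h = p \<bullet> h" for h
    by (simp add: f_def inner_add_right inner_diff_right p pu)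
  have "h = 0" if "f h = 0" for h
    using pf[of h] that ker[of h] by (simp add: f_def)
  then have "inj f" using linear_injective_0[OF linf] by auto
  then obtain c where c: "c > 0" "\<And>x. c * norm x \<le> norm (f x)"
    using linear_inj_bounded_below_pos[OF linf] by blast
  show ?thesis
  proof (rule that[OF c(1)])
    fix h assume "p \<bullet> h = 0"
    then show "c * norm h \<le> norm (W P h - h)" using c(2)[of h] by (simp add: f_def)
  qed
qed

text \<open>The velocity is fixed by the monodromy for \<open>d = 0\<close>. Along it the extra
  forcing is \<open>- d E \<phi>'\<close> up to \<open>O(d\<^sup>2)\<close>, because the flows
  differ by \<open>O(d)\<close>. Pairing with \<open>q\<close> gives
  \<open>p \<bullet> (V d P u - u) = - d k + O(d\<^sup>2)\<close>, the first-order input of the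
  eigenvalue perturbation.\<close>

lemma transversal_eigenvalue:
  fixes E :: "'a \<Rightarrow>\<^sub>L 'a"
  assumes q: "continuous_on {0..P} q"
    and adj: "\<And>y g. (\<And>t. t \<in> {0..P} \<Longrightarrow> (y has_vector_derivative F' (\<phi> t) (y t) + g t) (at t within {0..P})) \<Longrightarrow>
       ((\<lambda>t. q t \<bullet> g t) has_integral (p \<bullet> (y P - y 0))) {0..P}"
    and ev: "\<And>x v. W P v = x *\<^sub>R v \<Longrightarrow> v \<noteq> 0 \<Longrightarrow> x \<le> 1"
    and neg: "integral {0..P} (\<lambda>t. q t \<bullet> E (F (\<phi> t))) < 0"
  shows "\<exists>d0>0. \<forall>d. 0 < d \<and> d < d0 \<longrightarrow>
    (\<exists>V. linear_flow (\<lambda>t. F' (\<phi> t) - d *\<^sub>R E) P V \<and> (\<exists>x>1. \<exists>v. v \<noteq> 0 \<and> V P v = x *\<^sub>R v))"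
proof -
  obtain K where K: "K > 0" "\<And>t. norm (F' (\<phi> t)) \<le> K" using norm_F'_\<phi> by blast
  have Kd: "norm (F' (\<phi> t) - d *\<^sub>R E) \<le> K + \<bar>d\<bar> * norm E" for d t
    using norm_triangle_ineq4[of "F' (\<phi> t)" "d *\<^sub>R E"] K(2)[of t] by simp
  have contd: "continuous_on UNIV (\<lambda>t. F' (\<phi> t) - d *\<^sub>R E)" for d
    by (intro continuous_intros cont_F')
  have "\<exists>V. linear_flow (\<lambda>t. F' (\<phi> t) - d *\<^sub>R E) P V" for d
    using linear_flow_exists[OF contd Kd] by blast
  then obtain V where V: "\<And>d. linear_flow (\<lambda>t. F' (\<phi> t) - d *\<^sub>R E) P (V d)" by metis
  have PP: "P \<in> {0..P}" using P by simp
  define G where "G = exp ((K + norm E) * P)"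
  have G0: "G > 0" by (simp add: G_def)
  have Vn: "norm (V d t x) \<le> G * norm x" if "t \<in> {0..P}" "0 \<le> d" "d \<le> 1" for d t x
  proof -
    have "norm (V d t x) \<le> exp ((K + \<bar>d\<bar> * norm E) * t) * norm x"
      by (rule linear_flow_norm_le[OF Kd V that(1)])
    also have "\<dots> \<le> exp ((K + 1 * norm E) * P) * norm x"
      using that K P by (intro mult_right_mono exp_le_cancel_iff[THEN iffD2] mult_mono add_left_mono) auto
    finally show ?thesis by (simp add: G_def)
  qed
  have Vder: "((\<lambda>t. V d t x) has_vector_derivative F' (\<phi> t) (V d t x) + (- d) *\<^sub>R E (V d t x)) (at t within {0..P})"
    if "t \<in> {0..P}" for d t x
    using V[of d] that by (simp add: linear_flow_def blinfun.diff_left blinfun.scaleR_left)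
  have V0: "V d 0 x = x" for d x using V[of d] by (simp add: linear_flow_def)
  have diff: "norm (V d t x - W t x) \<le> norm E * G * P * G * d * norm x"
    if t: "t \<in> {0..P}" and d: "0 \<le> d" "d \<le> 1" for d t x
  proof -
    have "norm (V d t x - W t (V d 0 x)) \<le> (d * (norm E * (G * norm x))) * t * exp (K * t)"
    proof (rule linear_flow_perturbation[OF K(2) W Vder _ t])
      fix s assume s: "s \<in> {0..P}"
      have "norm (E (V d s x)) \<le> norm E * norm (V d s x)" by (rule norm_blinfun)
      also have "\<dots> \<le> norm E * (G * norm x)" using Vn[OF s d] by (intro mult_left_mono) auto
      finally show "norm ((- d) *\<^sub>R E (V d s x)) \<le> d * (norm E * (G * norm x))"
        using d by (simp add: mult_left_mono)
    qed
    also have "\<dots> \<le> (d * (norm E * (G * norm x))) * P * G"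
      unfolding G_def using t d K
      by (intro mult_mono exp_le_cancel_iff[THEN iffD2]) auto
    finally show ?thesis by (simp add: V0 mult_ac)
  qed
  have VW: "V 0 t x = W t x" if "t \<in> {0..P}" for t x
    using diff[OF that, of 0 x] by simp
  define C where "C = norm E * G * P * G"
  have C0: "C \<ge> 0" using P G0 by (simp add: C_def)
  have "bounded (q ` {0..P})" by (intro compact_imp_bounded compact_continuous_image q) auto
  then obtain Q where Q: "Q > 0" "\<And>t. t \<in> {0..P} \<Longrightarrow> norm (q t) \<le> Q"
    unfolding bounded_pos by auto
  define k where "k = integral {0..P} (\<lambda>t. q t \<bullet> E (F (\<phi> t)))"
  have contF\<phi>: "continuous_on S (\<lambda>t. F (\<phi> t))" for S
    by (rule continuous_on_compose2[OF C2_map_continuous(1)[OF C2] cont_\<phi>]) auto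
  have kint: "((\<lambda>t. q t \<bullet> E (F (\<phi> t))) has_integral k) {0..P}"
    unfolding k_def by (intro integrable_integral integrable_continuous_interval continuous_intros q contF\<phi>)
  define u where "u = F (\<phi> 0)"
  define C2 where "C2 = Q * (norm E * (C * norm u)) * P"
  have ineq: "p \<bullet> (V d P u - u) \<ge> (- k) * d - C2 * d\<^sup>2" if d: "0 \<le> d" "d \<le> 1" for d
  proof -
    have "((\<lambda>t. q t \<bullet> ((- d) *\<^sub>R E (V d t u))) has_integral (p \<bullet> (V d P u - V d 0 u))) {0..P}"
      by (rule adj[OF Vder])
    from has_integral_diff[OF this has_integral_mult_right[OF kint, of "- d"]]
    have I: "((\<lambda>t. q t \<bullet> ((- d) *\<^sub>R E (V d t u)) - (- d) * (q t \<bullet> E (F (\<phi> t)))) has_integral (p \<bullet> (V d P u - u) + d * k)) {0..P}"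
      by (simp add: V0)
    have "norm (p \<bullet> (V d P u - u) + d * k) \<le> d * (Q * (norm E * (C * d * norm u))) * measure lborel (cbox 0 P)"
    proof (rule has_integral_bound)
      show "0 \<le> d * (Q * (norm E * (C * d * norm u)))" using d Q C0 by simp
      show "((\<lambda>t. q t \<bullet> ((- d) *\<^sub>R E (V d t u)) - (- d) * (q t \<bullet> E (F (\<phi> t)))) has_integral (p \<bullet> (V d P u - u) + d * k)) (cbox 0 P)"
        using I by simp
      fix t assume "t \<in> cbox 0 P"
      then have t: "t \<in> {0..P}" by simp
      have "q t \<bullet> ((- d) *\<^sub>R E (V d t u)) - (- d) * (q t \<bullet> E (F (\<phi> t))) = (- d) * (q t \<bullet> E (V d t u - W t u))"
        using W_velocity[OF t] by (simp add: u_def blinfun.diff_right inner_diff_right algebra_simps)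
      then have "norm (q t \<bullet> ((- d) *\<^sub>R E (V d t u)) - (- d) * (q t \<bullet> E (F (\<phi> t)))) = d * \<bar>q t \<bullet> E (V d t u - W t u)\<bar>"
        using d by (simp add: abs_mult)
      also have "\<bar>q t \<bullet> E (V d t u - W t u)\<bar> \<le> norm (q t) * norm (E (V d t u - W t u))"
        by (rule Cauchy_Schwarz_ineq2)
      also have "\<dots> \<le> Q * (norm E * norm (V d t u - W t u))"
        using Q Q(2)[OF t] by (intro mult_mono norm_blinfun) auto
      also have "\<dots> \<le> Q * (norm E * (C * d * norm u))"
        using diff[OF t d, of u] Q by (intro mult_left_mono) (auto simp: C_def)
      finally show "norm (q t \<bullet> ((- d) *\<^sub>R E (V d t u)) - (- d) * (q t \<bullet> E (F (\<phi> t)))) \<le> d * (Q * (norm E * (C * d * norm u)))"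
        using d by (simp add: mult_left_mono)
    qed
    then have "\<bar>p \<bullet> (V d P u - u) + d * k\<bar> \<le> C2 * d\<^sup>2"
      using P by (simp add: C2_def power2_eq_square mult_ac)
    then show ?thesis by (simp add: abs_le_iff algebra_simps)
  qed
  have "\<exists>d0>0. \<forall>d. 0 < d \<and> d < d0 \<longrightarrow> (\<exists>x>1. \<exists>v. v \<noteq> 0 \<and> V d P v = x *\<^sub>R v)"
  proof (rule simple_eigenvalue_perturbation[where u = u and p = p and C = C and s = "- k" and ?C2.0 = C2])
    show "linear (V d P)" for d by (rule linear_flow_linear[OF Kd V PP])
    show "V 0 P u = u" using W_velocity[OF PP] \<phi>_P by (simp add: VW[OF PP] u_def)
    show "p \<bullet> V 0 P x = p \<bullet> x" for x by (simp add: VW[OF PP] p)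
    show "p \<bullet> u = 1" by (simp add: u_def pu)
    show "h = 0" if "V 0 P h = h" "p \<bullet> h = 0" for h using that ker by (simp add: VW[OF PP])
    show "x \<le> 1" if "V 0 P v = x *\<^sub>R v" "v \<noteq> 0" for x v using that ev by (simp add: VW[OF PP])
    show "norm (V d P x - V 0 P x) \<le> C * d * norm x" if "0 \<le> d" "d \<le> 1" for d x
      using diff[OF PP that, of x] by (simp add: C_def VW[OF PP])
    show "- k > 0" using neg by (simp add: k_def)
    show "C2 \<ge> 0" using Q C0 P by (simp add: C2_def)
  qed (use C0 ineq in auto)
  then show ?thesis using V by metis
qed

end

section \<open>The derivative of the period\<close>

lemma eventually_at_right_lt:
  fixes c :: real
  assumes "c > 0"
  shows "\<forall>\<^sub>F e in at_right 0. 0 < e \<and> e < c"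
  using eventually_at_right_real[OF assms] by simp

text \<open>The derivative \<open>x'\<close> is carried along explicitly, tied to the orbit by the
  implicit equation, so that \<open>I + e E\<close> is never inverted. Closeness to
  \<open>\<phi>\<close> is known only on \<open>{0..P}\<close> and without a rate.\<close>

locale perturbed_family = hyperbolic_orbit F F' \<phi> P W p
  for F :: "'a::euclidean_space \<Rightarrow> 'a" and F' \<phi> P W p +
  fixes E :: "'a \<Rightarrow>\<^sub>L 'a" and x x' :: "real \<Rightarrow> real \<Rightarrow> 'a" and Pf :: "real \<Rightarrow> real" and P' e0 :: real
  assumes e0: "e0 > 0"
    and x: "\<And>e t. \<bar>e\<bar> < e0 \<Longrightarrow> (x e has_vector_derivative x' e t) (at t)"
    and x_eq: "\<And>e t. \<bar>e\<bar> < e0 \<Longrightarrow> x' e t + e *\<^sub>R E (x' e t) = F (x e t)"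
    and x_per: "\<And>e t. \<bar>e\<bar> < e0 \<Longrightarrow> x e (t + Pf e) = x e t"
    and Pf_pos: "\<And>e. \<bar>e\<bar> < e0 \<Longrightarrow> Pf e > 0"
    and close: "\<And>\<eta>. \<eta> > 0 \<Longrightarrow> \<exists>\<rho>>0. \<forall>e. \<bar>e\<bar> < \<rho> \<longrightarrow> (\<forall>t\<in>{0..P}. dist (x e t) (\<phi> t) < \<eta>)"
    and Pf_0: "Pf 0 = P" and Pf': "(Pf has_real_derivative P') (at 0)" and P': "P' < 0"
begin

lemma Pf_quotient: "((\<lambda>e. (Pf e - P) / e) \<longlongrightarrow> P') (at_right 0)"
  using Pf' unfolding DERIV_def by (simp add: Pf_0 filterlim_at_split)

text \<open>Only positive \<open>e\<close> are considered. A negative derivative then makes the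
  perturbed period shorter than \<open>P\<close>, so a full perturbed period fits into the window
  where closeness is known.\<close>

lemma Pf_bound: "\<forall>\<^sub>F e in at_right 0. Pf e < P \<and> P - Pf e \<le> (\<bar>P'\<bar> + 1) * e"
proof -
  have "\<forall>\<^sub>F e in at_right 0. (Pf e - P) / e < 0"
    by (rule order_tendstoD(2)[OF Pf_quotient P'])
  moreover have "\<forall>\<^sub>F e in at_right 0. (Pf e - P) / e > P' - 1"
    by (rule order_tendstoD(1)[OF Pf_quotient]) simp
  ultimately show ?thesis using eventually_at_right_lt[of 1, OF zero_less_one]
  proof eventually_elim
    case (elim e)
    then have "(P' - 1) * e < Pf e - P" by (intro pos_less_divide_eq[THEN iffD1]) auto
    then show ?case using elim P' by (simp add: divide_less_0_iff algebra_simps)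
  qed
qed

definition approx :: "real \<Rightarrow> (real \<Rightarrow> 'a) \<Rightarrow> (real \<Rightarrow> 'a) \<Rightarrow> bool" where
  "approx e X X' \<longleftrightarrow> (\<forall>t. (X has_vector_derivative X' t) (at t)) \<and>
     (\<forall>t. X' t + e *\<^sub>R E (X' t) = F (X t)) \<and> (\<forall>t. X (t + Pf e) = X t) \<and> p \<bullet> (X 0 - \<phi> 0) = 0"

text \<open>Shifting time, the perturbed orbits can be made to start at a point \<open>X 0\<close> with
  \<open>p \<bullet> (X 0 - \<phi> 0) = 0\<close>, so that \<open>W_lower_bound\<close> applies to \<open>X 0 - \<phi> 0\<close>.\<close>

lemma approx_exists:
  assumes r: "\<And>t. norm (\<phi> t) \<le> r" and K: "K > 0" "\<And>z. norm z \<le> r + 1 \<Longrightarrow> norm (F z) \<le> K"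
    and \<eta>: "\<eta> > 0" "\<eta> \<le> 1"
  shows "\<forall>\<^sub>F e in at_right 0. \<exists>X X'. approx e X X' \<and> (\<forall>t. norm (X t) \<le> r + 1) \<and>
    (\<forall>t. norm (X' t) \<le> 2 * K) \<and> (\<forall>t\<in>{0..P}. norm (X t - \<phi> t) \<le> \<eta>)"
proof -
  \<comment> \<open>The phase of \<open>\<phi>\<close> relative to the section orthogonal to
    \<open>p\<close>; it crosses 0 with slope \<open>p \<bullet> F (\<phi> 0) = 1\<close>, and so
    strictly changes sign.\<close>
  define f where "f s = p \<bullet> (\<phi> s - \<phi> 0)" for s
  have "(f has_real_derivative 1) (at 0)"
  proof -
    have "((\<lambda>s. p \<bullet> (\<phi> s - \<phi> 0)) has_vector_derivative p \<bullet> (F (\<phi> 0) - 0)) (at 0)"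
      by (intro bounded_linear.has_vector_derivative[OF bounded_linear_inner_right]
          has_vector_derivative_diff \<phi> has_vector_derivative_const)
    then show ?thesis
      by (simp add: f_def[abs_def] pu has_real_derivative_iff_has_vector_derivative)
  qed
  then obtain d1 d2 where d1: "d1 > 0" "\<And>h. 0 < h \<Longrightarrow> h < d1 \<Longrightarrow> f 0 < f (0 + h)"
    and d2: "d2 > 0" "\<And>h. 0 < h \<Longrightarrow> h < d2 \<Longrightarrow> f (0 - h) < f 0"
    using DERIV_pos_inc_right[of f 1 0] DERIV_pos_inc_left[of f 1 0] by auto
  \<comment> \<open>Small enough for the sign change at \<open>h\<close> and \<open>- h\<close>, for
    \<open>P - h\<close> to stay in the window, and for a time shift by \<open>h\<close> to move the
    perturbed orbit by at most half of \<open>\<eta>\<close>.\<close>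
  define h where "h = Min {d1 / 2, d2 / 2, P / 2, \<eta> / (4 * K)}"
  have h: "h > 0" "h < d1" "h < d2" "h \<le> P / 2"
    using d1 d2 P \<eta> K by (simp_all add: h_def)
  have "h \<le> \<eta> / (4 * K)" by (simp add: h_def)
  then have hK: "2 * K * h \<le> \<eta> / 2" using K by (simp add: pos_le_divide_eq mult_ac)
  define m where "m = min (f h) (- f (- h))"
  have m: "m > 0" using d1(2)[of h] d2(2)[of h] h by (simp add: m_def f_def)
  define \<eta>1 where "\<eta>1 = min (\<eta> / 4) (m / (2 * (norm p + 1)))"
  have \<eta>1: "\<eta>1 > 0" using \<eta> m by (simp add: \<eta>1_def add_nonneg_pos)
  have \<eta>14: "\<eta>1 \<le> \<eta> / 4" unfolding \<eta>1_def by (rule min.cobounded1)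
  have "\<eta>1 \<le> m / (2 * (norm p + 1))" by (simp add: \<eta>1_def)
  then have "\<eta>1 * (2 * (norm p + 1)) \<le> m" by (simp add: pos_le_divide_eq add_nonneg_pos)
  then have pm: "norm p * (2 * \<eta>1) < m" using \<eta>1 by (simp add: algebra_simps)
  have "isCont Pf 0" using Pf' by (rule DERIV_isCont)
  then have Pft: "(Pf \<longlongrightarrow> P) (at_right 0)" by (simp add: isCont_def Pf_0 filterlim_at_split)
  have ev1: "\<forall>\<^sub>F e in at_right 0. Pf e > P / 2 \<and> Pf e > P - \<eta>1 / (2 * K)"
    using P K \<eta>1 by (intro eventually_conj order_tendstoD(1)[OF Pft]) auto
  obtain \<rho> where \<rho>: "\<rho> > 0" "\<And>e t. \<bar>e\<bar> < \<rho> \<Longrightarrow> t \<in> {0..P} \<Longrightarrow> dist (x e t) (\<phi> t) < \<eta>1"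
    using close[OF \<eta>1] by blast
  have "Min {e0, \<rho>, 1 / (2 * norm E + 1)} > 0" using e0 \<rho> by (simp add: add_nonneg_pos)
  from eventually_at_right_lt[OF this] ev1 Pf_bound show ?thesis
  proof eventually_elim
    case (elim e)
    then have e: "0 < e" "\<bar>e\<bar> < e0" "\<bar>e\<bar> < \<rho>" by auto
    have "e * (2 * norm E + 1) \<le> 1" using elim by (simp add: pos_less_divide_eq add_nonneg_pos)
    \<comment> \<open>This lets the term with \<open>E\<close> be absorbed into half the velocity,
      which gives the bound \<open>2 * K\<close>.\<close>
    then have eE: "e * norm E \<le> 1 / 2" using e by (simp add: algebra_simps)
    have Pf: "Pf e > P / 2" "Pf e < P" "P - Pf e < \<eta>1 / (2 * K)" using elim by auto
    then have PfK: "2 * K * (P - Pf e) \<le> \<eta>1" using K by (simp add: pos_less_divide_eq mult_ac)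
    have near: "norm (x e t - \<phi> t) \<le> \<eta>1" if "t \<in> {0..P}" for t
      using \<rho>(2)[OF e(3) that] by (simp add: dist_norm)
    have xr: "norm (x e t) \<le> r + 1" for t
    proof -
      obtain s where s: "s \<in> {0..Pf e}" "x e s = x e t"
        using periodic_range[of "x e" "Pf e" t, OF x_per[OF e(2)] Pf_pos[OF e(2)]] by blast
      then have "norm (x e s - \<phi> s) \<le> 1" using near[of s] Pf \<eta>14 \<eta> by auto
      then show ?thesis using s(2) r[of s] norm_triangle_ineq2[of "x e s" "\<phi> s"] by simp
    qed
    have x'K: "norm (x' e t) \<le> 2 * K" for t
    proof -
      have "x' e t = F (x e t) - e *\<^sub>R E (x' e t)" using x_eq[OF e(2), of t] by (simp add: algebra_simps)
      then have "norm (x' e t) \<le> norm (F (x e t)) + norm (e *\<^sub>R E (x' e t))"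
        by (metis norm_triangle_ineq4)
      also have "\<dots> \<le> K + e * (norm E * norm (x' e t))"
        using K(2)[OF xr] e(1) norm_blinfun[of E "x' e t"] by (intro add_mono) auto
      also have "e * (norm E * norm (x' e t)) \<le> 1 / 2 * norm (x' e t)"
        unfolding mult.assoc[symmetric] by (intro mult_right_mono eE) auto
      finally show ?thesis by simp
    qed
    have lip: "norm (x e t - x e s) \<le> 2 * K * \<bar>t - s\<bar>" for s t
      using has_vector_derivative_norm_bound[of "min s t" "max s t" "x e" "x' e" 0 "2 * K" s t]
        has_vector_derivative_at_within[OF x[OF e(2)]] x'K by auto
    \<comment> \<open>Negative times are moved into the window by the two periods; their difference
      costs at most \<open>\<eta>1\<close>.\<close>
    have near': "norm (x e t - \<phi> t) \<le> 2 * \<eta>1" if "t \<in> {- h..0}" for t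
    proof -
      have "norm (x e t - \<phi> t) = norm (x e (t + Pf e) - \<phi> (t + P))"
        by (simp add: x_per[OF e(2)] \<phi>_per)
      also have "\<dots> \<le> norm (x e (t + Pf e) - x e (t + P)) + norm (x e (t + P) - \<phi> (t + P))"
        using norm_triangle_ineq[of "x e (t + Pf e) - x e (t + P)" "x e (t + P) - \<phi> (t + P)"] by simp
      also have "\<dots> \<le> \<eta>1 + \<eta>1"
        using lip[of "t + Pf e" "t + P"] PfK Pf near[of "t + P"] that h P by (intro add_mono) auto
      finally show ?thesis by simp
    qed
    have pd: "\<bar>p \<bullet> (x e s - \<phi> 0) - f s\<bar> < m" if "norm (x e s - \<phi> s) \<le> 2 * \<eta>1" for s
    proof -
      have "p \<bullet> (x e s - \<phi> 0) - f s = p \<bullet> (x e s - \<phi> s)" by (simp add: f_def inner_diff_right)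
      also have "\<bar>\<dots>\<bar> \<le> norm p * norm (x e s - \<phi> s)" by (rule Cauchy_Schwarz_ineq2)
      also have "\<dots> \<le> norm p * (2 * \<eta>1)" using that by (intro mult_left_mono) auto
      finally show ?thesis using pm by linarith
    qed
    have "p \<bullet> (x e (- h) - \<phi> 0) \<le> 0" using pd[of "- h"] near'[of "- h"] h by (auto simp: m_def)
    moreover have "0 \<le> p \<bullet> (x e h - \<phi> 0)" using pd[of h] near[of h] h P \<eta>1 by (auto simp: m_def)
    moreover have "continuous_on {- h..h} (\<lambda>s. p \<bullet> (x e s - \<phi> 0))"
      using x[OF e(2)]
      by (intro continuous_intros continuous_at_imp_continuous_on) (auto dest: has_vector_derivative_continuous)
    ultimately obtain s where s: "- h \<le> s" "s \<le> h" "p \<bullet> (x e s - \<phi> 0) = 0"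
      using IVT'[of "\<lambda>s. p \<bullet> (x e s - \<phi> 0)" "- h" 0 h] h by auto
    have "approx e (\<lambda>t. x e (t + s)) (\<lambda>t. x' e (t + s))"
      unfolding approx_def
    proof (intro conjI allI)
      fix t
      have "((\<lambda>t. t + s) has_vector_derivative 1) (at t)" by (auto intro!: derivative_eq_intros)
      from vector_diff_chain_at[OF this x[OF e(2)]]
      show "((\<lambda>t. x e (t + s)) has_vector_derivative x' e (t + s)) (at t)" by (simp add: comp_def)
      show "x' e (t + s) + e *\<^sub>R E (x' e (t + s)) = F (x e (t + s))" by (rule x_eq[OF e(2)])
      show "x e (t + Pf e + s) = x e (t + s)"
        using x_per[OF e(2), of "t + s"] by (simp add: add_ac)
      show "p \<bullet> (x e (0 + s) - \<phi> 0) = 0" using s by simp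
    qed
    moreover have "norm (x e (t + s) - \<phi> t) \<le> \<eta>" if "t \<in> {0..P}" for t
    proof -
      have "norm (x e (t + s) - \<phi> t) \<le> norm (x e (t + s) - x e t) + norm (x e t - \<phi> t)"
        using norm_triangle_ineq[of "x e (t + s) - x e t" "x e t - \<phi> t"] by simp
      also have "\<dots> \<le> 2 * K * \<bar>s\<bar> + \<eta>1" using lip[of "t + s" t] near[OF that] by (intro add_mono) auto
      also have "2 * K * \<bar>s\<bar> \<le> 2 * K * h" using s K by (intro mult_left_mono) auto
      finally show ?thesis using hK \<eta>14 \<eta> by linarith
    qed
    ultimately show ?case using xr x'K by blast
  qed
qed

text \<open>A bootstrap for the deviation \<open>y\<close>. Its change over time \<open>P\<close> is
  \<open>O(e)\<close> because the periods differ by \<open>O(e)\<close>, while the linear flow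
  predicts this change up to \<open>O(e)\<close> plus a small multiple of \<open>norm (y 0)\<close>.
  As \<open>y 0\<close> is orthogonal to \<open>p\<close>, \<open>W_lower_bound\<close> allows that
  multiple to be absorbed, so \<open>y 0\<close>, and by Gronwall all of \<open>y\<close>, is
  \<open>O(e)\<close>.\<close>

lemma approx_linear_rate:
  assumes r: "\<And>t. norm (\<phi> t) \<le> r" and K: "K > 0" "\<And>z. norm z \<le> r + 1 \<Longrightarrow> norm (F z) \<le> K"
    and K': "\<And>z. norm z \<le> r + 1 \<Longrightarrow> norm (F' z) \<le> K"
    and lip: "\<And>y z. norm y \<le> r + 1 \<Longrightarrow> norm z \<le> r + 1 \<Longrightarrow> norm (F y - F z) \<le> K * norm (y - z)"
    and B: "B > 0" "\<And>y z. norm y \<le> r + 1 \<Longrightarrow> norm z \<le> r + 1 \<Longrightarrow>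
      norm (F z - F y - F' y (z - y)) \<le> B * (norm (z - y))\<^sup>2"
  obtains C where "C > 0" "\<forall>\<^sub>F e in at_right 0. \<exists>X X'. approx e X X' \<and> (\<forall>t. norm (X t) \<le> r + 1) \<and>
    (\<forall>t. norm (X' t) \<le> 2 * K) \<and> (\<forall>t\<in>{0..P}. norm (X t - \<phi> t) \<le> C * e)"
proof -
  have \<phi>r: "norm (\<phi> t) \<le> r + 1" for t using r[of t] by simp
  obtain c where c: "c > 0" "\<And>h. p \<bullet> h = 0 \<Longrightarrow> c * norm h \<le> norm (W P h - h)"
    using W_lower_bound by blast
  define G where "G = exp (K * P)"
  have G: "G > 0" by (simp add: G_def)
  define c1 where "c1 = norm E * (2 * K)"
  have c1: "c1 \<ge> 0" using K by (simp add: c1_def)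
  define H where "H = B * G * P * G"
  have H: "H > 0" using B G P by (simp add: H_def)
  \<comment> \<open>One factor of the quadratic remainder is bounded by \<open>\<eta>\<close>, so
    that its share is at most half of the lower bound \<open>c * norm (y 0)\<close>.\<close>
  define \<eta> where "\<eta> = min 1 (c / (2 * H))"
  have \<eta>: "\<eta> > 0" "\<eta> \<le> 1" using c H by (simp_all add: \<eta>_def)
  have "\<eta> \<le> c / (2 * H)" by (simp add: \<eta>_def)
  then have \<eta>H: "H * \<eta> \<le> c / 2" using H by (simp add: pos_le_divide_eq mult_ac)
  define c3 where "c3 = c1 * P * G + H * (c1 * P) + 2 * K * (\<bar>P'\<bar> + 1)"
  define C where "C = (2 * c3 / c + c1 * P) * G"
  have c3: "c3 > 0" using c1 P G H K by (simp add: c3_def add_nonneg_pos)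
  have C: "C > 0" using c3 c1 P G c by (simp add: C_def add_pos_nonneg)
  have ev: "\<forall>\<^sub>F e in at_right 0. \<exists>X X'. approx e X X' \<and> (\<forall>t. norm (X t) \<le> r + 1) \<and>
    (\<forall>t. norm (X' t) \<le> 2 * K) \<and> (\<forall>t\<in>{0..P}. norm (X t - \<phi> t) \<le> \<eta>)"
    by (rule approx_exists) (use r K \<eta> in auto)
  from eventually_at_right_lt[OF zero_less_one] Pf_bound ev
  have "\<forall>\<^sub>F e in at_right 0. \<exists>X X'. approx e X X' \<and> (\<forall>t. norm (X t) \<le> r + 1) \<and>
    (\<forall>t. norm (X' t) \<le> 2 * K) \<and> (\<forall>t\<in>{0..P}. norm (X t - \<phi> t) \<le> C * e)"
  proof eventually_elim
    case (elim e)
    then have e: "0 < e" and Pf: "Pf e < P" "P - Pf e \<le> (\<bar>P'\<bar> + 1) * e" by auto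
    from elim obtain X X' where X: "approx e X X'" "\<And>t. norm (X t) \<le> r + 1"
      "\<And>t. norm (X' t) \<le> 2 * K" "\<And>t. t \<in> {0..P} \<Longrightarrow> norm (X t - \<phi> t) \<le> \<eta>"
      by blast
    have dX: "\<And>t. (X has_vector_derivative X' t) (at t)" and eqX: "\<And>t. X' t + e *\<^sub>R E (X' t) = F (X t)"
      and perX: "\<And>t. X (t + Pf e) = X t" and pX: "p \<bullet> (X 0 - \<phi> 0) = 0"
      using X(1) unfolding approx_def by auto
    have X'eq: "X' t = F (X t) - e *\<^sub>R E (X' t)" for t using eqX[of t] by (simp add: eq_diff_eq)
    have Xper: "X (Pf e) = X 0" using perX[of 0] by simp
    have EX: "norm (e *\<^sub>R E (X' t)) \<le> e * c1" for t
      using e norm_blinfun[of E "X' t"] mult_left_mono[OF X(3)[of t], of "norm E"] by (simp add: c1_def)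
    define y where "y t = X t - \<phi> t" for t
    have dy: "(y has_vector_derivative X' t - F (\<phi> t)) (at t within S)" for t S
      unfolding y_def by (rule has_vector_derivative_at_within[OF has_vector_derivative_diff[OF dX \<phi>]])
    have y: "norm (y t) \<le> (norm (y 0) + e * c1 * P) * G" if t: "t \<in> {0..P}" for t
    proof -
      have "norm (y t) \<le> (norm (y 0) + e * c1 * t) * exp (K * t)"
      proof (rule gronwall[OF dy _ _ _ t])
        fix t
        have "X' t - F (\<phi> t) = (F (X t) - F (\<phi> t)) - e *\<^sub>R E (X' t)" using X'eq[of t] by (simp add: algebra_simps)
        then have "norm (X' t - F (\<phi> t)) \<le> norm (F (X t) - F (\<phi> t)) + norm (e *\<^sub>R E (X' t))"
          by (metis norm_triangle_ineq4)
        then show "norm (X' t - F (\<phi> t)) \<le> K * norm (y t) + e * c1"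
          using lip[OF X(2)[of t] \<phi>r[of t]] EX[of t] by (simp add: y_def)
      qed (use K e c1 in auto)
      also have "\<dots> \<le> (norm (y 0) + e * c1 * P) * exp (K * P)"
        using t K e c1 by (intro mult_mono add_left_mono mult_left_mono exp_le_cancel_iff[THEN iffD2] add_nonneg_nonneg mult_nonneg_nonneg) auto
      finally show ?thesis by (simp add: G_def)
    qed
    define g where "g t = X' t - F (\<phi> t) - F' (\<phi> t) (y t)" for t
    define \<gamma> where "\<gamma> = e * c1 + B * \<eta> * ((norm (y 0) + e * c1 * P) * G)"
    have g: "norm (g t) \<le> \<gamma>" if t: "t \<in> {0..P}" for t
    proof -
      have "g t = (F (X t) - F (\<phi> t) - F' (\<phi> t) (X t - \<phi> t)) - e *\<^sub>R E (X' t)"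
        using X'eq[of t] by (simp add: g_def y_def algebra_simps)
      then have "norm (g t) \<le> norm (F (X t) - F (\<phi> t) - F' (\<phi> t) (X t - \<phi> t)) + norm (e *\<^sub>R E (X' t))"
        by (metis norm_triangle_ineq4)
      also have "\<dots> \<le> B * (norm (y t))\<^sup>2 + e * c1"
        using B(2)[OF \<phi>r X(2)] EX unfolding y_def by (rule add_mono)
      also have "B * (norm (y t))\<^sup>2 \<le> B * (\<eta> * ((norm (y 0) + e * c1 * P) * G))"
        unfolding power2_eq_square using B X(4)[OF t] y[OF t] \<eta>
        by (intro mult_left_mono mult_mono) (auto simp: y_def)
      finally show ?thesis by (simp add: \<gamma>_def mult_ac)
    qed
    have "norm (y P - W P (y 0)) \<le> \<gamma> * P * exp (K * P)"
    proof (rule linear_flow_perturbation[OF K'[OF \<phi>r] W _ g])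
      show "(y has_vector_derivative F' (\<phi> t) (y t) + g t) (at t within {0..P})" for t
        using dy[of t] by (simp add: g_def)
    qed (use P in auto)
    then have yP: "norm (y P - W P (y 0)) \<le> \<gamma> * P * G" by (simp add: G_def)
    \<comment> \<open>\<open>\<phi>\<close> closes up after time \<open>P\<close> and
      \<open>X\<close> after time \<open>Pf e\<close>; the mismatch is the path travelled by
      \<open>X\<close> in between.\<close>
    have "norm (y P - y 0) = norm (X P - X (Pf e))" by (simp add: y_def \<phi>_P Xper)
    also have "\<dots> \<le> 2 * K * (P - Pf e)"
      using has_vector_derivative_norm_bound[of "Pf e" P X X' 0 "2 * K" "Pf e" P]
        has_vector_derivative_at_within[OF dX] X(3) Pf by auto
    also have "\<dots> \<le> 2 * K * ((\<bar>P'\<bar> + 1) * e)" using Pf K by (intro mult_left_mono) auto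
    finally have yy: "norm (y P - y 0) \<le> 2 * K * ((\<bar>P'\<bar> + 1) * e)" .
    have "c * norm (y 0) \<le> norm (W P (y 0) - y 0)" using c(2)[of "y 0"] pX by (simp add: y_def)
    also have "\<dots> \<le> norm (y P - W P (y 0)) + norm (y P - y 0)"
      using norm_triangle_ineq4[of "y P - y 0" "y P - W P (y 0)"] by (simp add: algebra_simps)
    also have "\<dots> \<le> \<gamma> * P * G + 2 * K * ((\<bar>P'\<bar> + 1) * e)" using yP yy by (rule add_mono)
    also have "\<dots> = e * (c1 * P * G) + (H * \<eta>) * norm (y 0) + (H * \<eta>) * (e * (c1 * P)) + 2 * K * ((\<bar>P'\<bar> + 1) * e)"
      by (simp add: \<gamma>_def H_def algebra_simps)
    also have "\<dots> \<le> e * (c1 * P * G) + c / 2 * norm (y 0) + H * (e * (c1 * P)) + 2 * K * ((\<bar>P'\<bar> + 1) * e)"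
      using \<eta>H \<eta> H e c1 P by (intro add_mono mult_right_mono order_refl) (auto simp: mult_left_le)
    also have "\<dots> = c / 2 * norm (y 0) + c3 * e" by (simp add: c3_def algebra_simps)
    finally have "c * norm (y 0) \<le> 2 * c3 * e" by simp
    then have y0: "norm (y 0) \<le> 2 * c3 / c * e" using c by (simp add: pos_le_divide_eq mult_ac)
    have "norm (X t - \<phi> t) \<le> C * e" if "t \<in> {0..P}" for t
    proof -
      have "norm (y t) \<le> (2 * c3 / c * e + e * c1 * P) * G"
        using G by (intro order_trans[OF y[OF that]] mult_right_mono add_right_mono y0) auto
      then show ?thesis by (simp add: C_def y_def algebra_simps)
    qed
    then show ?case using X by blast
  qed
  then show ?thesis using that C by blast
qed

text \<open>The deviation \<open>y\<close> solves the variational equation with forcing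
  \<open>- e E \<phi>'\<close> up to \<open>O(e\<^sup>2)\<close>, so pairing with \<open>q\<close>
  gives \<open>p \<bullet> (y P - y 0) = - e k + O(e\<^sup>2)\<close>. Geometrically the same change
  is \<open>(P - Pf e) F (\<phi> 0)\<close> to first order, whose pairing with \<open>p\<close> is
  \<open>P - Pf e\<close>.\<close>

lemma period_derivative:
  assumes q: "continuous_on {0..P} q"
    and adj: "\<And>y g. (\<And>t. t \<in> {0..P} \<Longrightarrow> (y has_vector_derivative F' (\<phi> t) (y t) + g t) (at t within {0..P})) \<Longrightarrow>
       ((\<lambda>t. q t \<bullet> g t) has_integral (p \<bullet> (y P - y 0))) {0..P}"
  shows "integral {0..P} (\<lambda>t. q t \<bullet> E (F (\<phi> t))) = P'"
proof -
  obtain r where r: "r > 0" "\<And>t. norm (\<phi> t) \<le> r" using bounded_\<phi> by blast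
  obtain K B where K: "K > 0" "\<And>z. norm z \<le> r + 1 \<Longrightarrow> norm (F z) \<le> K"
    and K': "\<And>z. norm z \<le> r + 1 \<Longrightarrow> norm (F' z) \<le> K"
    and lip: "\<And>y z. norm y \<le> r + 1 \<Longrightarrow> norm z \<le> r + 1 \<Longrightarrow> norm (F y - F z) \<le> K * norm (y - z)"
    and B: "B > 0" "\<And>y z. norm y \<le> r + 1 \<Longrightarrow> norm z \<le> r + 1 \<Longrightarrow>
      norm (F z - F y - F' y (z - y)) \<le> B * (norm (z - y))\<^sup>2"
    using C2_map_estimates[OF C2, of "r + 1"] by metis
  have \<phi>r: "norm (\<phi> t) \<le> r + 1" for t using r(2)[of t] by simp
  obtain C where C: "C > 0" "\<forall>\<^sub>F e in at_right 0. \<exists>X X'. approx e X X' \<and> (\<forall>t. norm (X t) \<le> r + 1) \<and>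
    (\<forall>t. norm (X' t) \<le> 2 * K) \<and> (\<forall>t\<in>{0..P}. norm (X t - \<phi> t) \<le> C * e)"
    by (rule approx_linear_rate[of r K B]) (use r K K' lip B in blast)+
  have "bounded (q ` {0..P})" by (intro compact_imp_bounded compact_continuous_image q) auto
  then obtain Q where Q: "Q > 0" "\<And>t. t \<in> {0..P} \<Longrightarrow> norm (q t) \<le> Q"
    unfolding bounded_pos by auto
  define k where "k = integral {0..P} (\<lambda>t. q t \<bullet> E (F (\<phi> t)))"
  have contF\<phi>: "continuous_on S (\<lambda>t. F (\<phi> t))" for S
    by (rule continuous_on_compose2[OF C2_map_continuous(1)[OF C2] cont_\<phi>]) auto
  have kint: "((\<lambda>t. q t \<bullet> E (F (\<phi> t))) has_integral k) {0..P}"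
    unfolding k_def by (intro integrable_integral integrable_continuous_interval continuous_intros q contF\<phi>)
  have \<phi>lip: "norm (\<phi> t - \<phi> s) \<le> K * \<bar>t - s\<bar>" for s t
    using has_vector_derivative_norm_bound[of "min s t" "max s t" \<phi> "\<lambda>t. F (\<phi> t)" 0 K s t]
      has_vector_derivative_at_within[OF \<phi>] K(2)[OF \<phi>r] by auto
  define c1 where "c1 = norm E * (2 * K)"
  define c2 where "c2 = \<bar>P'\<bar> + 1"
  define D where "D = K * C + c1"
  \<comment> \<open>The first summand bounds the error of the integral, the second that of replacing
    the displacement by time difference times velocity.\<close>
  define C' where "C' = Q * (norm E * D + B * C\<^sup>2) * P + norm p * ((D + K * K * c2) * c2)"
  have D0: "D \<ge> 0" using K C by (simp add: D_def c1_def)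
  have c20: "c2 > 0" by (simp add: c2_def add_nonneg_pos)
  from eventually_at_right_lt[OF zero_less_one] Pf_bound C(2)
    eventually_at_right_lt[OF e0]
  have "\<forall>\<^sub>F e in at_right 0. \<bar>(Pf e - P) / e - k\<bar> \<le> C' * e"
  proof eventually_elim
    case (elim e)
    then have e: "0 < e" and Pf: "Pf e < P" "P - Pf e \<le> c2 * e" by (auto simp: c2_def)
    have Pf0: "Pf e > 0" using elim by (intro Pf_pos) auto
    from elim obtain X X' where X: "approx e X X'" "\<And>t. norm (X t) \<le> r + 1"
      "\<And>t. norm (X' t) \<le> 2 * K" "\<And>t. t \<in> {0..P} \<Longrightarrow> norm (X t - \<phi> t) \<le> C * e"
      by blast
    have dX: "\<And>t. (X has_vector_derivative X' t) (at t)" and eqX: "\<And>t. X' t + e *\<^sub>R E (X' t) = F (X t)"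
      and perX: "\<And>t. X (t + Pf e) = X t"
      using X(1) unfolding approx_def by auto
    have X'eq: "X' t = F (X t) - e *\<^sub>R E (X' t)" for t using eqX[of t] by (simp add: eq_diff_eq)
    have Xper: "X (Pf e) = X 0" using perX[of 0] by simp
    have EX: "norm (e *\<^sub>R E (X' t)) \<le> e * c1" for t
      using e norm_blinfun[of E "X' t"] mult_left_mono[OF X(3)[of t], of "norm E"] by (simp add: c1_def)
    have X'\<phi>: "norm (X' t - F (\<phi> t)) \<le> D * e" if t: "t \<in> {0..P}" for t
    proof -
      have "X' t - F (\<phi> t) = (F (X t) - F (\<phi> t)) - e *\<^sub>R E (X' t)" using X'eq[of t] by (simp add: algebra_simps)
      then have "norm (X' t - F (\<phi> t)) \<le> norm (F (X t) - F (\<phi> t)) + norm (e *\<^sub>R E (X' t))"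
        by (metis norm_triangle_ineq4)
      also have "\<dots> \<le> K * (C * e) + e * c1"
        using order_trans[OF lip[OF X(2) \<phi>r] mult_left_mono[OF X(4)[OF t]]] K EX
        by (intro add_mono) auto
      finally show ?thesis by (simp add: D_def algebra_simps)
    qed
    define y where "y t = X t - \<phi> t" for t
    define g where "g t = X' t - F (\<phi> t) - F' (\<phi> t) (y t)" for t
    have dy: "(y has_vector_derivative F' (\<phi> t) (y t) + g t) (at t within S)" for t S
    proof -
      have "(y has_vector_derivative X' t - F (\<phi> t)) (at t within S)"
        unfolding y_def by (rule has_vector_derivative_at_within[OF has_vector_derivative_diff[OF dX \<phi>]])
      then show ?thesis by (simp add: g_def)
    qed
    have I: "((\<lambda>t. q t \<bullet> g t + e * (q t \<bullet> E (F (\<phi> t)))) has_integral (p \<bullet> (y P - y 0) + e * k)) {0..P}"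
      by (intro has_integral_add adj dy has_integral_mult_right kint)
    have "norm (p \<bullet> (y P - y 0) + e * k) \<le> Q * (norm E * D + B * C\<^sup>2) * e\<^sup>2 * measure lborel (cbox 0 P)"
    proof (rule has_integral_bound)
      show "0 \<le> Q * (norm E * D + B * C\<^sup>2) * e\<^sup>2" using Q B D0 by simp
      show "((\<lambda>t. q t \<bullet> g t + e * (q t \<bullet> E (F (\<phi> t)))) has_integral (p \<bullet> (y P - y 0) + e * k)) (cbox 0 P)"
        using I by simp
      fix t assume "t \<in> cbox 0 P"
      then have t: "t \<in> {0..P}" by simp
      define R where "R = F (X t) - F (\<phi> t) - F' (\<phi> t) (X t - \<phi> t)"
      \<comment> \<open>Removing the leading forcing leaves the Taylor remainder and the effect of
        \<open>E\<close> on the velocity difference, both of order \<open>e\<^sup>2\<close>.\<close>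
      have "g t + e *\<^sub>R E (F (\<phi> t)) = R - e *\<^sub>R E (X' t - F (\<phi> t))"
        using eqX[of t] by (simp add: g_def R_def y_def blinfun.diff_right algebra_simps)
      then have "q t \<bullet> g t + e * (q t \<bullet> E (F (\<phi> t))) = q t \<bullet> (R - e *\<^sub>R E (X' t - F (\<phi> t)))"
        by (metis inner_add_right inner_scaleR_right)
      then have "norm (q t \<bullet> g t + e * (q t \<bullet> E (F (\<phi> t)))) \<le> norm (q t) * norm (R - e *\<^sub>R E (X' t - F (\<phi> t)))"
        using Cauchy_Schwarz_ineq2 by simp
      also have "\<dots> \<le> Q * (norm R + norm (e *\<^sub>R E (X' t - F (\<phi> t))))"
        using Q Q(2)[OF t] by (intro mult_mono norm_triangle_ineq4) auto
      also have "\<dots> \<le> Q * (B * (C * e)\<^sup>2 + e * (norm E * (D * e)))"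
      proof (intro mult_left_mono add_mono)
        show "norm R \<le> B * (C * e)\<^sup>2"
          unfolding R_def using B(1) X(4)[OF t]
          by (intro order_trans[OF B(2)[OF \<phi>r X(2)]] mult_left_mono power_mono) auto
        show "norm (e *\<^sub>R E (X' t - F (\<phi> t))) \<le> e * (norm E * (D * e))"
          using e order_trans[OF norm_blinfun mult_left_mono[OF X'\<phi>[OF t] norm_ge_zero[of E]]] by simp
      qed (use Q in auto)
      finally show "norm (q t \<bullet> g t + e * (q t \<bullet> E (F (\<phi> t)))) \<le> Q * (norm E * D + B * C\<^sup>2) * e\<^sup>2"
        by (simp add: power2_eq_square algebra_simps)
    qed
    then have 1: "\<bar>p \<bullet> (y P - y 0) + e * k\<bar> \<le> Q * (norm E * D + B * C\<^sup>2) * P * e\<^sup>2"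
      using P by (simp add: mult_ac)
    have "norm (X P - X (Pf e) - (P - Pf e) *\<^sub>R F (\<phi> 0)) \<le> (D * e + K * (K * (P - Pf e))) * \<bar>P - Pf e\<bar>"
    proof (rule has_vector_derivative_norm_bound[OF has_vector_derivative_at_within[OF dX]])
      fix t assume t: "t \<in> {Pf e..P}"
      have "norm (X' t - F (\<phi> 0)) \<le> norm (X' t - F (\<phi> t)) + norm (F (\<phi> t) - F (\<phi> P))"
        using norm_triangle_ineq[of "X' t - F (\<phi> t)" "F (\<phi> t) - F (\<phi> P)"] by (simp add: \<phi>_P)
      also have "norm (F (\<phi> t) - F (\<phi> P)) \<le> K * (K * \<bar>t - P\<bar>)"
        using K by (intro order_trans[OF lip[OF \<phi>r \<phi>r]] mult_left_mono \<phi>lip) auto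
      also have "\<dots> \<le> K * (K * (P - Pf e))" using t K by (intro mult_left_mono) auto
      also have "norm (X' t - F (\<phi> t)) \<le> D * e" using t Pf0 by (intro X'\<phi>) auto
      finally show "norm (X' t - F (\<phi> 0)) \<le> D * e + K * (K * (P - Pf e))" by simp
    qed (use Pf in auto)
    also have "\<dots> \<le> (D * e + K * (K * (c2 * e))) * (c2 * e)"
      using Pf K D0 e c20 by (intro mult_mono add_left_mono mult_left_mono add_nonneg_nonneg mult_nonneg_nonneg) auto
    also have "\<dots> = (D + K * K * c2) * c2 * e\<^sup>2" by (simp add: power2_eq_square algebra_simps)
    finally have X2: "norm (X P - X (Pf e) - (P - Pf e) *\<^sub>R F (\<phi> 0)) \<le> (D + K * K * c2) * c2 * e\<^sup>2" .
    have "p \<bullet> (X P - X (Pf e) - (P - Pf e) *\<^sub>R F (\<phi> 0)) = p \<bullet> (y P - y 0) - (P - Pf e)"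
      by (simp add: y_def \<phi>_P Xper inner_diff_right pu)
    then have 2: "\<bar>p \<bullet> (y P - y 0) - (P - Pf e)\<bar> \<le> norm p * ((D + K * K * c2) * c2 * e\<^sup>2)"
      using order_trans[OF Cauchy_Schwarz_ineq2 mult_left_mono[OF X2 norm_ge_zero[of p]]] by metis
    have "\<bar>(P - Pf e) + e * k\<bar> \<le> C' * e\<^sup>2"
      using 1 2 by (simp add: C'_def algebra_simps)
    moreover have "(Pf e - P) / e - k = - ((P - Pf e) + e * k) / e"
      using e by (simp add: field_simps)
    ultimately show ?case
      using e by (simp add: pos_divide_le_eq power2_eq_square mult.assoc)
  qed
  then have ev: "\<forall>\<^sub>F e in at_right 0. norm ((Pf e - P) / e - k) \<le> C' * e" by simp
  have "((\<lambda>e. C' * e) \<longlongrightarrow> C' * 0) (at_right 0)" by (rule tendsto_mult_left[OF tendsto_ident_at])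
  then have "((\<lambda>e. C' * e) \<longlongrightarrow> 0) (at_right 0)" by simp
  then have "((\<lambda>e. (Pf e - P) / e - k) \<longlongrightarrow> 0) (at_right 0)"
    by (rule Lim_null_comparison[OF ev])
  then have "((\<lambda>e. (Pf e - P) / e) \<longlongrightarrow> k) (at_right 0)"
    by (rule LIM_zero_cancel)
  from tendsto_unique[OF trivial_limit_at_right_real this Pf_quotient]
  show ?thesis by (simp add: k_def)
qed

end

section \<open>Instability of the synchronous orbit\<close>

locale lipschitz_flow =
  fixes G :: "'a::euclidean_space \<Rightarrow> 'a" and K :: real and U :: "'a \<Rightarrow> real \<Rightarrow> 'a"
  assumes K: "K > 0" and lip: "\<And>x y. norm (G x - G y) \<le> K * norm (x - y)"
    and U_0: "\<And>x. U x 0 = x"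
    and dU: "\<And>x t. t \<ge> 0 \<Longrightarrow> (U x has_vector_derivative G (U x t)) (at t within {0..})"
begin

lemma dU': "t \<in> {0..T} \<Longrightarrow> (U x has_vector_derivative G (U x t)) (at t within {0..T})"
  by (rule has_vector_derivative_within_subset[OF dU]) auto

lemma solution_dist:
  assumes "\<And>t. t \<in> {0..T} \<Longrightarrow> (y has_vector_derivative G (y t)) (at t within {0..T})"
    and t: "t \<in> {0..T}"
  shows "norm (U x t - y t) \<le> norm (x - y 0) * exp (K * t)"
proof -
  have "norm (U x t - y t) \<le> (norm (U x 0 - y 0) + 0 * t) * exp (K * t)"
    by (rule gronwall[OF has_vector_derivative_diff[OF dU' assms(1)] _ _ _ t]) (use K lip in auto)
  then show ?thesis by (simp add: U_0)
qed

lemma solution_unique: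
  assumes "\<And>t. t \<in> {0..T} \<Longrightarrow> (y has_vector_derivative G (y t)) (at t within {0..T})"
    and t: "t \<in> {0..T}"
  shows "U (y 0) t = y t"
  using solution_dist[OF assms, of "y 0"] by simp

lemma semigroup:
  assumes "s \<ge> 0" "t \<ge> 0"
  shows "U x (s + t) = U (U x s) t"
proof -
  have "U ((\<lambda>t. U x (s + t)) 0) t = (\<lambda>t. U x (s + t)) t"
  proof (rule solution_unique)
    show "t \<in> {0..t}" using assms by simp
    fix \<tau> assume \<tau>: "\<tau> \<in> {0..t}"
    have "(U x has_vector_derivative G (U x (s + \<tau>))) (at (s + \<tau>) within (\<lambda>\<tau>. s + \<tau>) ` {0..t})"
      by (rule has_vector_derivative_within_subset[OF dU]) (use \<tau> assms in auto)
    moreover have "((\<lambda>\<tau>. s + \<tau>) has_vector_derivative 1) (at \<tau> within {0..t})"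
      by (auto intro!: derivative_eq_intros)
    ultimately have "((U x \<circ> (\<lambda>\<tau>. s + \<tau>)) has_vector_derivative 1 *\<^sub>R G (U x (s + \<tau>))) (at \<tau> within {0..t})"
      by (intro vector_diff_chain_within)
    then show "((\<lambda>t. U x (s + t)) has_vector_derivative G (U x (s + \<tau>))) (at \<tau> within {0..t})"
      by (simp add: comp_def)
  qed
  then show ?thesis by simp
qed

text \<open>The smallness of \<open>w\<close> keeps the nonlinear deviation within distance 1 over
  the whole period, where the quadratic remainder \<open>R\<close> is available; Gronwall for the
  difference of the nonlinear and the linear deviation then gives a quadratic error.\<close>

lemma linearization_error:
  assumes \<gamma>: "\<And>t. t \<in> {0..P} \<Longrightarrow> (\<gamma> has_vector_derivative G (\<gamma> t)) (at t within {0..P})"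
    and V: "\<And>t. t \<in> {0..P} \<Longrightarrow> (V has_vector_derivative B t (V t)) (at t within {0..P})" "V 0 = w"
    and B: "\<And>t. linear (B t)" "\<And>t y. norm (B t y) \<le> K * norm y"
    and R: "\<And>t y. norm y \<le> 1 \<Longrightarrow> norm (G (\<gamma> t + y) - G (\<gamma> t) - B t y) \<le> C * (norm y)\<^sup>2"
    and C: "C \<ge> 0" and P: "P \<ge> 0" and w: "norm w * exp (K * P) \<le> 1"
  shows "norm (U (\<gamma> 0 + w) P - \<gamma> P - V P) \<le> C * (exp (K * P))\<^sup>2 * P * exp (K * P) * (norm w)\<^sup>2"
proof -
  define y where "y t = U (\<gamma> 0 + w) t - \<gamma> t" for t
  have y: "norm (y t) \<le> norm w * exp (K * P)" if t: "t \<in> {0..P}" for t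
  proof -
    have "norm (y t) \<le> norm (\<gamma> 0 + w - \<gamma> 0) * exp (K * t)"
      unfolding y_def by (rule solution_dist[OF \<gamma> t])
    also have "\<dots> \<le> norm w * exp (K * P)" using t K by (simp add: mult_left_mono)
    finally show ?thesis .
  qed
  define e where "e t = y t - V t" for t
  have "norm (e P) \<le> (norm (e 0) + C * (norm w * exp (K * P))\<^sup>2 * P) * exp (K * P)"
  proof (rule gronwall)
    fix t assume t: "t \<in> {0..P}"
    show "(e has_vector_derivative G (U (\<gamma> 0 + w) t) - G (\<gamma> t) - B t (V t)) (at t within {0..P})"
      unfolding e_def y_def
      by (intro has_vector_derivative_diff dU' \<gamma> V t)
    have "G (U (\<gamma> 0 + w) t) - G (\<gamma> t) - B t (V t) = (G (\<gamma> t + y t) - G (\<gamma> t) - B t (y t)) + B t (e t)"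
      by (simp add: y_def e_def linear_diff[OF B(1)])
    also have "norm \<dots> \<le> norm (G (\<gamma> t + y t) - G (\<gamma> t) - B t (y t)) + norm (B t (e t))"
      by (rule norm_triangle_ineq)
    also have "\<dots> \<le> C * (norm (y t))\<^sup>2 + K * norm (e t)"
      using y[OF t] w by (intro add_mono R B) auto
    also have "C * (norm (y t))\<^sup>2 \<le> C * (norm w * exp (K * P))\<^sup>2"
      using y[OF t] C by (intro mult_left_mono power_mono) auto
    finally show "norm (G (U (\<gamma> 0 + w) t) - G (\<gamma> t) - B t (V t)) \<le> K * norm (e t) + C * (norm w * exp (K * P))\<^sup>2"
      by simp
  qed (use K C P in auto)
  moreover have "e 0 = 0" by (simp add: e_def y_def U_0 V(2))
  ultimately show ?thesis by (simp add: e_def y_def power_mult_distrib mult_ac)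
qed

end

lemma lipschitz_flow_exists:
  fixes G :: "'a::euclidean_space \<Rightarrow> 'a"
  assumes K: "K > 0" and lip: "\<And>x y. norm (G x - G y) \<le> K * norm (x - y)"
  obtains U where "lipschitz_flow G K U"
proof -
  have "K-lipschitz_on UNIV G"
    using K lip by (intro lipschitz_onI) (auto simp: dist_norm)
  then have cont: "continuous_on UNIV G" by (rule lipschitz_on_continuous_on)
  have "\<exists>u. u 0 = x \<and> (\<forall>t\<ge>0. (u has_vector_derivative G (u t)) (at t within {0..}))" for x
  proof (rule picard_global[of "\<lambda>_. G" K x "norm (G x)"])
    show "continuous_on UNIV (\<lambda>p. G (snd p))"
      by (rule continuous_on_compose2[OF cont]) (auto intro!: continuous_intros)
  qed (use K lip in auto)
  then obtain U where U: "\<And>x. U x 0 = x" "\<And>x t. t \<ge> 0 \<Longrightarrow> (U x has_vector_derivative G (U x t)) (at t within {0..})"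
    by metis
  have "lipschitz_flow G K U" by unfold_locales (use K lip U in auto)
  then show ?thesis by (rule that)
qed

section \<open>Mean and deviations over the patches\<close>

lemma norm_vec_le_card:
  fixes u :: "'a::real_normed_vector^'n"
  assumes "\<And>j. norm (u $ j) \<le> c"
  shows "norm u \<le> real CARD('n) * c"
proof -
  have "norm u \<le> (\<Sum>j\<in>UNIV. norm (u $ j))" unfolding norm_vec_def by (rule L2_set_le_sum) auto
  also have "\<dots> \<le> (\<Sum>j\<in>(UNIV::'n set). c)" by (intro sum_mono assms)
  finally show ?thesis by simp
qed

lemma has_vector_derivative_vec_lambda:
  fixes f :: "'n::finite \<Rightarrow> real \<Rightarrow> 'a::real_normed_vector"
  assumes "\<And>j. (f j has_vector_derivative f' j) F"
  shows "((\<lambda>t. \<chi> j. f j t) has_vector_derivative (\<chi> j. f' j)) F"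
proof -
  define emb where "emb j x = (\<chi> i. if i = j then x else 0)" for j :: 'n and x :: 'a
  have bl: "bounded_linear (emb j)" for j
  proof (rule bounded_linear_intro)
    show "norm (emb j x) \<le> norm x * real CARD('n)" for x
      using norm_vec_le_card[of "emb j x" "norm x"] by (simp add: emb_def mult.commute)
  qed (auto simp: emb_def vec_eq_iff)
  have emb: "(\<chi> j. g j) = (\<Sum>j\<in>UNIV. emb j (g j))" for g :: "'n \<Rightarrow> 'a"
    by (simp add: emb_def vec_eq_iff)
  show ?thesis
    unfolding emb
    by (intro has_vector_derivative_sum bounded_linear.has_vector_derivative[OF bl] assms)
qed

definition mean :: "'a::real_vector^'n \<Rightarrow> 'a" where
  "mean u = (1 / real CARD('n)) *\<^sub>R (\<Sum>j\<in>UNIV. u $ j)"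

lemma sum_diff_mean: "(\<Sum>j\<in>UNIV. u $ j - mean u) = 0"
  by (simp add: mean_def sum_subtractf scaleR_conv_of_real sum_constant_scaleR)

lemma mean_linear: "linear mean"
  by (rule linearI) (simp_all add: mean_def sum.distrib scaleR_add_right scaleR_sum_right mult.commute)

lemma norm_mean_le: "norm (mean u) \<le> norm (u :: 'a::real_normed_vector^'n)"
proof -
  have "norm (\<Sum>j\<in>UNIV. u $ j) \<le> (\<Sum>j\<in>(UNIV::'n set). norm u)"
    by (rule sum_norm_le) (rule Finite_Cartesian_Product.norm_nth_le)
  then show ?thesis by (simp add: mean_def divide_simps mult.commute)
qed

lemma norm_diff_mean_le: "norm (u $ j - mean u) \<le> 2 * norm (u :: 'a::real_normed_vector^'n)"
  using norm_triangle_ineq4[of "u $ j" "mean u"] norm_mean_le[of u] Finite_Cartesian_Product.norm_nth_le[of u j] by simp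

text \<open>The coupling is the negative Laplacian of the complete graph on the patches: it kills
  the mean and multiplies deviations from it by minus the number of patches. This is the origin of
  \<open>d = n \<delta>\<close>.\<close>

lemma patch_field_nth:
  "patch_field \<delta> E F u $ j = F (u $ j) - (\<delta> * real CARD('n)) *\<^sub>R (E *v (u $ j - mean u))"
  for u :: "real^'m^'n"
proof -
  have "(\<Sum>i\<in>UNIV. u $ i - u $ j) = - (real CARD('n) *\<^sub>R (u $ j - mean u))"
    by (simp add: mean_def sum_subtractf sum_constant_scaleR scaleR_diff_right del: sum_constant)
  moreover have "patch_field \<delta> E F u $ j = \<delta> *\<^sub>R (E *v (\<Sum>i\<in>UNIV. u $ i - u $ j)) + F (u $ j)"
    by (simp add: patch_field_def vec_eq_iff matrix_vector_mult_def sum_distrib_left)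
  moreover have "E *v (- (c *\<^sub>R x)) = - (c *\<^sub>R (E *v x))" for c x
    using matrix_vector_mult_scaleR[of E "- c" x] by simp
  ultimately show ?thesis by simp
qed

text \<open>The abstract instability result is applied to the period map around the synchronous
  state at time 0, with a difference of two patches as the observable. Only the deviations supply
  growth; of the mean it is required that it grows no faster than the upper rate
  \<open>b\<close>.\<close>

lemma patch_unstable_of_transversal_eigenvalue:
  fixes F :: "real^'m \<Rightarrow> real^'m" and E :: "real^'m^'m" and Eb :: "(real^'m) \<Rightarrow>\<^sub>L (real^'m)"
  assumes n: "CARD('n) \<ge> 2" and orbit: "periodic_orbit F F' \<phi> P"
    and W: "linear_flow (\<lambda>t. F' (\<phi> t)) P W"
    and Wpow: "\<And>\<beta>. \<beta> > 1 \<Longrightarrow> \<exists>C. \<forall>k x. norm ((W P ^^ k) x) \<le> C * \<beta> ^ k * norm x"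
    and Eb: "\<And>x. Eb x = E *v x" and \<delta>: "\<delta> > 0"
    and V: "linear_flow (\<lambda>t. F' (\<phi> t) - (\<delta> * real CARD('n)) *\<^sub>R Eb) P V"
    and q: "V P q = g *\<^sub>R q" "q \<noteq> 0" "g > 1"
  shows "\<not> orbitally_stable (patch_field \<delta> E F :: real^'m^'n \<Rightarrow> real^'m^'n)
    ((\<lambda>t. (\<chi> j. \<phi> t) :: real^'m^'n) ` {0..P})"
proof
  assume stable: "orbitally_stable (patch_field \<delta> E F :: real^'m^'n \<Rightarrow> real^'m^'n)
    ((\<lambda>t. (\<chi> j. \<phi> t) :: real^'m^'n) ` {0..P})"
  interpret periodic_orbit F F' \<phi> P by (rule orbit)
  obtain r where r: "r > 0" "\<And>t. norm (\<phi> t) \<le> r" using bounded_\<phi> by blast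
  obtain K B where K: "K > 0" "\<And>z. norm z \<le> r + 1 \<Longrightarrow> norm (F' z) \<le> K"
    and Flip: "\<And>y z. norm y \<le> r + 1 \<Longrightarrow> norm z \<le> r + 1 \<Longrightarrow> norm (F y - F z) \<le> K * norm (y - z)"
    and B: "B > 0" "\<And>y z. norm y \<le> r + 1 \<Longrightarrow> norm z \<le> r + 1 \<Longrightarrow>
      norm (F z - F y - F' y (z - y)) \<le> B * (norm (z - y))\<^sup>2"
    using C2_map_estimates[OF C2, of "r + 1"] by metis
  have \<phi>r: "norm (\<phi> t) \<le> r + 1" for t using r(2)[of t] by simp
  have PP: "P \<in> {0..P}" using P by simp
  define N where "N = real CARD('n)"
  have N: "N > 0" by (simp add: N_def)
  define d where "d = \<delta> * N"
  have d: "d > 0" using \<delta> N by (simp add: d_def)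
  \<comment> \<open>Composing with the projection onto a ball makes the field globally Lipschitz
    without changing it within distance 1 of the orbit.\<close>
  define F1 where "F1 = F \<circ> closest_point (cball 0 (r + 1))"
  have F1_eq: "F1 z = F z" if "norm z \<le> r + 1" for z
    using that by (simp add: F1_def closest_point_self)
  have F1_lip: "norm (F1 y - F1 z) \<le> K * norm (y - z)" for y z
  proof -
    have mem: "norm (closest_point (cball 0 (r + 1)) z) \<le> r + 1" for z :: "real^'m"
      using closest_point_in_set[of "cball 0 (r + 1)" z] r by auto
    have "norm (F1 y - F1 z) \<le> K * norm (closest_point (cball 0 (r + 1)) y - closest_point (cball 0 (r + 1)) z)"
      unfolding F1_def comp_def by (rule Flip[OF mem mem])
    also have "\<dots> \<le> K * norm (y - z)"
      using closest_point_lipschitz[of "cball 0 (r + 1)" y z] r K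
      by (intro mult_left_mono) (auto simp: dist_norm)
    finally show ?thesis .
  qed
  define G :: "real^'m^'n \<Rightarrow> real^'m^'n" where "G = patch_field \<delta> E F1"
  have G_nth: "G u $ j = F1 (u $ j) - d *\<^sub>R Eb (u $ j - mean u)" for u j
    by (simp add: G_def patch_field_nth d_def N_def Eb)
  define Kg where "Kg = N * (K + d * (norm Eb * 2))"
  have Kg: "Kg > 0" using N K d by (simp add: Kg_def add_pos_nonneg)
  have Ebm: "norm (d *\<^sub>R Eb (u $ j - mean u)) \<le> d * (norm Eb * 2) * norm u" for u :: "real^'m^'n" and j
  proof -
    have "norm (Eb (u $ j - mean u)) \<le> norm Eb * (2 * norm u)"
      by (rule order_trans[OF norm_blinfun mult_left_mono[OF norm_diff_mean_le]]) simp
    then show ?thesis using d by (simp add: mult_left_mono mult.assoc)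
  qed
  have G_lip: "norm (G u - G v) \<le> Kg * norm (u - v)" for u v
  proof -
    have "norm ((G u - G v) $ j) \<le> (K + d * (norm Eb * 2)) * norm (u - v)" for j
    proof -
      have "(G u - G v) $ j = (F1 (u $ j) - F1 (v $ j)) - d *\<^sub>R Eb ((u - v) $ j - mean (u - v))"
        by (simp add: G_nth linear_diff[OF mean_linear] blinfun.diff_right blinfun.add_right algebra_simps)
      also have "norm \<dots> \<le> norm (F1 (u $ j) - F1 (v $ j)) + norm (d *\<^sub>R Eb ((u - v) $ j - mean (u - v)))"
        by (rule norm_triangle_ineq4)
      also have "\<dots> \<le> K * norm (u - v) + d * (norm Eb * 2) * norm (u - v)"
      proof (rule add_mono[OF _ Ebm])
        have "norm (u $ j - v $ j) \<le> norm (u - v)"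
          using Finite_Cartesian_Product.norm_nth_le[of "u - v" j] by simp
        then show "norm (F1 (u $ j) - F1 (v $ j)) \<le> K * norm (u - v)"
          using K by (intro order_trans[OF F1_lip] mult_left_mono) auto
      qed
      finally show ?thesis by (simp add: algebra_simps)
    qed
    from norm_vec_le_card[of "G u - G v", OF this] show ?thesis by (simp add: Kg_def N_def mult.assoc)
  qed
  obtain U where "lipschitz_flow G Kg U" using lipschitz_flow_exists[OF Kg G_lip] by blast
  then interpret flow: lipschitz_flow G Kg U .
  define \<gamma> :: "real \<Rightarrow> real^'m^'n" where "\<gamma> t = (\<chi> j. \<phi> t)" for t
  have mean_const: "mean ((\<chi> j. z) :: real^'m^'n) = z" for z
    by (simp add: mean_def sum_constant_scaleR del: sum_constant)
  have \<gamma>': "(\<gamma> has_vector_derivative G (\<gamma> t)) (at t within S)" for t S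
  proof -
    have "G (\<gamma> t) = (\<chi> j. F (\<phi> t))" by (simp add: vec_eq_iff G_nth \<gamma>_def mean_const F1_eq[OF \<phi>r])
    then show ?thesis
      unfolding \<gamma>_def by (simp only:) (intro has_vector_derivative_vec_lambda has_vector_derivative_at_within[OF \<phi>])
  qed
  \<comment> \<open>The linearised flow: \<open>W\<close> transports the mean, \<open>V\<close> the
    deviations. Deviations have sum 0 and keep it under the linear map \<open>V t\<close>, so the
    splitting is invariant.\<close>
  define L where "L t w = (\<chi> j. W t (mean w) + V t (w $ j - mean w))" for t and w :: "real^'m^'n"
  define A where "A t w = (\<chi> j. F' (\<phi> t) (w $ j) - d *\<^sub>R Eb (w $ j - mean w))" for t and w :: "real^'m^'n"
  have KV: "norm (F' (\<phi> t) - d *\<^sub>R Eb) \<le> K + d * norm Eb" for t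
    using norm_triangle_ineq4[of "F' (\<phi> t)" "d *\<^sub>R Eb"] K(2)[OF \<phi>r, of t] d by simp
  have V: "linear_flow (\<lambda>t. F' (\<phi> t) - d *\<^sub>R Eb) P V" using V by (simp add: d_def N_def)
  have Wlin: "linear (W t)" if "t \<in> {0..P}" for t by (rule linear_flow_linear[OF K(2)[OF \<phi>r] W that])
  have Vlin: "linear (V t)" if "t \<in> {0..P}" for t by (rule linear_flow_linear[OF KV V that])
  have sumV: "(\<Sum>j\<in>UNIV. V t (w $ j - mean w)) = 0" if "t \<in> {0..P}" for t and w :: "real^'m^'n"
    by (simp only: linear_sum[OF Vlin[OF that], symmetric] sum_diff_mean linear_0[OF Vlin[OF that]])
  have mean_L: "mean (L t w) = W t (mean w)" if "t \<in> {0..P}" for t w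
    unfolding mean_def[of "L t w"] using sumV[OF that, of w]
    by (simp add: L_def sum.distrib sum_constant_scaleR del: sum_constant)
  have L': "((\<lambda>t. L t w) has_vector_derivative A t (L t w)) (at t within {0..P})" if t: "t \<in> {0..P}" for t w
  proof -
    have dev: "L t w $ j - mean (L t w) = V t (w $ j - mean w)" for j
      unfolding mean_L[OF t] by (simp add: L_def)
    have "A t (L t w) $ j = F' (\<phi> t) (W t (mean w)) + (F' (\<phi> t) - d *\<^sub>R Eb) (V t (w $ j - mean w))" for j
      unfolding A_def vec_lambda_beta dev
      by (simp add: L_def blinfun.add_right blinfun.diff_left blinfun.scaleR_left)
    then have "A t (L t w) = (\<chi> j. F' (\<phi> t) (W t (mean w)) + (F' (\<phi> t) - d *\<^sub>R Eb) (V t (w $ j - mean w)))"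
      by (simp add: vec_eq_iff[of "A t _"])
    moreover have "((\<lambda>t. L t w) has_vector_derivative (\<chi> j. F' (\<phi> t) (W t (mean w)) + (F' (\<phi> t) - d *\<^sub>R Eb) (V t (w $ j - mean w)))) (at t within {0..P})"
      unfolding L_def using W V t
      by (intro has_vector_derivative_vec_lambda has_vector_derivative_add) (auto simp: linear_flow_def)
    ultimately show ?thesis by simp
  qed
  have L0: "L 0 w = w" for w using W V by (simp add: L_def linear_flow_def vec_eq_iff)
  have Alin: "linear (A t)" for t
    by (rule linearI) (simp_all add: A_def vec_eq_iff linear_add[OF mean_linear] linear_scale[OF mean_linear]
        blinfun.add_right blinfun.diff_right blinfun.scaleR_right algebra_simps)
  have An: "norm (A t w) \<le> Kg * norm w" for t w
  proof -
    have "norm (A t w $ j) \<le> (K + d * (norm Eb * 2)) * norm w" for j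
    proof -
      have "norm (A t w $ j) \<le> norm (F' (\<phi> t) (w $ j)) + norm (d *\<^sub>R Eb (w $ j - mean w))"
        unfolding A_def vec_lambda_beta by (rule norm_triangle_ineq4)
      also have "norm (F' (\<phi> t) (w $ j)) \<le> K * norm w"
        using K by (intro order_trans[OF norm_blinfun] mult_mono K(2)[OF \<phi>r] Finite_Cartesian_Product.norm_nth_le) auto
      finally show ?thesis using Ebm[of w j] by (simp add: algebra_simps)
    qed
    from norm_vec_le_card[of "A t w", OF this] show ?thesis by (simp add: Kg_def N_def mult.assoc)
  qed
  have AR: "norm (G (\<gamma> t + y) - G (\<gamma> t) - A t y) \<le> N * B * (norm y)\<^sup>2" if y: "norm y \<le> 1" for t y
  proof -
    have "norm ((G (\<gamma> t + y) - G (\<gamma> t) - A t y) $ j) \<le> B * (norm y)\<^sup>2" for j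
    proof -
      have yj: "norm (y $ j) \<le> norm y" by (rule Finite_Cartesian_Product.norm_nth_le)
      have ry: "norm (\<phi> t + y $ j) \<le> r + 1"
        using norm_triangle_ineq[of "\<phi> t" "y $ j"] r(2)[of t] yj y by linarith
      have "(G (\<gamma> t + y) - G (\<gamma> t) - A t y) $ j = F (\<phi> t + y $ j) - F (\<phi> t) - F' (\<phi> t) (\<phi> t + y $ j - \<phi> t)"
        by (simp add: G_nth A_def \<gamma>_def[of t, symmetric] linear_add[OF mean_linear] blinfun.add_right blinfun.diff_right algebra_simps)
          (simp add: \<gamma>_def F1_eq[OF ry] F1_eq[OF \<phi>r] add.commute[of _ "\<phi> t"])
      then have "norm ((G (\<gamma> t + y) - G (\<gamma> t) - A t y) $ j) \<le> B * (norm (\<phi> t + y $ j - \<phi> t))\<^sup>2"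
        using B(2)[OF \<phi>r[of t] ry] by (simp only:)
      also have "\<dots> \<le> B * (norm y)\<^sup>2" using B(1) yj by (intro mult_left_mono power_mono) auto
      finally show ?thesis .
    qed
    from norm_vec_le_card[of "G (\<gamma> t + y) - G (\<gamma> t) - A t y", OF this] show ?thesis by (simp add: N_def mult.assoc)
  qed
  \<comment> \<open>The period map centred at \<open>\<gamma> 0\<close>. The centre stays fixed
    under iteration, so phase drift is simply part of the mean.\<close>
  define T where "T w = U (\<gamma> 0 + w) P - \<gamma> 0" for w
  have \<gamma>P: "\<gamma> P = \<gamma> 0" by (simp add: \<gamma>_def \<phi>_P)
  \<comment> \<open>A deviation of this size remains at most 1 throughout the next period.\<close>
  define c0 where "c0 = 1 / exp (Kg * P)"
  have c0: "c0 > 0" by (simp add: c0_def)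
  have c0': "norm w * exp (Kg * P) \<le> 1" if "norm w \<le> c0" for w :: "real^'m^'n"
    using that by (simp add: c0_def pos_le_divide_eq)
  define C3 where "C3 = N * B * (exp (Kg * P))\<^sup>2 * P * exp (Kg * P)"
  have TL: "norm (T w - L P w) \<le> C3 * (norm w)\<^sup>2" if "norm w \<le> c0" for w
    using flow.linearization_error[of P \<gamma> "\<lambda>t. L t w" A w "N * B", OF \<gamma>' L' L0 Alin An AR _ _ c0'[OF that]]
      N B P by (simp add: T_def \<gamma>P C3_def)
  have Vbl: "bounded_linear (V P)" by (rule linear_flow_bounded_linear[OF KV V PP])
  obtain a b C where ab: "1 < a" "1 < b" "b < a\<^sup>2" "0 < C"
    and VC: "\<And>k x. norm ((V P ^^ k) x) \<le> C * b ^ k * norm x"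
    and rec: "\<And>n. \<exists>N\<ge>n. \<exists>v. norm ((V P ^^ N) v) = 1 \<and> (\<forall>k\<le>N. norm ((V P ^^ k) v) * a ^ (N - k) \<le> 2)"
    using growth_along_record_times[OF Vbl q] by metis
  obtain C0 where C0: "\<And>k x. norm ((W P ^^ k) x) \<le> C0 * b ^ k * norm x" using Wpow[OF ab(2)] by blast
  have Llin: "linear (L P)"
    by (rule linearI) (simp_all add: L_def vec_eq_iff linear_add[OF mean_linear] linear_scale[OF mean_linear]
        linear_add[OF Wlin[OF PP]] linear_scale[OF Wlin[OF PP]] linear_add[OF Vlin[OF PP]] linear_diff[OF Vlin[OF PP]]
        linear_scale[OF Vlin[OF PP]] algebra_simps)
  have Lk: "(L P ^^ k) w = (\<chi> j. (W P ^^ k) (mean w) + (V P ^^ k) (w $ j - mean w))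
      \<and> mean ((L P ^^ k) w) = (W P ^^ k) (mean w)" for k w
  proof (induction k)
    case (Suc k)
    have m: "mean ((L P ^^ k) w) = (W P ^^ k) (mean w)" using Suc by blast
    have "(L P ^^ k) w $ j = (W P ^^ k) (mean w) + (V P ^^ k) (w $ j - mean w)" for j
      by (simp only: Suc[THEN conjunct1] vec_lambda_beta)
    then have dev: "(L P ^^ k) w $ j - mean ((L P ^^ k) w) = (V P ^^ k) (w $ j - mean w)" for j
      by (simp add: m)
    have "(L P ^^ Suc k) w = L P ((L P ^^ k) w)" by simp
    moreover have "L P ((L P ^^ k) w) = (\<chi> j. (W P ^^ Suc k) (mean w) + (V P ^^ Suc k) (w $ j - mean w))"
      unfolding L_def[of P "(L P ^^ k) w"] dev by (simp add: m)
    moreover have "mean (L P ((L P ^^ k) w)) = (W P ^^ Suc k) (mean w)"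
      by (simp add: mean_L[OF PP] m)
    ultimately show ?case by (simp only:)
  qed (simp add: vec_eq_iff)
  define CL where "CL = N * (\<bar>C0\<bar> + 2 * C)"
  have CL: "CL > 0" using N ab by (simp add: CL_def add_nonneg_pos)
  have Lb: "norm ((L P ^^ k) w) \<le> CL * b ^ k * norm w" for k w
  proof -
    have "norm ((L P ^^ k) w $ j) \<le> (\<bar>C0\<bar> + 2 * C) * b ^ k * norm w" for j
    proof -
      have "norm ((L P ^^ k) w $ j) \<le> norm ((W P ^^ k) (mean w)) + norm ((V P ^^ k) (w $ j - mean w))"
        using Lk[of k w] by (simp add: norm_triangle_ineq)
      also have "\<dots> \<le> \<bar>C0\<bar> * b ^ k * norm w + C * b ^ k * (2 * norm w)"
      proof (rule add_mono)
        have "C0 * b ^ k * norm (mean w) \<le> \<bar>C0\<bar> * b ^ k * norm w"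
          using ab norm_mean_le[of w] by (intro mult_mono) auto
        then show "norm ((W P ^^ k) (mean w)) \<le> \<bar>C0\<bar> * b ^ k * norm w"
          by (rule order_trans[OF C0])
        show "norm ((V P ^^ k) (w $ j - mean w)) \<le> C * b ^ k * (2 * norm w)"
          using ab by (intro order_trans[OF VC] mult_left_mono norm_diff_mean_le) auto
      qed
      finally show ?thesis by (simp add: algebra_simps)
    qed
    from norm_vec_le_card[of "(L P ^^ k) w", OF this] show ?thesis by (simp add: CL_def N_def mult.assoc)
  qed
  obtain i j :: 'n where ij: "i \<noteq> j"
  proof (rule ccontr)
    assume "\<not> thesis"
    then have "(UNIV :: 'n set) = {undefined}" using that by blast
    then have "CARD('n) = card {undefined :: 'n}" by (rule arg_cong)
    then show False using n by simp
  qed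
  \<comment> \<open>It vanishes on synchronous states and has norm at most 2, so half of
    \<open>norm (D w)\<close> bounds the distance from the orbit from below.\<close>
  define D where "D w = w $ i - w $ j" for w :: "real^'m^'n"
  have Dn: "norm (D w) \<le> 2 * norm w" for w
    using norm_triangle_ineq4[of "w $ i" "w $ j"] Finite_Cartesian_Product.norm_nth_le[of w i] Finite_Cartesian_Product.norm_nth_le[of w j] by (simp add: D_def)
  have Dbl: "bounded_linear D"
    by (rule bounded_linear_intro[of _ 2]) (use Dn in \<open>auto simp: D_def algebra_simps\<close>)
  \<comment> \<open>Opposite perturbations of two patches have mean 0; they evolve by
    \<open>V\<close> alone and carry its growth into the patch model.\<close>
  define emb where "emb v = (\<chi> k. if k = i then v else if k = j then - v else 0)" for v :: "real^'m"
  have mean_emb: "mean (emb v) = 0" for v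
  proof -
    have "(\<Sum>k\<in>UNIV. emb v $ k) = (\<Sum>k\<in>UNIV. (if k = i then v else 0) + (if k = j then - v else 0))"
      using ij by (intro sum.cong) (auto simp: emb_def)
    then show ?thesis by (simp add: mean_def sum.distrib)
  qed
  have Vk: "linear (V P ^^ k)" for k by (intro bounded_linear.linear bounded_linear_funpow Vbl)
  have Wk: "(W P ^^ k) 0 = 0" for k by (induction k) (auto simp: linear_0[OF Wlin[OF PP]])
  have L_emb: "(L P ^^ k) (emb v) = emb ((V P ^^ k) v)" for k v
  proof -
    have "(L P ^^ k) (emb v) = (\<chi> l. (V P ^^ k) (emb v $ l))"
      by (simp add: Lk[THEN conjunct1] mean_emb Wk)
    also have "\<dots> = (\<chi> l. emb ((V P ^^ k) v) $ l)"
      by (intro arg_cong[of _ _ vec_lambda] ext) (simp add: emb_def linear_0[OF Vk] linear_neg[OF Vk])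
    finally show ?thesis by simp
  qed
  have D_emb: "D (emb v) = 2 *\<^sub>R v" for v using ij by (simp add: D_def emb_def scaleR_2)
  have norm_emb: "norm (emb v) \<le> N * norm v" for v
    unfolding N_def by (rule norm_vec_le_card) (simp add: emb_def)
  have rec': "\<exists>M\<ge>m. \<exists>v. norm (D ((L P ^^ M) v)) \<ge> 1 \<and> (\<forall>k\<le>M. norm ((L P ^^ k) v) * a ^ (M - k) \<le> N * 2)" for m :: nat
  proof -
    obtain M v where M: "M \<ge> m" "norm ((V P ^^ M) v) = 1" "\<And>k. k \<le> M \<Longrightarrow> norm ((V P ^^ k) v) * a ^ (M - k) \<le> 2"
      using rec by blast
    have "norm ((L P ^^ k) (emb v)) * a ^ (M - k) \<le> N * 2" if "k \<le> M" for k
    proof -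
      have "norm ((L P ^^ k) (emb v)) * a ^ (M - k) \<le> (N * norm ((V P ^^ k) v)) * a ^ (M - k)"
        unfolding L_emb using ab by (intro mult_right_mono norm_emb) auto
      also have "\<dots> \<le> N * 2" using M(3)[OF that] N by (simp add: mult.assoc)
      finally show ?thesis .
    qed
    moreover have "norm (D ((L P ^^ M) (emb v))) \<ge> 1" using M(2) by (simp add: L_emb D_emb)
    ultimately show ?thesis using M(1) by blast
  qed
  have Lbl: "bounded_linear (L P)" using Llin by (simp add: linear_conv_bounded_linear)
  have b0: "b > 0" using ab by simp
  have C3: "C3 \<ge> 0" using N B P by (simp add: C3_def)
  have N2: "N * 2 > 0" using N by simp
  obtain e where e: "e > 0" "\<And>\<rho>. \<rho> > 0 \<Longrightarrow> \<exists>w M. norm w < \<rho> \<and> (\<forall>k\<le>M. norm ((T ^^ k) w) \<le> c0) \<and> norm (D ((T ^^ M) w)) \<ge> e"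
    using quadratic_perturbation_unstable[OF Lbl Dbl ab(1) b0 ab(3) CL Lb c0 C3 TL rec' N2] by blast
  have "\<gamma> = (\<lambda>t. \<chi> j. \<phi> t)" by (simp add: fun_eq_iff \<gamma>_def)
  then have "orbitally_stable (patch_field \<delta> E F) (\<gamma> ` {0..P})" using stable by simp
  then obtain \<rho> where \<rho>: "\<rho> > 0" "\<forall>S y. S \<ge> 0 \<and>
      (\<forall>t\<in>{0..S}. (y has_vector_derivative patch_field \<delta> E F (y t)) (at t within {0..S})) \<and>
      infdist (y 0) (\<gamma> ` {0..P}) < \<rho> \<longrightarrow> (\<forall>t\<in>{0..S}. infdist (y t) (\<gamma> ` {0..P}) < e / 2)"
    unfolding orbitally_stable_def using half_gt_zero[OF e(1)] by blast
  obtain w M where w: "norm w < \<rho>" "\<And>k. k \<le> M \<Longrightarrow> norm ((T ^^ k) w) \<le> c0" "norm (D ((T ^^ M) w)) \<ge> e"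
    using e(2)[OF \<rho>(1)] by blast
  define y where "y = U (\<gamma> 0 + w)"
  have yk: "y (real k * P) = \<gamma> 0 + (T ^^ k) w" for k
  proof (induction k)
    case 0
    show ?case by (simp add: y_def flow.U_0)
  next
    case (Suc k)
    have "y (real (Suc k) * P) = U (y (real k * P)) P"
      using flow.semigroup[of "real k * P" P "\<gamma> 0 + w"] P by (simp add: y_def algebra_simps)
    then show ?case by (simp add: Suc T_def)
  qed
  \<comment> \<open>At multiples of the period the deviation is at most \<open>c0\<close>, hence at
    most 1 in between. The solution never leaves the region where \<open>F1\<close> equals
    \<open>F\<close> and so solves the original system.\<close>
  have y_ball: "norm (y t $ l) \<le> r + 1" if t: "t \<in> {0..real M * P}" for t l
  proof -
    define k where "k = nat \<lfloor>t / P\<rfloor>"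
    define s where "s = t - real k * P"
    have k: "real k = of_int \<lfloor>t / P\<rfloor>" using t P by (simp add: k_def)
    have kt: "real k * P \<le> t" using P by (simp add: k pos_le_divide_eq[symmetric])
    have "t < (real k + 1) * P" using P by (simp add: k pos_divide_less_eq[symmetric])
    then have s: "s \<in> {0..P}" using kt by (auto simp: s_def algebra_simps)
    have "real k * P \<le> real M * P" using kt t by auto
    then have kM: "k \<le> M" using P by simp
    have "y t = U (y (real k * P)) s"
      using flow.semigroup[of "real k * P" s "\<gamma> 0 + w"] P s by (simp add: y_def s_def)
    then have yt: "y t = U (\<gamma> 0 + (T ^^ k) w) s" by (simp add: yk)
    have "norm (y t - \<gamma> s) \<le> norm (\<gamma> 0 + (T ^^ k) w - \<gamma> 0) * exp (Kg * s)"
      unfolding yt by (rule flow.solution_dist[OF \<gamma>' s])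
    also have "\<dots> \<le> norm ((T ^^ k) w) * exp (Kg * P)"
      using s Kg by (simp add: mult_left_mono)
    also have "\<dots> \<le> 1" by (rule c0'[OF w(2)[OF kM]])
    finally have "norm ((y t - \<gamma> s) $ l) \<le> 1"
      using Finite_Cartesian_Product.norm_nth_le[of "y t - \<gamma> s" l] by linarith
    then show ?thesis
      using norm_triangle_ineq2[of "y t $ l" "\<phi> s"] r(2)[of s] by (simp add: \<gamma>_def)
  qed
  have ysol: "(y has_vector_derivative patch_field \<delta> E F (y t)) (at t within {0..real M * P})"
    if t: "t \<in> {0..real M * P}" for t
  proof -
    have "G (y t) = patch_field \<delta> E F (y t)"
      unfolding G_def
      by (simp add: vec_eq_iff[of "patch_field \<delta> E F1 (y t)"] patch_field_nth F1_eq[OF y_ball[OF t]])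
    then show ?thesis using flow.dU'[OF t, of "\<gamma> 0 + w"] by (simp add: y_def)
  qed
  have "infdist (y 0) (\<gamma> ` {0..P}) \<le> dist (y 0) (\<gamma> 0)"
    using P by (intro infdist_le) auto
  also have "\<dots> < \<rho>" using w(1) by (simp add: y_def flow.U_0 dist_norm)
  finally have y0: "infdist (y 0) (\<gamma> ` {0..P}) < \<rho>" .
  have MP: "real M * P \<ge> 0" using P by simp
  then have "infdist (y (real M * P)) (\<gamma> ` {0..P}) < e / 2"
    using \<rho>(2)[rule_format, of "real M * P" y "real M * P"] ysol y0 by simp
  moreover have "e / 2 \<le> infdist (y (real M * P)) (\<gamma> ` {0..P})"
  proof (subst infdist_notempty, use P in simp, rule cINF_greatest, use P in simp)
    fix z assume "z \<in> \<gamma> ` {0..P}"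
    then obtain t where z: "z = \<gamma> t" by blast
    \<comment> \<open>\<open>D\<close> annihilates both \<open>\<gamma> 0\<close> and
      \<open>\<gamma> t\<close>, so the bound holds against every point of the orbit.\<close>
    have "D (y (real M * P) - \<gamma> t) = D ((T ^^ M) w)" by (simp add: yk D_def \<gamma>_def)
    then show "e / 2 \<le> dist (y (real M * P)) z"
      using w(3) Dn[of "y (real M * P) - \<gamma> t"] by (simp add: dist_norm z)
  qed
  ultimately show False by simp
qed

lemma fundamental_matrix_linear_flow:
  fixes A :: "real \<Rightarrow> (real^'m) \<Rightarrow>\<^sub>L (real^'m)"
  assumes "fundamental_matrix (\<lambda>t. matrix (blinfun_apply (A t))) \<Phi>"
  shows "linear_flow A T (\<lambda>t x. \<Phi> t *v x)"
  unfolding linear_flow_def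
proof (intro conjI allI ballI)
  show "\<Phi> 0 *v x = x" for x using assms by (simp add: fundamental_matrix_def)
  fix x t
  have "(\<Phi> has_vector_derivative (matrix (blinfun_apply (A t)) ** \<Phi> t)) (at t within {0..T})"
    using assms by (auto simp: fundamental_matrix_def intro: has_vector_derivative_at_within)
  moreover have "bounded_linear (\<lambda>M :: real^'m^'m. M *v x)"
    by (intro linear_conv_bounded_linear[THEN iffD1] linearI)
      (simp_all add: matrix_vector_mult_add_rdistrib scaleR_matrix_vector_assoc)
  ultimately have "((\<lambda>t. \<Phi> t *v x) has_vector_derivative ((matrix (blinfun_apply (A t)) ** \<Phi> t) *v x)) (at t within {0..T})"
    by (rule bounded_linear.has_vector_derivative[rotated])
  also have "(matrix (blinfun_apply (A t)) ** \<Phi> t) *v x = A t (\<Phi> t *v x)"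
    unfolding matrix_vector_mul_assoc[symmetric]
    by (rule fun_cong[OF matrix_vector_mul(3)[OF blinfun.bounded_linear_right]])
  finally show "((\<lambda>t. \<Phi> t *v x) has_vector_derivative A t (\<Phi> t *v x)) (at t within {0..T})" .
qed

theorem theorem2p3:
  fixes F :: "real^'m \<Rightarrow> real^'m" and F' :: "real^'m \<Rightarrow> ((real^'m) \<Rightarrow>\<^sub>L (real^'m))"
    and E :: "real^'m^'m" and \<phi> :: "real \<Rightarrow> real^'m" and P :: real
    and Pf :: "real \<Rightarrow> real" and P' :: real
  assumes "CARD('n) \<ge> 2"
    and "C2_map F F'"
    and "periodic_solution (mat 1) F \<phi> P"
    and "floquet_hyp (\<lambda>t. matrix (blinfun_apply (F' (\<phi> t)))) P"
    and "is_period_function F E \<phi> P Pf"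
    and "(Pf has_real_derivative P') (at 0)"
    and "P' < 0"
  shows "\<exists>\<delta>0>0. \<forall>\<delta>. 0 < \<delta> \<and> \<delta> < \<delta>0 \<longrightarrow>
           \<not> orbitally_stable (patch_field \<delta> E F :: real^'m^'n \<Rightarrow> real^'m^'n)
                ((\<lambda>t. (\<chi> j. \<phi> t) :: real^'m^'n) ` {0..P})"
proof -
  have P: "P > 0" and \<phi>: "\<And>t. (\<phi> has_vector_derivative F (\<phi> t)) (at t)"
    and per: "\<And>t. \<phi> (t + P) = \<phi> t" and minP: "\<And>q. 0 < q \<Longrightarrow> q < P \<Longrightarrow> \<exists>t. \<phi> (t + q) \<noteq> \<phi> t"
    using assms(3) unfolding periodic_solution_def by auto
  have orbit: "periodic_orbit F F' \<phi> P"
    by unfold_locales (use assms(2) P \<phi> per in auto)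
  then interpret orbit: periodic_orbit F F' \<phi> P .
  obtain r where r: "r > 0" "\<And>t. norm (\<phi> t) \<le> r" using orbit.bounded_\<phi> by blast
  obtain K where K: "\<And>t. norm (F' (\<phi> t)) \<le> K"
    using C2_map_estimates[OF assms(2), of r] r(2) by metis
  obtain \<Phi> where \<Phi>: "fundamental_matrix (\<lambda>t. matrix (blinfun_apply (F' (\<phi> t)))) \<Phi>"
    and order: "order 1 (char_poly_cmat (\<Phi> P)) = 1"
    and roots: "\<And>z. poly (char_poly_cmat (\<Phi> P)) z = 0 \<Longrightarrow> z = 1 \<or> cmod z < 1"
    using assms(4) unfolding floquet_hyp_def by blast
  define W where "W t x = \<Phi> t *v x" for t x
  have W: "linear_flow (\<lambda>t. F' (\<phi> t)) P W"
    using fundamental_matrix_linear_flow[OF \<Phi>] unfolding W_def .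
  have WF: "F (\<phi> t) = W t (F (\<phi> 0))" if "t \<in> {0..P}" for t
    by (rule linear_flow_unique[OF K W has_vector_derivative_at_within[OF orbit.velocity] that])
  have u: "\<Phi> P *v F (\<phi> 0) = F (\<phi> 0)"
    using WF[of P] P by (simp add: W_def orbit.\<phi>_P)
  \<comment> \<open>Zero velocity at one time would propagate along the linear flow and make
    \<open>\<phi>\<close> constant, contradicting the minimality of \<open>P\<close> at the
    candidate period \<open>P / 2\<close>.\<close>
  have u0: "F (\<phi> 0) \<noteq> 0"
  proof
    assume "F (\<phi> 0) = 0"
    then have F0: "F (\<phi> t) = 0" if "t \<in> {0..P}" for t using WF[OF that] by (simp add: W_def)
    have "F (\<phi> t) = 0" for t
      using periodic_range[of \<phi> P t, OF per P] F0 by metis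
    then have const: "\<phi> t = \<phi> 0" for t
      using has_vector_derivative_zero_constant[of UNIV \<phi>] \<phi> by (metis UNIV_I convex_UNIV)
    obtain t where "\<phi> (t + P / 2) \<noteq> \<phi> t" using minP[of "P / 2"] P by auto
    then show False using const[of "t + P / 2"] const[of t] by simp
  qed
  obtain p where p: "\<And>x. p \<bullet> (\<Phi> P *v x) = p \<bullet> x" "p \<bullet> F (\<phi> 0) = 1"
    "\<And>h. \<Phi> P *v h = h \<Longrightarrow> p \<bullet> h = 0 \<Longrightarrow> h = 0"
    using left_eigenvector_exists[OF order u u0] by blast
  define Eb where "Eb = Blinfun (\<lambda>x. E *v x)"
  have Eb: "Eb x = E *v x" for x
    unfolding Eb_def by (simp add: bounded_linear_Blinfun_apply matrix_vector_mul_bounded_linear)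
  obtain \<phi>e e0 where e0: "e0 > 0" and Pf0: "Pf 0 = P"
    and fam: "\<And>e. \<bar>e\<bar> < e0 \<Longrightarrow> periodic_solution (mat 1 + e *\<^sub>R E) F (\<phi>e e) (Pf e)"
    and close: "\<And>\<eta>. \<eta> > 0 \<Longrightarrow> \<exists>\<rho>>0. \<forall>e. \<bar>e\<bar> < \<rho> \<longrightarrow> (\<forall>t\<in>{0..P}. dist (\<phi>e e t) (\<phi> t) < \<eta>)"
    using assms(5) unfolding is_period_function_def by blast
  have mul: "(mat 1 + e *\<^sub>R E) *v v = v + e *\<^sub>R Eb v" for e v
    by (simp add: matrix_vector_mult_add_rdistrib scaleR_matrix_vector_assoc Eb)
  have "\<forall>e t. \<exists>v. \<bar>e\<bar> < e0 \<longrightarrow> (\<phi>e e has_vector_derivative v) (at t) \<and> v + e *\<^sub>R Eb v = F (\<phi>e e t)"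
    using fam unfolding periodic_solution_def mul by blast
  then obtain \<phi>' where \<phi>': "\<And>e t. \<bar>e\<bar> < e0 \<Longrightarrow> (\<phi>e e has_vector_derivative \<phi>' e t) (at t)"
    "\<And>e t. \<bar>e\<bar> < e0 \<Longrightarrow> \<phi>' e t + e *\<^sub>R Eb (\<phi>' e t) = F (\<phi>e e t)"
    by metis
  interpret perturbed_family F F' \<phi> P W p Eb \<phi>e \<phi>' Pf P' e0
    by unfold_locales
      (use W p e0 \<phi>' fam close Pf0 assms(6,7) in \<open>auto simp: W_def periodic_solution_def\<close>)
  obtain q where q: "continuous_on {0..P} q"
    "\<And>y g. (\<And>t. t \<in> {0..P} \<Longrightarrow> (y has_vector_derivative F' (\<phi> t) (y t) + g t) (at t within {0..P})) \<Longrightarrow>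
       ((\<lambda>t. q t \<bullet> g t) has_integral (p \<bullet> (y P - y 0))) {0..P}"
    by (rule adjoint_solution_exists[OF orbit.cont_F' K less_imp_le[OF P] W, of p])
      (use p in \<open>auto simp: W_def\<close>)
  have "integral {0..P} (\<lambda>t. q t \<bullet> Eb (F (\<phi> t))) = P'"
    by (rule period_derivative[OF q])
  then have neg: "integral {0..P} (\<lambda>t. q t \<bullet> Eb (F (\<phi> t))) < 0" using assms(7) by simp
  have ev: "x \<le> 1" if "W P v = x *\<^sub>R v" "v \<noteq> 0" for x v
    using roots[OF eigenvalue_imp_char_root[of "\<Phi> P" v x]] that by (auto simp: W_def)
  have "\<exists>d0>0. \<forall>d. 0 < d \<and> d < d0 \<longrightarrow>
    (\<exists>V. linear_flow (\<lambda>t. F' (\<phi> t) - d *\<^sub>R Eb) P V \<and> (\<exists>x>1. \<exists>v. v \<noteq> 0 \<and> V P v = x *\<^sub>R v))"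
    by (rule transversal_eigenvalue[OF q(1) _ _ neg]) (use q(2) ev in blast)+
  then obtain d0 where d0: "d0 > 0" "\<And>d. 0 < d \<Longrightarrow> d < d0 \<Longrightarrow>
    \<exists>V. linear_flow (\<lambda>t. F' (\<phi> t) - d *\<^sub>R Eb) P V \<and> (\<exists>x>1. \<exists>v. v \<noteq> 0 \<and> V P v = x *\<^sub>R v)"
    by blast
  have "cmod z \<le> 1" if "poly (char_poly_cmat (\<Phi> P)) z = 0" for z using roots[OF that] by auto
  then have Wpow: "\<exists>C. \<forall>k x. norm ((W P ^^ k) x) \<le> C * \<beta> ^ k * norm x" if "\<beta> > 1" for \<beta>
    using power_growth_of_char_roots[OF _ that] unfolding W_def by blast
  have N: "real CARD('n) > 0" by simp
  have "\<not> orbitally_stable (patch_field \<delta> E F :: real^'m^'n \<Rightarrow> real^'m^'n)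
                ((\<lambda>t. (\<chi> j. \<phi> t) :: real^'m^'n) ` {0..P})"
    if \<delta>: "0 < \<delta>" "\<delta> < d0 / real CARD('n)" for \<delta>
  proof -
    have "0 < \<delta> * real CARD('n)" "\<delta> * real CARD('n) < d0"
      using \<delta> N by (simp_all add: pos_less_divide_eq)
    from d0(2)[OF this] obtain V x v where "linear_flow (\<lambda>t. F' (\<phi> t) - (\<delta> * real CARD('n)) *\<^sub>R Eb) P V"
      "V P v = x *\<^sub>R v" "v \<noteq> 0" "x > 1" by blast
    then show ?thesis
      using patch_unstable_of_transversal_eigenvalue[where V = V, OF assms(1) orbit W _ Eb \<delta>(1)] Wpow by blast
  qed
  \<comment> \<open>The threshold for \<open>\<delta>\<close> is that for \<open>d\<close> divided
    by the number of patches.\<close>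
  then show ?thesis using d0(1) N by (intro exI[of _ "d0 / real CARD('n)"]) simp
qed

end
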